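(* Let $\alpha>0$, $\varphi(z)=\alpha(\log^+|z|)^2$, and $\lambda_n=e^{\frac{1+n}{2\alpha}}$ for $n\ge 0$. Let $\Gamma=\{\gamma_n : n\ge 0\}\subset\mathbb{C}$ be a sequence of pairwise distinct points with $|\gamma_n|\le|\gamma_{n+1}|$ for all $n\geq 0$, and write $\gamma_n=\lambda_n e^{\delta_n}e^{i\theta_n}$ with $\delta_n,\theta_n\in\mathbb{R}$. Let $q$ denote the Hölder conjugate of $p$ ($1/p+1/q=1$, with $1/q=0$ if $p=1$). Consider the conditions (a) $\Gamma$ is $d_\rho$-separated; (b) $(\delta_n)_{n\ge0}$ is a bounded real sequence. Then: A) For $1\le p<4/3$: $\Gamma\setminus\{*\}$ is a complete interpolating sequence for $\mathcal{F}^p_\varphi$ if and only if (a) and (b) hold and there exists an integer $N\ge1$ such that $$-\left(\frac{1}{4\alpha}+\frac{1}{q\alpha}\right)<\nabla_N\le\Delta_N<\frac{1}{4\alpha}-\frac{1}{q\alpha}.$$ B) For $4/3<p<4$: $\Gamma$ is a complete interpolating sequence for $\mathcal{F}^p_\varphi$ if and only if (a) and (b) hold and there exists an integer $N\ge1$ such that $$\frac{1}{4\alpha}-\frac{1}{q\alpha}<\nabla_N\le\Delta_N<\frac{1}{p\alpha}-\frac{1}{4\alpha}.$$ C) For $4<p<\infty$: $\Gamma\cup\{*\}$ is a complete interpolating sequence for $\mathcal{F}^p_\varphi$ if and only if (a) and (b) hold and there exists an integer $N\ge1$ such that $$\frac{1}{p\alpha}-\frac{1}{4\alpha}<\nabla_N\le\Delta_N<\frac{1}{p\alpha}+\frac{1}{4\alpha}.$$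 Here $\Gamma\setminus\{*\}$ is the sequence obtained by removing any one point from $\Gamma$, and $\Gamma\cup\{*\}$ is $\Gamma$ together with any one point of $\mathbb{C}\setminus\Gamma$ (the equivalences hold whichever point is chosen).
   Context: For $1\le p<\infty$, $\mathcal{F}^p_\varphi$ is the Banach space of entire functions $f$ with $\|f\|_{p,\varphi}^p:=\int_{\mathbb{C}}|f(z)e^{-\varphi(z)}|^p\,dm(z)<\infty$, where $dm$ is area Lebesgue measure on $\mathbb{C}$, and $\log^+ x=\max(\log x,0)$. For a countable set $S\subset\mathbb{C}$ and a family $v=(v_s)_{s\in S}$ of complex numbers put $\|v\|_{p,\varphi,S}^p:=\sum_{s\in S}(1+|s|)^2|v_s|^p e^{-p\varphi(s)}$; for a function $f$, $\|f\|_{p,\varphi,S}$ is this quantity with $v_s=f(s)$. - $S$ is sampling for $\mathcal{F}^p_\varphi$ if there is $C\ge1$ with $\frac1C\|f\|_{p,\varphi}^p\le\|f\|_{p,\varphi,S}^p\le C\|f\|_{p,\varphi}^p$ for all $f\in\mathcal{F}^p_\varphi$. - $S$ is interpolating for $\mathcal{F}^p_\varphi$ if for every $v=(v_s)_{s\in S}$ with $\|v\|_{p,\varphi,S}<\infty$ there is $f\in\mathcal{F}^p_\varphi$ with $f(s)=v_s$ for all $s\in S$. - $S$ is a complete interpolating sequence (or set) for $\mathcal{F}^p_\varphi$ if it is both sampling and interpolating for $\mathcal{F}^p_\varphi$. Let $\rho(z)=|z|/\sqrt{2\alpha}$ and $d_\rho(z,w)=\dfrac{|z-w|}{1+\min\{\rho(z),\rho(w)\}}$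 for $z,w\in\mathbb{C}$. A set $S\subset\mathbb{C}$ is $d_\rho$-separated if $\inf\{d_\rho(s,s'): s\ne s',\ s,s'\in S\}>0$. For the real sequence $(\delta_n)_{n\geq 0}$ and a positive integer $N$, $$\nabla_N:=\inf_{n\ge0}\frac1N\sum_{k=n+1}^{n+N}\delta_k,\qquad \Delta_N:=\sup_{n\ge0}\frac1N\sum_{k=n+1}^{n+N}\delta_k.$$ *)

theory Defs
  imports "HOL-Complex_Analysis.Complex_Analysis"
begin

definition log_plus :: "real \<Rightarrow> real" where
  "log_plus x = max (ln x) 0"

definition log_weight :: "real \<Rightarrow> complex \<Rightarrow> real" where
  "log_weight \<alpha> z = \<alpha> * (log_plus (norm z))\<^sup>2"

text \<open>
  Both quantities below are the \<open>p\<close>-th powers of norms. They take values in \<^typ>\<open>ennreal\<close>, so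
  that divergent integrals and sums have the value \<open>\<infinity>\<close> rather than \<open>0\<close>.
\<close>

definition fock_norm_pow :: "real \<Rightarrow> (complex \<Rightarrow> real) \<Rightarrow> (complex \<Rightarrow> complex) \<Rightarrow> ennreal" where
  "fock_norm_pow p \<phi> f = (\<integral>\<^sup>+ z. ennreal (norm (f z * of_real (exp (- \<phi> z))) powr p) \<partial>lborel)"

definition fock_space :: "real \<Rightarrow> (complex \<Rightarrow> real) \<Rightarrow> (complex \<Rightarrow> complex) set" where
  "fock_space p \<phi> = {f. f holomorphic_on UNIV \<and> fock_norm_pow p \<phi> f < \<infinity>}"

definition seq_norm_pow ::
    "real \<Rightarrow> (complex \<Rightarrow> real) \<Rightarrow> complex set \<Rightarrow> (complex \<Rightarrow> complex) \<Rightarrow> ennreal" where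
  "seq_norm_pow p \<phi> S v =
     (\<Sum>\<^sub>\<infinity>s\<in>S. ennreal ((1 + norm s)\<^sup>2 * norm (v s) powr p * exp (- (p * \<phi> s))))"

definition sampling :: "real \<Rightarrow> (complex \<Rightarrow> real) \<Rightarrow> complex set \<Rightarrow> bool" where
  "sampling p \<phi> S \<longleftrightarrow>
     (\<exists>C::real. C \<ge> 1 \<and> (\<forall>f\<in>fock_space p \<phi>.
        ennreal (1 / C) * fock_norm_pow p \<phi> f \<le> seq_norm_pow p \<phi> S f \<and>
        seq_norm_pow p \<phi> S f \<le> ennreal C * fock_norm_pow p \<phi> f))"

text \<open>A family indexed by \<open>S\<close> is a total function; its values off \<open>S\<close> play no role.\<close>

definition interpolating :: "real \<Rightarrow> (complex \<Rightarrow> real) \<Rightarrow> complex set \<Rightarrow> bool" where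
  "interpolating p \<phi> S \<longleftrightarrow>
     (\<forall>v::complex \<Rightarrow> complex. seq_norm_pow p \<phi> S v < \<infinity> \<longrightarrow>
        (\<exists>f\<in>fock_space p \<phi>. \<forall>s\<in>S. f s = v s))"

definition complete_interpolating :: "real \<Rightarrow> (complex \<Rightarrow> real) \<Rightarrow> complex set \<Rightarrow> bool" where
  "complete_interpolating p \<phi> S \<longleftrightarrow> sampling p \<phi> S \<and> interpolating p \<phi> S"

definition rho :: "real \<Rightarrow> complex \<Rightarrow> real" where
  "rho \<alpha> z = norm z / sqrt (2 * \<alpha>)"

definition d_rho :: "real \<Rightarrow> complex \<Rightarrow> complex \<Rightarrow> real" where
  "d_rho \<alpha> z w = norm (z - w) / (1 + min (rho \<alpha> z) (rho \<alpha> w))"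

text \<open>
  The infima and suprema below are taken in \<^typ>\<open>ereal\<close>, where they exist without boundedness
  or nonemptiness assumptions.
\<close>

definition d_rho_separated :: "real \<Rightarrow> complex set \<Rightarrow> bool" where
  "d_rho_separated \<alpha> S \<longleftrightarrow>
     (INF (s, s') \<in> {(s, s'). s \<in> S \<and> s' \<in> S \<and> s \<noteq> s'}. ereal (d_rho \<alpha> s s')) > 0"

definition nabla_avg :: "(nat \<Rightarrow> real) \<Rightarrow> nat \<Rightarrow> ereal" where
  "nabla_avg \<delta> N = (INF n. ereal (1 / real N * (\<Sum>k=n+1..n+N. \<delta> k)))"

definition Delta_avg :: "(nat \<Rightarrow> real) \<Rightarrow> nat \<Rightarrow> ereal" where
  "Delta_avg \<delta> N = (SUP n. ereal (1 / real N * (\<Sum>k=n+1..n+N. \<delta> k)))"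

definition lam :: "real \<Rightarrow> nat \<Rightarrow> real" where
  "lam \<alpha> n = exp ((1 + real n) / (2 * \<alpha>))"

text \<open>
  The exponent conjugate to \<open>1\<close> is \<open>\<infinity>\<close>. Only \<open>1 / q\<close> is ever used, and since \<open>1 / 0 = 0\<close> on
  \<^typ>\<open>real\<close>, that case is encoded by \<open>q = 0\<close>, the unique real solution for \<open>p = 1\<close>.
\<close>

definition hoelder_conjugate :: "real \<Rightarrow> real \<Rightarrow> bool" where
  "hoelder_conjugate p q \<longleftrightarrow> 1 / p + 1 / q = 1"

end

(*
  Write f(z) = sum a_k z^k and t = ln|z|.  The weighted monomial |z^k| e^(-phi) |z|^(2/p) is a Gaussian in t
  centred at t_k = (k + 2/p)/(2 alpha), so the Fock norm of f is equivalent to the l^p norm of the coefficients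
  normalised by the Gaussian maxima, and a sequence is complete interpolating iff the matrix with entries
  exp(-h (x_j - k)^2) e^(i k arg), h = 1/(4 alpha), x_j the rescaled log-modulus of the j-th node, is an
  isomorphism of l^p.

  If the nodes are separated and the partial sums of x_j - j grow strictly slower than 1/2 per step, the canonical
  product yields Lagrange functions whose normalised coefficients decay like e^(-eps|k - j|); Schur's test gives
  interpolation, and uniqueness follows by dividing by the canonical product.

  Conversely, a boundedly invertible matrix forces separation (the dual functions are Lipschitz in log-coordinates
  after division by a suitable monomial) and |x_j - j| bounded (otherwise a function with coefficients far from the
  nodes where it does not vanish contradicts boundedness below); conjugating with exponential weights shows that the
  inverse matrix decays exponentially off the diagonal; the dual functions are the Lagrange functions of the canonical
  product, and comparing sizes bounds the partial sums of x_j - j.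

  Removing or adding a point only shifts the index; which point is used does not matter, because one node of a complete
  interpolating set can be moved freely.
*)

theory Submission
  imports Defs
begin

text \<open>The slope 1/2 is read off from the canonical product. With factor j left out, its
  weighted size on the circle of position k, relative to k = j, is up to constants exp(-h |k - j| -
  2 h (E k - E j)), where E is the partial sum of the deviations. This decays on both sides of j
  exactly when the increments of E have slope strictly below 1/2 in modulus, up to a bounded error.
  The position of \<gamma> n is n + 2 \<alpha> \<delta> n - (2/p - 1), so the three cases are one
  criterion with centres c = 2/p - 2, 2/p - 1 and 2/p: averages of 2 \<alpha> \<delta> stay strictly
  inside (c - 1/2, c + 1/2). The value 0 lies in this window for p < 4/3, for 4/3 < p < 4 and for p
  > 4 respectively, which explains the stated ranges. Since p = 1 is included, duality of l^p is
  avoided. Boundedness is always Schur's test, and the inverse matrix is reached only through dual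
  functions and through a priori estimates in which a small Schur bound is absorbed by the lower
  sampling bound.\<close>

section \<open>Schur's test on l^p\<close>

lemma powr_ge_tangent:
  fixes y p :: real
  assumes "p \<ge> 1" "y \<ge> 0"
  shows "1 + p * (y - 1) \<le> y powr p"
proof (cases "y = 0")
  case True
  then show ?thesis using assms by simp
next
  case False
  then have y: "y > 0" using assms by simp
  have "y powr p - 1 powr p \<ge> p * (y - 1)"
  proof (rule convex_on_imp_above_tangent[where A = "{0<..}"])
    show "convex_on {0<..} (\<lambda>x::real. x powr p)" using powr_convex assms by blast
    show "connected {0::real<..}" by simp
    show "1 \<in> interior {0::real<..}" by (simp add: interior_open)
    show "y \<in> {0<..}" using y by simp
    show "((\<lambda>x::real. x powr p) has_field_derivative p) (at 1 within {0<..})"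
      by (auto intro!: derivative_eq_intros)
  qed
  then show ?thesis by simp
qed

text \<open>The tangent inequality moved from 1 to the point l. The scale l stays free: optimising
  it turns this pointwise bound into Jensen's inequality.\<close>

lemma young_powr:
  fixes b l p :: real
  assumes "p \<ge> 1" "b \<ge> 0" "l > 0"
  shows "b \<le> (1 - 1/p) * l + l powr (1 - p) / p * b powr p"
proof -
  have "1 + p * (b/l - 1) \<le> (b/l) powr p"
    using assms by (intro powr_ge_tangent) auto
  also have "\<dots> = b powr p / l powr p" using assms by (simp add: powr_divide)
  finally have "l / p * (1 + p * (b/l - 1)) \<le> l / p * (b powr p / l powr p)"
    using assms by (intro mult_left_mono) auto
  moreover have "l / p * (1 + p * (b/l - 1)) = b - (1 - 1/p) * l"
    using assms by (simp add: field_simps)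
  moreover have "l / p * (b powr p / l powr p) = l powr (1 - p) / p * b powr p"
    using assms by (simp add: powr_diff)
  ultimately show ?thesis by linarith
qed

text \<open>Jensen's inequality for a kernel of mass at most A that is not normalised. No conjugate
  exponent occurs, so p = 1 is covered as well. The left side is a number c below the integral,
  which itself may be infinite.\<close>

lemma nn_integral_jensen_powr:
  fixes K \<beta> :: "'a \<Rightarrow> real" and c p A :: real
  assumes [measurable]: "K \<in> borel_measurable M" "\<beta> \<in> borel_measurable M"
    and K: "\<And>x. K x \<ge> 0" and \<beta>: "\<And>x. \<beta> x \<ge> 0" and p: "p \<ge> 1" and A: "A > 0" and c: "c \<ge> 0"
    and KA: "(\<integral>\<^sup>+x. ennreal (K x) \<partial>M) \<le> ennreal A"
    and cK: "ennreal c \<le> (\<integral>\<^sup>+x. ennreal (K x * \<beta> x) \<partial>M)"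
  shows "ennreal (c powr p) \<le> ennreal (A powr (p - 1)) * (\<integral>\<^sup>+x. ennreal (K x * \<beta> x powr p) \<partial>M)"
proof (cases "c = 0 \<or> (\<integral>\<^sup>+x. ennreal (K x * \<beta> x powr p) \<partial>M) = \<infinity>")
  case True
  then show ?thesis using A by (auto simp: ennreal_mult_eq_top_iff ennreal_mult_top)
next
  case False
  then have c: "c > 0" using c by auto
  obtain r where r: "(\<integral>\<^sup>+x. ennreal (K x * \<beta> x powr p) \<partial>M) = ennreal r" "r \<ge> 0"
    using False by (metis ennreal_cases infinity_ennreal_def)
  \<comment> \<open>The optimal scale: after integration the first term of Young's bound is (1 -
    1/p) l A, which for l = c / A is (1 - 1/p) c and can be absorbed by c.\<close>
  define l where "l = c / A"
  have l: "l > 0" using c A by (simp add: l_def)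
  have "(\<integral>\<^sup>+x. ennreal (K x * \<beta> x) \<partial>M)
      \<le> (\<integral>\<^sup>+x. ennreal ((1 - 1/p) * l) * ennreal (K x) + ennreal (l powr (1 - p) / p) * ennreal (K x * \<beta> x powr p) \<partial>M)"
  proof (rule nn_integral_mono)
    fix x
    have "K x * \<beta> x \<le> K x * ((1 - 1/p) * l + l powr (1 - p) / p * \<beta> x powr p)"
      by (intro mult_left_mono young_powr p \<beta> l K)
    also have "\<dots> = (1 - 1/p) * l * K x + l powr (1 - p) / p * (K x * \<beta> x powr p)"
      by (simp add: algebra_simps)
    finally show "ennreal (K x * \<beta> x)
       \<le> ennreal ((1 - 1/p) * l) * ennreal (K x) + ennreal (l powr (1 - p) / p) * ennreal (K x * \<beta> x powr p)"
      using K \<beta> p l by (simp add: ennreal_mult[symmetric] ennreal_plus[symmetric] del: ennreal_plus)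
  qed
  also have "\<dots> = ennreal ((1 - 1/p) * l) * (\<integral>\<^sup>+x. ennreal (K x) \<partial>M) + ennreal (l powr (1 - p) / p) * ennreal r"
    by (subst nn_integral_add) (auto simp: nn_integral_cmult r)
  also have "\<dots> \<le> ennreal ((1 - 1/p) * l) * ennreal A + ennreal (l powr (1 - p) / p) * ennreal r"
    by (intro add_mono mult_left_mono KA) auto
  also have "\<dots> = ennreal ((1 - 1/p) * l * A + l powr (1 - p) / p * r)"
    using p l A r by (simp add: ennreal_mult[symmetric] ennreal_plus[symmetric] del: ennreal_plus)
  finally have "ennreal c \<le> ennreal ((1 - 1/p) * l * A + l powr (1 - p) / p * r)" using cK by simp
  then have "c \<le> (1 - 1/p) * l * A + l powr (1 - p) / p * r"
    using p l A r by (subst (asm) ennreal_le_iff) (auto intro!: add_nonneg_nonneg mult_nonneg_nonneg)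
  then have "c \<le> l powr (1 - p) * r" using A p c by (simp add: l_def field_simps)
  then have "c * l powr (p - 1) \<le> l powr (1 - p) * r * l powr (p - 1)" by (intro mult_right_mono) auto
  also have "\<dots> = r" using l by (simp add: powr_diff field_simps)
  finally have "A powr (p - 1) * (c * l powr (p - 1)) \<le> A powr (p - 1) * r" by (intro mult_left_mono) auto
  moreover have "A powr (p - 1) * (c * l powr (p - 1)) = c powr p"
    using A c by (simp add: l_def powr_divide powr_diff)
  ultimately have "c powr p \<le> A powr (p - 1) * r" by simp
  then show ?thesis unfolding r using r(2) by (simp add: ennreal_mult[symmetric])
qed

lemma suminf_jensen_powr:
  fixes K \<beta> :: "nat \<Rightarrow> real" and c p A :: real
  assumes "\<And>k. K k \<ge> 0" "\<And>k. \<beta> k \<ge> 0" "p \<ge> 1" "A > 0" "c \<ge> 0"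
    and "(\<Sum>k. ennreal (K k)) \<le> ennreal A"
    and "ennreal c \<le> (\<Sum>k. ennreal (K k * \<beta> k))"
  shows "ennreal (c powr p) \<le> ennreal (A powr (p - 1)) * (\<Sum>k. ennreal (K k * \<beta> k powr p))"
proof -
  have "ennreal (c powr p) \<le> ennreal (A powr (p - 1)) * (\<integral>\<^sup>+k. ennreal (K k * \<beta> k powr p) \<partial>count_space UNIV)"
  proof (rule nn_integral_jensen_powr)
    show "K \<in> borel_measurable (count_space UNIV)" "\<beta> \<in> borel_measurable (count_space UNIV)" by simp_all
    show "(\<integral>\<^sup>+k. ennreal (K k) \<partial>count_space UNIV) \<le> ennreal A"
      unfolding nn_integral_count_space_nat by (rule assms)
    show "ennreal c \<le> (\<integral>\<^sup>+k. ennreal (K k * \<beta> k) \<partial>count_space UNIV)"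
      unfolding nn_integral_count_space_nat by (rule assms)
  qed (rule assms)+
  then show ?thesis unfolding nn_integral_count_space_nat .
qed

lemma suminf_swap_ennreal:
  fixes f :: "nat \<Rightarrow> nat \<Rightarrow> ennreal"
  shows "(\<Sum>i. \<Sum>k. f i k) = (\<Sum>k. \<Sum>i. f i k)"
proof -
  have "(\<integral>\<^sup>+k. (\<Sum>i. f i k) \<partial>count_space UNIV) = (\<Sum>i. \<integral>\<^sup>+k. f i k \<partial>count_space UNIV)"
    by (rule nn_integral_suminf) auto
  then show ?thesis by (simp add: nn_integral_count_space_nat)
qed

lemma suminf_mono_ennreal:
  fixes f g :: "nat \<Rightarrow> ennreal"
  assumes "\<And>k. f k \<le> g k" shows "suminf f \<le> suminf g"
  by (rule suminf_le) (use assms in auto)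

lemma le_suminf_ennreal:
  fixes f :: "nat \<Rightarrow> ennreal" shows "f k \<le> suminf f"
  using sum_le_suminf[of f "{k}"] by auto

text \<open>Jensen along each row costs \<open>A powr (p - 1)\<close>; after exchanging the sums,
  the column bound costs the remaining factor A. The conclusion concerns any family c dominated by
  the kernel, so values and coefficients are treated alike.\<close>

lemma schur_test:
  fixes K :: "nat \<Rightarrow> nat \<Rightarrow> real" and \<beta> c :: "nat \<Rightarrow> real" and p A :: real
  assumes K: "\<And>i k. K i k \<ge> 0" and \<beta>: "\<And>k. \<beta> k \<ge> 0" and p: "p \<ge> 1" and A: "A > 0" and c: "\<And>i. c i \<ge> 0"
    and row: "\<And>i. (\<Sum>k. ennreal (K i k)) \<le> ennreal A"
    and col: "\<And>k. (\<Sum>i. ennreal (K i k)) \<le> ennreal A"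
    and cK: "\<And>i. ennreal (c i) \<le> (\<Sum>k. ennreal (K i k * \<beta> k))"
  shows "(\<Sum>i. ennreal (c i powr p)) \<le> ennreal (A powr p) * (\<Sum>k. ennreal (\<beta> k powr p))"
proof -
  have "(\<Sum>i. ennreal (c i powr p)) \<le> (\<Sum>i. ennreal (A powr (p - 1)) * (\<Sum>k. ennreal (K i k * \<beta> k powr p)))"
    by (intro suminf_mono_ennreal suminf_jensen_powr) (use assms in auto)
  also have "\<dots> = ennreal (A powr (p - 1)) * (\<Sum>k. \<Sum>i. ennreal (K i k * \<beta> k powr p))"
    by (subst suminf_swap_ennreal) (rule ennreal_suminf_cmult)
  also have "\<dots> \<le> ennreal (A powr (p - 1)) * ((\<Sum>k. ennreal (\<beta> k powr p)) * ennreal A)"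
  proof (rule mult_left_mono)
    have "(\<Sum>k. \<Sum>i. ennreal (K i k * \<beta> k powr p)) \<le> (\<Sum>k. ennreal (\<beta> k powr p) * ennreal A)"
    proof (rule suminf_mono_ennreal)
      fix k
      have "(\<Sum>i. ennreal (K i k * \<beta> k powr p)) = (\<Sum>i. ennreal (\<beta> k powr p) * ennreal (K i k))"
        by (rule suminf_cong) (metis K ennreal_mult' mult.commute powr_ge_zero)
      also have "\<dots> = ennreal (\<beta> k powr p) * (\<Sum>i. ennreal (K i k))" by (rule ennreal_suminf_cmult)
      also have "\<dots> \<le> ennreal (\<beta> k powr p) * ennreal A" by (intro mult_left_mono col) simp
      finally show "(\<Sum>i. ennreal (K i k * \<beta> k powr p)) \<le> ennreal (\<beta> k powr p) * ennreal A" .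
    qed
    also have "\<dots> = (\<Sum>k. ennreal (\<beta> k powr p)) * ennreal A" by (rule ennreal_suminf_multc)
    finally show "(\<Sum>k. \<Sum>i. ennreal (K i k * \<beta> k powr p)) \<le> (\<Sum>k. ennreal (\<beta> k powr p)) * ennreal A" .
  qed simp
  also have "\<dots> = ennreal (A powr p) * (\<Sum>k. ennreal (\<beta> k powr p))"
  proof -
    have "A powr p = A powr (p - 1) * A" using A by (simp add: powr_diff)
    then show ?thesis using A by (simp add: ennreal_mult mult_ac)
  qed
  finally show ?thesis .
qed

text \<open>Both sides of n are geometric; the finite left side is bounded by the full
  series.\<close>

lemma suminf_exp_dist_nat:
  fixes c :: real
  assumes c: "c > 0"
  shows "(\<Sum>k. ennreal (exp (- (c * \<bar>real n - real k\<bar>)))) \<le> ennreal (2 / (1 - exp (- c)))"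
proof -
  define q where "q = exp (- c)"
  have q: "0 < q" "q < 1" using c by (auto simp: q_def)
  define g where "g m = ennreal (q ^ m)" for m :: nat
  have ge: "ennreal (exp (- (c * real m))) = g m" for m
    unfolding g_def q_def using exp_of_nat_mult[of m "- c"] by (simp add: mult.commute)
  have "(\<lambda>m. q ^ m) sums (1 / (1 - q))" using q by (intro geometric_sums) auto
  then have gs: "suminf g = ennreal (1 / (1 - q))"
    unfolding g_def using q by (intro suminf_ennreal_eq) auto
  define F where "F k = ennreal (exp (- (c * \<bar>real n - real k\<bar>)))" for k :: nat
  have F1: "F (k + n) = g k" for k by (simp add: F_def ge)
  have F2: "F k = g (Suc (n - Suc k))" if "k < n" for k
  proof -
    have "\<bar>real n - real k\<bar> = real (Suc (n - Suc k))" using that by auto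
    then show ?thesis unfolding F_def ge[symmetric] by simp
  qed
  have "suminf F = (\<Sum>k. F (k + n)) + (\<Sum>k<n. F k)"
    by (rule suminf_offset) simp
  also have "(\<Sum>k. F (k + n)) = suminf g" by (simp add: F1)
  also have "(\<Sum>k<n. F k) = (\<Sum>k<n. g (Suc (n - Suc k)))" by (intro sum.cong) (auto simp: F2)
  also have "\<dots> = (\<Sum>k<n. g (Suc k))" by (rule sum.nat_diff_reindex)
  also have "\<dots> \<le> (\<Sum>k<n. g k)"
    unfolding g_def using q by (intro sum_mono ennreal_leI power_decreasing) auto
  also have "\<dots> \<le> suminf g" by (rule sum_le_suminf) auto
  finally have "suminf F \<le> suminf g + suminf g" by (simp add: add_left_mono)
  also have "\<dots> = ennreal (2 / (1 - q))" unfolding gs using q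
    by (subst ennreal_plus[symmetric]) auto
  finally show ?thesis unfolding F_def q_def .
qed

lemma suminf_exp_dist_real:
  fixes c y :: real
  assumes c: "c > 0"
  shows "(\<Sum>k. ennreal (exp (- (c * \<bar>y - real k\<bar>)))) \<le> ennreal (2 * exp c / (1 - exp (- c)))"
proof -
  \<comment> \<open>Rounding moves the centre by at most 1, which costs the factor
    \<open>exp c\<close>. A negative y becomes 0, and this only brings the centre closer to every
    index.\<close>
  define n where "n = nat \<lfloor>y\<rfloor>"
  have "ennreal (exp (- (c * \<bar>y - real k\<bar>))) \<le> ennreal (exp c) * ennreal (exp (- (c * \<bar>real n - real k\<bar>)))" for k
  proof -
    have "\<bar>real n - real k\<bar> \<le> \<bar>y - real k\<bar> + 1" unfolding n_def by linarith
    then have "c * \<bar>real n - real k\<bar> \<le> c * (\<bar>y - real k\<bar> + 1)" using c by (intro mult_left_mono) auto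
    then have "exp (- (c * \<bar>y - real k\<bar>)) \<le> exp c * exp (- (c * \<bar>real n - real k\<bar>))"
      by (simp add: exp_add[symmetric] algebra_simps)
    then show ?thesis by (simp add: ennreal_mult[symmetric])
  qed
  then have "(\<Sum>k. ennreal (exp (- (c * \<bar>y - real k\<bar>)))) \<le> (\<Sum>k. ennreal (exp c) * ennreal (exp (- (c * \<bar>real n - real k\<bar>))))"
    by (rule suminf_mono_ennreal)
  also have "\<dots> \<le> ennreal (exp c) * ennreal (2 / (1 - exp (- c)))"
    by (simp add: mult_left_mono suminf_exp_dist_nat c)
  also have "\<dots> = ennreal (2 * exp c / (1 - exp (- c)))"
    using c by (simp add: ennreal_mult[symmetric] mult.commute)
  finally show ?thesis .
qed

text \<open>Completing the square. The rate a is free because it gets spent in different ways: one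
  unit makes the kernel summable, further units pay for a distance or for an exponential
  weight.\<close>

lemma gaussian_le_exp:
  fixes h a y :: real
  assumes "h > 0"
  shows "exp (- (h * y\<^sup>2)) \<le> exp (a\<^sup>2 / (4 * h)) * exp (- (a * \<bar>y\<bar>))"
proof -
  have "0 \<le> (2 * h * \<bar>y\<bar> - a)\<^sup>2 / (4 * h)" using assms by simp
  also have "\<dots> = h * y\<^sup>2 + a\<^sup>2 / (4*h) - a * \<bar>y\<bar>" using assms
    by (simp add: field_simps power2_eq_square)
  finally show ?thesis by (simp add: exp_add[symmetric])
qed

lemma norm_suminf_le_ennreal:
  fixes a :: "nat \<Rightarrow> complex"
  assumes "a sums s"
  shows "ennreal (norm s) \<le> (\<Sum>k. ennreal (norm (a k)))"
proof (rule LIMSEQ_le_const2)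
  show "(\<lambda>n. ennreal (norm (\<Sum>k<n. a k))) \<longlonglongrightarrow> ennreal (norm s)"
    using assms by (intro tendsto_ennrealI tendsto_norm) (simp add: sums_def)
  have "ennreal (norm (\<Sum>k<n. a k)) \<le> (\<Sum>k. ennreal (norm (a k)))" for n
  proof -
    have "ennreal (norm (\<Sum>k<n. a k)) \<le> ennreal (\<Sum>k<n. norm (a k))" by (intro ennreal_leI norm_sum)
    also have "\<dots> = (\<Sum>k<n. ennreal (norm (a k)))" by simp
    also have "\<dots> \<le> (\<Sum>k. ennreal (norm (a k)))" by (rule sum_le_suminf) auto
    finally show ?thesis .
  qed
  then show "\<exists>N. \<forall>n\<ge>N. ennreal (norm (\<Sum>k<n. a k)) \<le> (\<Sum>k. ennreal (norm (a k)))" by blast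
qed

lemma powr_add_le:
  fixes x y p :: real
  assumes "x \<ge> 0" "y \<ge> 0" "p \<ge> 1"
  shows "(x + y) powr p \<le> 2 powr p * (x powr p + y powr p)"
proof -
  have "(x + y) powr p \<le> (2 * max x y) powr p" using assms by (intro powr_mono2) auto
  also have "\<dots> = 2 powr p * max x y powr p" using assms by (simp add: powr_mult)
  also have "max x y powr p \<le> x powr p + y powr p" by (simp add: max_def)
  finally show ?thesis by simp
qed

lemma suminf_powr_add_le:
  fixes u v w :: "nat \<Rightarrow> real"
  assumes "p \<ge> 1" "\<And>i. u i \<ge> 0" "\<And>i. v i \<ge> 0" "\<And>i. w i \<ge> 0" "\<And>i. u i \<le> v i + w i"
  shows "(\<Sum>i. ennreal (u i powr p)) \<le> ennreal (2 powr p) * ((\<Sum>i. ennreal (v i powr p)) + (\<Sum>i. ennreal (w i powr p)))"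
proof -
  have "(\<Sum>i. ennreal (u i powr p)) \<le> (\<Sum>i. ennreal (2 powr p) * (ennreal (v i powr p) + ennreal (w i powr p)))"
  proof (rule suminf_mono_ennreal)
    fix i
    have "u i powr p \<le> (v i + w i) powr p" using assms by (intro powr_mono2) auto
    also have "\<dots> \<le> 2 powr p * (v i powr p + w i powr p)" using assms by (intro powr_add_le) auto
    finally have "ennreal (u i powr p) \<le> ennreal (2 powr p * (v i powr p + w i powr p))" by (rule ennreal_leI)
    also have "\<dots> = ennreal (2 powr p) * (ennreal (v i powr p) + ennreal (w i powr p))"
      by (simp add: ennreal_mult ennreal_plus)
    finally show "ennreal (u i powr p) \<le> ennreal (2 powr p) * (ennreal (v i powr p) + ennreal (w i powr p))" .
  qed
  also have "\<dots> = ennreal (2 powr p) * ((\<Sum>i. ennreal (v i powr p)) + (\<Sum>i. ennreal (w i powr p)))"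
    by (subst ennreal_suminf_cmult) (simp add: suminf_add[symmetric])
  finally show ?thesis .
qed

lemma ennreal_finite_ex: "(x::ennreal) \<noteq> \<infinity> \<Longrightarrow> \<exists>r. x = ennreal r \<and> r \<ge> 0"
  by (cases x rule: ennreal_cases) auto

section \<open>Coefficient model of the Fock space\<close>

definition coef :: "(complex \<Rightarrow> complex) \<Rightarrow> nat \<Rightarrow> complex" where
  "coef f k = fps_nth (fps_expansion f 0) k"

lemma coef_deriv: "coef f k = (deriv ^^ k) f 0 / fact k"
  by (simp add: coef_def fps_expansion_def)

lemma coef_sums:
  assumes "f holomorphic_on UNIV"
  shows "(\<lambda>k. coef f k * z ^ k) sums f z"
  unfolding coef_def
  by (rule has_fps_expansion_imp_sums_complex[where r = \<infinity>])
     (use assms in \<open>auto intro!: has_fps_expansion_fps_expansion[of UNIV]\<close>)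

text \<open>Convergence at every positive real point already forces an infinite radius; uniqueness
  of power series then identifies the coefficients.\<close>

lemma entire_of_sums:
  assumes "\<And>z. (\<lambda>k. c k * z ^ k) sums f z"
  shows "f holomorphic_on UNIV" "coef f = c"
proof -
  define F where "F = Abs_fps c"
  have "ereal r \<le> fps_conv_radius F" for r
  proof (cases "r \<ge> 0")
    case True
    have "summable (\<lambda>k. fps_nth F k * (of_real r) ^ k)" using assms[of "of_real r"] by (auto simp: F_def sums_iff)
    then have "conv_radius (fps_nth F) \<ge> norm (of_real r :: complex)" by (rule conv_radius_geI)
    then show ?thesis using True by (simp add: fps_conv_radius_def)
  next
    case False
    then have "ereal r \<le> 0" by simp
    also have "0 \<le> fps_conv_radius F" by (simp add: fps_conv_radius_def conv_radius_nonneg)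
    finally show ?thesis .
  qed
  then have R: "fps_conv_radius F = \<infinity>" by (meson ereal_le_real ereal_top order_refl)
  have e: "eval_fps F z = f z" for z using assms[of z] by (simp add: eval_fps_def F_def sums_iff)
  then have ff: "f = eval_fps F" by auto
  show "f holomorphic_on UNIV" unfolding ff by (rule holomorphic_on_eval_fps) (auto simp: R)
  have "f has_fps_expansion F" unfolding ff by (rule eval_fps_has_fps_expansion) (simp add: R)
  then show "coef f = c" by (auto simp: coef_def fps_expansion_eqI F_def fun_eq_iff)
qed

lemma coef_linear:
  assumes "f holomorphic_on UNIV" "g holomorphic_on UNIV"
  shows "coef (\<lambda>z. a * f z + b * g z) k = a * coef f k + b * coef g k"
proof -
  have "(\<lambda>k. (a * coef f k + b * coef g k) * z ^ k) sums (a * f z + b * g z)" for z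
    using sums_add[OF sums_mult[OF coef_sums[OF assms(1), of z], of a] sums_mult[OF coef_sums[OF assms(2), of z], of b]]
    by (simp add: algebra_simps)
  then show ?thesis by (subst entire_of_sums(2)[of "\<lambda>k. a * coef f k + b * coef g k"]) auto
qed

locale small_fock =
  fixes \<alpha> p :: real
  assumes \<alpha>: "\<alpha> > 0" and p: "p \<ge> 1"
begin

text \<open>
  \<open>pos z\<close> is the log-modulus rescaled so that the weighted monomial of degree \<open>k\<close> peaks at \<open>pos z = k\<close>,
  \<open>circ\<close> its inverse; \<open>om z\<close> is \<open>\<bar>z\<bar>\<close> to the power \<open>2 / p\<close> times \<open>exp (- \<phi> z)\<close> for \<open>\<bar>z\<bar> \<ge> 1\<close>, so the area factor is
  absorbed, and \<open>1 / wt k\<close> normalises \<open>z ^ k\<close> to have weighted maximum \<open>1\<close>.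
  For \<open>z = 0\<close> the value of \<open>pos\<close> is junk (\<open>ln 0 = 0\<close>).
\<close>

definition h :: real where "h = 1 / (4 * \<alpha>)"

lemma h: "h > 0" using \<alpha> by (simp add: h_def)

definition pos :: "complex \<Rightarrow> real" where "pos z = 2 * \<alpha> * ln (norm z) - 2 / p"
definition circ :: "real \<Rightarrow> real" where "circ y = exp ((y + 2 / p) / (2 * \<alpha>))"
definition wt :: "nat \<Rightarrow> real" where "wt k = exp (h * (real k + 2 / p)\<^sup>2)"
definition om :: "complex \<Rightarrow> real" where "om z = exp (h * (2 / p)\<^sup>2 - h * (pos z)\<^sup>2)"
definition bc :: "(complex \<Rightarrow> complex) \<Rightarrow> nat \<Rightarrow> complex" where "bc f k = of_real (wt k) * coef f k"
definition nrm :: "(complex \<Rightarrow> complex) \<Rightarrow> ennreal" where "nrm f = (\<Sum>k. ennreal (norm (bc f k) powr p))"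
definition gsum :: real where "gsum = exp (1 / (4 * h)) * (2 * exp 1 / (1 - exp (- 1)))"

lemma om_pos: "om z > 0" and wt_pos: "wt k > 0" and circ_pos: "circ y > 0"
  by (simp_all add: om_def wt_def circ_def)

lemma norm_circ: "z \<noteq> 0 \<Longrightarrow> norm z = circ (pos z)"
  using \<alpha> by (simp add: circ_def pos_def field_simps)

lemma pos_circ: "norm z = circ y \<Longrightarrow> pos z = y"
  using \<alpha> by (simp add: circ_def pos_def field_simps)

lemma circ_eq: "circ y = exp (2 * h * (y + 2 / p))"
  using \<alpha> by (simp add: circ_def h_def field_simps)

lemma circ_quot: "circ x / circ y = exp (2 * h * (x - y))"
  by (simp add: circ_eq exp_diff[symmetric] algebra_simps)

lemma circ_le: "x \<le> y \<Longrightarrow> circ x \<le> circ y"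
  using \<alpha> by (simp add: circ_def divide_right_mono)

text \<open>The shifts by 2/p in \<open>pos\<close>, \<open>wt\<close> and \<open>om\<close> are
  arranged so that completing the square leaves no remainder. The estimates of weighted values below
  rest on this Gaussian.\<close>

lemma om_mult_power:
  assumes "z \<noteq> 0"
  shows "om z * norm z ^ k = wt k * exp (- (h * (pos z - real k)\<^sup>2))"
proof -
  have "norm z ^ k = exp (real k * (2 * h * (pos z + 2 / p)))"
    by (simp add: norm_circ[OF assms] circ_eq exp_of_nat_mult)
  then show ?thesis
    by (simp add: om_def wt_def exp_add[symmetric] power2_eq_square algebra_simps)
qed

lemma gsum: "gsum > 0" "(\<Sum>k. ennreal (exp (- (h * (y - real k)\<^sup>2)))) \<le> ennreal gsum"
proof -
  show "gsum > 0" by (simp add: gsum_def)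
  have "(\<Sum>k. ennreal (exp (- (h * (y - real k)\<^sup>2)))) \<le> (\<Sum>k. ennreal (exp (1 / (4 * h))) * ennreal (exp (- (1 * \<bar>y - real k\<bar>))))"
    using gaussian_le_exp[OF h, of _ 1]
    by (intro suminf_mono_ennreal) (simp add: ennreal_mult[symmetric])
  also have "\<dots> = ennreal (exp (1 / (4 * h))) * (\<Sum>k. ennreal (exp (- (1 * \<bar>y - real k\<bar>))))"
    by (rule ennreal_suminf_cmult)
  also have "\<dots> \<le> ennreal (exp (1 / (4 * h))) * ennreal (2 * exp 1 / (1 - exp (- 1)))"
    by (intro mult_left_mono suminf_exp_dist_real) auto
  also have "\<dots> = ennreal gsum" by (simp add: gsum_def ennreal_mult[symmetric])
  finally show "(\<Sum>k. ennreal (exp (- (h * (y - real k)\<^sup>2)))) \<le> ennreal gsum" .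
qed

lemma summable_gauss: "summable (\<lambda>k. exp (- (h * (y - real k)\<^sup>2)))"
  by (rule summable_suminf_not_top) (use gsum(2)[of y] in \<open>auto simp: top_unique\<close>)

section \<open>Evaluation bounds, Cauchy estimates and synthesis from coefficients\<close>

lemma eval_le:
  assumes f: "f holomorphic_on UNIV" and z: "z \<noteq> 0"
  shows "ennreal (om z * norm (f z)) \<le> (\<Sum>k. ennreal (exp (- (h * (pos z - real k)\<^sup>2)) * norm (bc f k)))"
proof -
  have "ennreal (om z * norm (f z)) = ennreal (norm (of_real (om z) * f z))"
    using om_pos[of z] by (simp add: norm_mult)
  also have "\<dots> \<le> (\<Sum>k. ennreal (norm (of_real (om z) * (coef f k * z ^ k))))"
    by (intro norm_suminf_le_ennreal sums_mult coef_sums f)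
  also have "(\<lambda>k. norm (of_real (om z) * (coef f k * z ^ k))) = (\<lambda>k. exp (- (h * (pos z - real k)\<^sup>2)) * norm (bc f k))"
  proof
    fix k
    have "norm (of_real (om z) * (coef f k * z ^ k)) = (om z * norm z ^ k) * norm (coef f k)"
      using om_pos[of z] by (simp add: norm_mult norm_power)
    also have "\<dots> = exp (- (h * (pos z - real k)\<^sup>2)) * norm (bc f k)"
      using wt_pos[of k] by (simp add: om_mult_power z bc_def norm_mult)
    finally show "norm (of_real (om z) * (coef f k * z ^ k)) = exp (- (h * (pos z - real k)\<^sup>2)) * norm (bc f k)" .
  qed
  finally show ?thesis .
qed

lemma eval_bounded:
  assumes "f holomorphic_on UNIV" "z \<noteq> 0" "\<And>k. norm (bc f k) \<le> D"
  shows "om z * norm (f z) \<le> D * gsum"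
proof -
  have D: "D \<ge> 0" using assms(3)[of 0] norm_ge_zero order_trans by blast
  have "ennreal (om z * norm (f z)) \<le> (\<Sum>k. ennreal (exp (- (h * (pos z - real k)\<^sup>2)) * norm (bc f k)))"
    by (rule eval_le) fact+
  also have "\<dots> \<le> (\<Sum>k. ennreal D * ennreal (exp (- (h * (pos z - real k)\<^sup>2))))"
    using assms(3) D by (intro suminf_mono_ennreal) (simp add: ennreal_mult[symmetric] mult.commute mult_left_mono)
  also have "\<dots> = ennreal D * (\<Sum>k. ennreal (exp (- (h * (pos z - real k)\<^sup>2))))" by (rule ennreal_suminf_cmult)
  also have "\<dots> \<le> ennreal D * ennreal gsum" by (intro mult_left_mono gsum) auto
  also have "\<dots> = ennreal (D * gsum)" using D gsum(1) by (simp add: ennreal_mult)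
  finally show ?thesis using D gsum(1) by (simp add: ennreal_le_iff)
qed

text \<open>Cauchy's estimate on the circle of position y, on which \<open>om\<close> is constant.
  The Gaussian factor is the loss from choosing a circle other than the best one; it is 1 for y =
  k.\<close>

lemma coef_le:
  assumes f: "f holomorphic_on UNIV" and D: "\<And>z. norm z = circ y \<Longrightarrow> om z * norm (f z) \<le> D"
  shows "norm (bc f k) * exp (- (h * (y - real k)\<^sup>2)) \<le> D"
proof -
  define w where "w = complex_of_real (circ y)"
  have w: "norm w = circ y" "w \<noteq> 0" using circ_pos[of y] by (auto simp: w_def)
  have omw: "om z = om w" if "norm z = circ y" for z using that w by (simp add: om_def pos_def)
  have "norm ((deriv ^^ k) f 0) \<le> fact k * (D / om w) / circ y ^ k"
  proof (rule Cauchy_inequality)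
    show "f holomorphic_on ball 0 (circ y)" using f holomorphic_on_subset by blast
    show "continuous_on (cball 0 (circ y)) f" using f holomorphic_on_imp_continuous_on holomorphic_on_subset by blast
    show "0 < circ y" by (rule circ_pos)
    fix x :: complex assume "norm (0 - x) = circ y"
    then have x: "norm x = circ y" by simp
    then show "norm (f x) \<le> D / om w" using D[OF x] omw[OF x] om_pos[of w] by (simp add: field_simps)
  qed
  then have "norm (coef f k) \<le> D / om w / circ y ^ k"
    by (simp add: coef_deriv norm_divide field_simps)
  then have "norm (coef f k) * (om w * norm w ^ k) \<le> D"
    using om_pos[of w] circ_pos[of y] by (simp add: w(1) field_simps)
  then have "norm (coef f k) * (wt k * exp (- (h * (y - real k)\<^sup>2))) \<le> D"
    unfolding om_mult_power[OF w(2)] pos_circ[OF w(1)] .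
  then show ?thesis using wt_pos[of k] by (simp add: bc_def norm_mult mult_ac)
qed

lemma summable_synth:
  fixes z :: complex and \<beta> :: "nat \<Rightarrow> complex"
  assumes "\<And>k. norm (\<beta> k) \<le> D"
  shows "summable (\<lambda>k. norm (\<beta> k / of_real (wt k) * z ^ k))"
proof (cases "z = 0")
  case True
  have "(\<lambda>k. norm (\<beta> k / of_real (wt k) * z ^ k)) = (\<lambda>k. norm (\<beta> k / of_real (wt k)) * 0 ^ k)"
    by (simp only: True norm_mult norm_power norm_zero)
  then show ?thesis by (simp only: summable_zero_power')
next
  case False
  have D: "D \<ge> 0" using assms[of 0] norm_ge_zero order_trans by blast
  have "summable (\<lambda>k. D / om z * exp (- (h * (pos z - real k)\<^sup>2)))"
    by (intro summable_mult summable_gauss)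
  then show ?thesis
  proof (rule summable_comparison_test'[where N = 0])
    fix k
    have "norm (\<beta> k / of_real (wt k) * z ^ k) = norm (\<beta> k) / (wt k * om z) * (om z * norm z ^ k)"
      using om_pos[of z] wt_pos[of k] by (simp add: norm_mult norm_divide norm_power)
    also have "\<dots> \<le> D / (wt k * om z) * (om z * norm z ^ k)"
      using om_pos[of z] wt_pos[of k] assms[of k] by (intro mult_right_mono divide_right_mono) auto
    also have "\<dots> = D / om z * exp (- (h * (pos z - real k)\<^sup>2))"
      unfolding om_mult_power[OF False] using wt_pos[of k] by simp
    finally show "norm (norm (\<beta> k / of_real (wt k) * z ^ k)) \<le> D / om z * exp (- (h * (pos z - real k)\<^sup>2))" by simp
  qed
qed

text \<open>Bounded coefficients suffice because the Gaussian kernel is summable; whether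
  \<open>nrm\<close> of the function so obtained is finite is a separate question.\<close>

lemma synth:
  assumes "\<And>k. norm (\<beta> k) \<le> D"
  obtains f where "f holomorphic_on UNIV" "bc f = \<beta>"
proof -
  define f where "f z = (\<Sum>k. \<beta> k / of_real (wt k) * z ^ k)" for z
  have s: "(\<lambda>k. \<beta> k / of_real (wt k) * z ^ k) sums f z" for z
    unfolding f_def by (rule summable_sums[OF summable_norm_cancel[OF summable_synth[OF assms]]])
  show thesis
  proof
    show "f holomorphic_on UNIV" by (rule entire_of_sums(1)[OF s])
    show "bc f = \<beta>"
    proof
      fix k show "bc f k = \<beta> k" using wt_pos[of k] by (simp add: bc_def entire_of_sums(2)[OF s])
    qed
  qed
qed

lemma bc_linear:
  assumes "f holomorphic_on UNIV" "g holomorphic_on UNIV"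
  shows "bc (\<lambda>z. a * f z + b * g z) k = a * bc f k + b * bc g k"
  by (simp add: bc_def coef_linear[OF assms] algebra_simps)

lemma bc_sums:
  assumes "f holomorphic_on UNIV"
  shows "(\<lambda>k. bc f k / of_real (wt k) * z ^ k) sums f z"
  using coef_sums[OF assms, of z] wt_pos by (simp add: bc_def less_imp_neq[symmetric])

lemma bc_eq_zero:
  assumes "f holomorphic_on UNIV" "\<And>k. bc f k = 0" shows "f z = 0"
  using bc_sums[OF assms(1), of z] assms(2) sums_unique2 sums_zero by (simp add: sums_0 sums_iff)

lemma bc_le_of_nrm_le:
  assumes "nrm f \<le> ennreal r" "r \<ge> 0"
  shows "norm (bc f k) \<le> r powr (1 / p)"
proof -
  have "ennreal (norm (bc f k) powr p) \<le> ennreal r"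
    using le_suminf_ennreal[of "\<lambda>k. ennreal (norm (bc f k) powr p)" k] assms(1) by (simp add: nrm_def)
  then have "norm (bc f k) powr p \<le> r" using assms(2) by (simp add: ennreal_le_iff)
  then have "(norm (bc f k) powr p) powr (1/p) \<le> r powr (1/p)" using p by (intro powr_mono2) auto
  then show ?thesis using p by (simp add: powr_powr)
qed

lemma bc_bounded:
  assumes "nrm f < \<infinity>"
  obtains D where "\<And>k. norm (bc f k) \<le> D"
proof -
  obtain r where "nrm f = ennreal r" "r \<ge> 0" using ennreal_finite_ex[OF less_imp_neq[OF assms]] by blast
  then show thesis using that[of "r powr (1 / p)"] bc_le_of_nrm_le[of f r] by simp
qed

lemma nrm_eq_zero:
  assumes "f holomorphic_on UNIV" "nrm f = 0" shows "f z = 0"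
proof (rule bc_eq_zero[OF assms(1)])
  fix k
  have "ennreal (norm (bc f k) powr p) \<le> 0"
    using le_suminf_ennreal[of "\<lambda>k. ennreal (norm (bc f k) powr p)" k] assms(2) by (simp add: nrm_def)
  then show "bc f k = 0" by simp
qed

lemma nrm_linear:
  assumes "f holomorphic_on UNIV" "g holomorphic_on UNIV"
  shows "nrm (\<lambda>z. a * f z + b * g z) \<le> ennreal (2 powr p) * (ennreal (norm a powr p) * nrm f + ennreal (norm b powr p) * nrm g)"
proof -
  have c: "(\<Sum>i. ennreal ((norm a * norm (bc f i)) powr p)) = ennreal (norm a powr p) * nrm f" for a f
    unfolding nrm_def by (subst ennreal_suminf_cmult[symmetric]) (simp add: powr_mult ennreal_mult)
  show ?thesis unfolding c[symmetric] unfolding nrm_def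
    by (rule suminf_powr_add_le) (auto simp: p bc_linear[OF assms] norm_mult intro!: order_trans[OF norm_triangle_ineq])
qed

end

section \<open>Canonical products\<close>

text \<open>Simplicity of the zeros of Q is expressed by a global factorisation, which infinite
  products supply directly. Near such a zero both f and Q are divided by the linear factor, and the
  quotient of the cofactors is holomorphic there.\<close>

lemma entire_divide:
  assumes f: "f holomorphic_on UNIV" and Q: "Q holomorphic_on UNIV"
    and zeros: "\<And>z. Q z = 0 \<Longrightarrow> f z = 0 \<and> (\<exists>Q1. Q1 holomorphic_on UNIV \<and> Q1 z \<noteq> 0 \<and> (\<forall>w. Q w = (w - z) * Q1 w))"
  obtains H where "H holomorphic_on UNIV" "\<And>z. f z = Q z * H z"
proof -
  \<comment> \<open>At a simple zero the limit of f / Q is the quotient of the derivatives.\<close>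
  define H where "H z = (if Q z = 0 then deriv f z / deriv Q z else f z / Q z)" for z
  have fd: "H field_differentiable at a" for a
  proof (cases "Q a = 0")
    case False
    have "open (- {w. Q w = 0})"
    proof -
      have "closed {w \<in> UNIV. Q w = 0}"
        by (rule continuous_closed_preimage_constant) (use Q holomorphic_on_imp_continuous_on in auto)
      then show ?thesis by (simp add: open_Compl)
    qed
    moreover have "(\<lambda>z. f z / Q z) holomorphic_on - {w. Q w = 0}"
      by (intro holomorphic_on_divide) (use f Q holomorphic_on_subset in auto)
    then have "H holomorphic_on - {w. Q w = 0}"
      by (rule holomorphic_transform) (auto simp: H_def)
    ultimately show ?thesis using False by (auto simp: holomorphic_on_open field_differentiable_def)
  next
    case True
    obtain Q1 where Q1: "Q1 holomorphic_on UNIV" "Q1 a \<noteq> 0" and QQ: "\<And>w. Q w = (w - a) * Q1 w" and fa: "f a = 0"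
      using zeros[OF True] by blast
    define f1 where "f1 z = (if z = a then deriv f a else (f z - f a) / (z - a))" for z
    have f1: "f1 holomorphic_on UNIV" unfolding f1_def by (rule pole_lemma_open) (use f in auto)
    have ff: "f w = (w - a) * f1 w" for w using fa by (simp add: f1_def)
    have dQ: "deriv Q a = Q1 a"
    proof (rule DERIV_imp_deriv)
      have "(Q1 has_field_derivative deriv Q1 a) (at a)" using Q1(1) by (simp add: holomorphic_derivI)
      then have "((\<lambda>w. (w - a) * Q1 w) has_field_derivative Q1 a) (at a)"
        by (auto intro!: derivative_eq_intros)
      moreover have "Q = (\<lambda>w. (w - a) * Q1 w)" using QQ by auto
      ultimately show "(Q has_field_derivative Q1 a) (at a)" by simp
    qed
    have op: "open (- {w. Q1 w = 0})"
    proof -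
      have "closed {w \<in> UNIV. Q1 w = 0}"
        by (rule continuous_closed_preimage_constant) (use Q1 holomorphic_on_imp_continuous_on in auto)
      then show ?thesis by (simp add: open_Compl)
    qed
    have "(\<lambda>z. f1 z / Q1 z) holomorphic_on - {w. Q1 w = 0}"
      by (intro holomorphic_on_divide) (use f1 Q1 holomorphic_on_subset in auto)
    then have "H holomorphic_on - {w. Q1 w = 0}"
    proof (rule holomorphic_transform)
      fix z assume "z \<in> - {w. Q1 w = 0}"
      then have z: "Q1 z \<noteq> 0" by simp
      show "f1 z / Q1 z = H z"
      proof (cases "z = a")
        case True
        then show ?thesis using \<open>Q a = 0\<close> by (simp add: H_def dQ f1_def)
      next
        case False
        then show ?thesis using z by (simp add: H_def QQ ff)
      qed
    qed
    then show ?thesis using op Q1(2) by (auto simp: holomorphic_on_open field_differentiable_def)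
  qed
  show thesis
  proof
    show "H holomorphic_on UNIV" using fd by (simp add: holomorphic_on_def field_differentiable_at_within)
    show "f z = Q z * H z" for z using zeros[of z] by (auto simp: H_def)
  qed
qed

text \<open>Differentiating the product at a leaves only \<open>f a\<close>.\<close>

lemma entire_zero_of_mult:
  assumes f: "f holomorphic_on UNIV" and z0: "\<And>z::complex. (z - a) * f z = 0"
  shows "f a = 0"
proof -
  have "(f has_field_derivative deriv f a) (at a)" by (rule holomorphic_derivI[OF f open_UNIV UNIV_I])
  then have "((\<lambda>z. (z - a) * f z) has_field_derivative f a) (at a)"
    by (auto intro!: derivative_eq_intros)
  moreover have "((\<lambda>z. (z - a) * f z) has_field_derivative 0) (at a)" unfolding z0 by simp
  ultimately show ?thesis by (rule DERIV_unique)
qed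

text \<open>One circle for each e is enough, so the estimate may be restricted to circles that keep
  away from the zeros of a divisor.\<close>

lemma coef_eq_zeroI:
  assumes H: "H holomorphic_on UNIV"
    and small: "\<And>e. e > 0 \<Longrightarrow> \<exists>r>0. \<forall>z. norm z = r \<longrightarrow> norm (H z) \<le> e * r ^ m"
  shows "coef H m = 0"
proof -
  have "norm (coef H m) \<le> e" if e: "e > 0" for e
  proof -
    obtain r where r: "r > 0" "\<And>z. norm z = r \<Longrightarrow> norm (H z) \<le> e * r ^ m" using small[OF e] by blast
    have "norm ((deriv ^^ m) H 0) \<le> fact m * (e * r ^ m) / r ^ m"
    proof (rule Cauchy_inequality)
      show "H holomorphic_on ball 0 r" using H holomorphic_on_subset by blast
      show "continuous_on (cball 0 r) H" using H holomorphic_on_imp_continuous_on holomorphic_on_subset by blast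
    qed (use r in auto)
    then show ?thesis using r by (simp add: coef_deriv norm_divide field_simps)
  qed
  then show ?thesis by (metis dense_ge norm_le_zero_iff)
qed

text \<open>For small q the logarithm of the factor is linear in q. For norm q > 1/2 the term with
  ln (1 / d) alone brings the right side below d. The uniform exponential form turns a product of
  such factors into a sum.\<close>

lemma norm_one_minus_ge_exp:
  fixes q :: complex
  assumes d: "0 < d" "d \<le> 1" and q: "norm (1 - q) \<ge> d"
  shows "norm (1 - q) \<ge> exp (- ((2 + 2 * ln (1 / d)) * norm q))"
proof (cases "norm q \<le> 1/2")
  case True
  have "- (2 * norm q) \<le> - norm q - 2 * (norm q)\<^sup>2"
  proof -
    have "norm q * norm q \<le> norm q * (1/2)" using True by (intro mult_left_mono) auto
    then show ?thesis by (simp add: power2_eq_square)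
  qed
  also have "\<dots> \<le> ln (1 - norm q)" by (rule ln_one_minus_pos_lower_bound) (use True in auto)
  finally have "exp (- (2 * norm q)) \<le> 1 - norm q" using True by (simp add: ln_ge_iff)
  also have "\<dots> \<le> norm (1 - q)" using norm_triangle_ineq2[of 1 q] by simp
  finally have "exp (- (2 * norm q)) \<le> norm (1 - q)" .
  moreover have "0 \<le> ln (1 / d)" using d by simp
  then have "- ((2 + 2 * ln (1 / d)) * norm q) \<le> - (2 * norm q)" by (simp add: distrib_right)
  ultimately show ?thesis by (meson exp_le_cancel_iff order_trans)
next
  case False
  have l: "0 \<le> ln (1 / d)" using d by simp
  have "ln (1 / d) * 1 \<le> ln (1 / d) * (2 * norm q)" using False l by (intro mult_left_mono) auto
  moreover have "(2 + 2 * ln (1 / d)) * norm q = 2 * norm q + ln (1 / d) * (2 * norm q)" by (simp add: algebra_simps)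
  ultimately have "- ((2 + 2 * ln (1 / d)) * norm q) \<le> - ln (1 / d)" using norm_ge_zero[of q] by linarith
  also have "\<dots> = ln d" using d by (simp add: ln_div)
  finally have "exp (- ((2 + 2 * ln (1 / d)) * norm q)) \<le> d" using d by (simp add: ln_ge_iff)
  then show ?thesis using q by simp
qed

text \<open>The regularity shared by both directions: sufficiency assumes it, and necessity proves
  it before a canonical product can be formed. Separation is relative to the modulus.\<close>

locale near_regular = small_fock +
  fixes \<sigma> :: "nat \<Rightarrow> complex" and B c :: real
  assumes \<sigma>_nz: "\<And>i. \<sigma> i \<noteq> 0" and B: "\<And>i. \<bar>pos (\<sigma> i) - real i\<bar> \<le> B"
    and c: "c > 0" and sep: "\<And>i j. i \<noteq> j \<Longrightarrow> c * norm (\<sigma> i) \<le> norm (\<sigma> i - \<sigma> j)"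
begin

definition deviation :: "nat \<Rightarrow> real" where "deviation i = pos (\<sigma> i) - real i"
definition E :: "nat \<Rightarrow> real" where "E k = (\<Sum>i<k. deviation i)"
text \<open>No convergence factors occur since the moduli grow geometrically. Leaving out J covers
  the product and its cofactors, from which the Lagrange functions are made.\<close>

definition Q :: "nat set \<Rightarrow> complex \<Rightarrow> complex" where
  "Q J z = (\<Prod>i. if i \<in> J then 1 else 1 - z / \<sigma> i)"
text \<open>\<open>\<Psi> j k\<close> is the size of \<open>om z * \<bar>Q {j} z\<bar>\<close> on the circle \<open>pos z = k\<close>, away from the nodes.\<close>

definition \<Psi> :: "nat \<Rightarrow> nat \<Rightarrow> real" where
  "\<Psi> j k = exp (h * real k - 2 * h * E k - (if j < k then 2 * h * (real k - real j) else 0))"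

lemma B_nonneg: "B \<ge> 0" using B[of 0] by linarith
lemma \<Psi>_pos: "\<Psi> j k > 0" by (simp add: \<Psi>_def)
lemma norm_\<sigma>: "norm (\<sigma> i) = circ (pos (\<sigma> i))" by (rule norm_circ[OF \<sigma>_nz])
lemma inj_\<sigma>: "\<sigma> i = \<sigma> j \<Longrightarrow> i = j"
proof (rule ccontr)
  assume "\<sigma> i = \<sigma> j" "i \<noteq> j"
  then have "c * norm (\<sigma> i) \<le> 0" using sep[of i j] by simp
  then show False using c \<sigma>_nz[of i] by (simp add: mult_le_0_iff)
qed

section \<open>Convergence, zeros and divisibility of the canonical product\<close>

lemma norm_quot: "z \<noteq> 0 \<Longrightarrow> norm (z / \<sigma> i) = exp (2 * h * (pos z - pos (\<sigma> i)))"
  by (simp add: norm_divide norm_\<sigma> norm_circ[of z] circ_quot)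

lemma norm_quot_le: "norm (z / \<sigma> i) \<le> norm z / circ (- B) * exp (- (2 * h)) ^ i"
proof -
  have "circ (real i - B) \<le> norm (\<sigma> i)" unfolding norm_\<sigma> using B[of i] by (intro circ_le) linarith
  moreover have "circ (real i - B) = circ (- B) / exp (- (2 * h)) ^ i"
    by (simp add: circ_eq exp_of_nat_mult[symmetric] exp_diff[symmetric] algebra_simps)
  ultimately have "norm z / norm (\<sigma> i) \<le> norm z / (circ (- B) / exp (- (2 * h)) ^ i)"
    using circ_pos[of "real i - B"] by (intro divide_left_mono) (simp_all add: circ_pos \<sigma>_nz)
  then show ?thesis by (simp add: norm_divide)
qed

lemma summable_quot: "summable (\<lambda>i. norm z / circ (- B) * exp (- (2 * h)) ^ i)"
  using h by (intro summable_mult summable_geometric) auto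

lemma conv_Q: "convergent_prod (\<lambda>i. if i \<in> J then 1 else 1 - z / \<sigma> i)"
proof (rule abs_convergent_prod_imp_convergent_prod[OF summable_imp_abs_convergent_prod])
  show "summable (\<lambda>i. norm ((if i \<in> J then 1 else 1 - z / \<sigma> i) - 1))"
    by (rule summable_comparison_test'[OF summable_quot[of z], of 0])
       (use norm_quot_le[of z] circ_pos[of "-B"] in auto)
qed

lemma Q_limit: "(\<lambda>n. \<Prod>i<n. if i \<in> J then 1 else 1 - z / \<sigma> i) \<longlonglongrightarrow> Q J z"
  unfolding Q_def using convergent_prod_LIMSEQ[OF conv_Q[of J z]] by (simp add: LIMSEQ_lessThan_iff_atMost)

text \<open>On a disc of radius 1 the geometric majorant is uniform, so the partial products
  converge locally uniformly.\<close>

lemma Q_holo: "Q J holomorphic_on UNIV"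
proof (rule holomorphic_uniform_sequence)
  show "(\<lambda>z. \<Prod>i<n. if i \<in> J then 1 else 1 - z / \<sigma> i) holomorphic_on UNIV" for n
  proof (intro holomorphic_on_prod)
    fix i show "(\<lambda>z. if i \<in> J then 1 else 1 - z / \<sigma> i) holomorphic_on UNIV"
      by (cases "i \<in> J") (auto intro!: holomorphic_intros simp: \<sigma>_nz)
  qed
  fix x :: complex
  define R where "R = norm x + 1"
  have R: "norm z \<le> R" if "z \<in> cball x 1" for z
    using that norm_triangle_ineq2[of z x] by (simp add: R_def dist_norm norm_minus_commute)
  have "uniformly_convergent_on (cball x 1) (\<lambda>n z. \<Sum>i<n. norm ((if i \<in> J then 1 else 1 - z / \<sigma> i) - 1))"
  proof (rule Weierstrass_m_test')
    show "summable (\<lambda>i. R / circ (- B) * exp (- (2 * h)) ^ i)"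
      using h by (intro summable_mult summable_geometric) auto
    fix n z assume z: "z \<in> cball x 1"
    have "norm (z / \<sigma> n) \<le> R / circ (- B) * exp (- (2 * h)) ^ n"
      by (rule order_trans[OF norm_quot_le]) (use R[OF z] circ_pos[of "-B"] in \<open>auto intro!: mult_right_mono divide_right_mono\<close>)
    moreover have "0 \<le> R / circ (- B) * exp (- (2 * h)) ^ n" using circ_pos[of "-B"] by (simp add: R_def)
    ultimately show "norm (norm ((if n \<in> J then 1 else 1 - z / \<sigma> n) - 1)) \<le> R / circ (- B) * exp (- (2 * h)) ^ n" by simp
  qed
  then have "uniformly_convergent_on (cball x 1) (\<lambda>n z. \<Prod>i<n. if i \<in> J then 1 else 1 - z / \<sigma> i)"
  proof (rule uniformly_convergent_on_prod'[rotated 2])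
    fix n show "continuous_on (cball x 1) (\<lambda>z. if n \<in> J then 1 else 1 - z / \<sigma> n)"
      by (cases "n \<in> J") (auto intro!: continuous_intros simp: \<sigma>_nz)
  qed simp
  then obtain l where l: "uniform_limit (cball x 1) (\<lambda>n z. \<Prod>i<n. if i \<in> J then 1 else 1 - z / \<sigma> i) l sequentially"
    by (auto simp: uniformly_convergent_on_def)
  have "l z = Q J z" if "z \<in> cball x 1" for z
    using tendsto_uniform_limitI[OF l that] Q_limit LIMSEQ_unique by blast
  then have "uniform_limit (cball x 1) (\<lambda>n z. \<Prod>i<n. if i \<in> J then 1 else 1 - z / \<sigma> i) (Q J) sequentially"
    using l uniform_limit_cong'[of "cball x 1"] by (metis (no_types, lifting))
  then show "\<exists>d>0. cball x d \<subseteq> UNIV \<and> uniform_limit (cball x d) (\<lambda>n z. \<Prod>i<n. if i \<in> J then 1 else 1 - z / \<sigma> i) (Q J) sequentially"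
    by (intro exI[of _ 1]) auto
qed auto

lemma Q_split:
  assumes "i \<notin> J" shows "Q J z = (1 - z / \<sigma> i) * Q (insert i J) z"
proof (rule LIMSEQ_unique[OF Q_limit])
  have "(\<lambda>n. (1 - z / \<sigma> i) * (\<Prod>m<n. if m \<in> insert i J then 1 else 1 - z / \<sigma> m)) \<longlonglongrightarrow> (1 - z / \<sigma> i) * Q (insert i J) z"
    by (intro tendsto_mult tendsto_const Q_limit)
  moreover have "\<forall>\<^sub>F n in sequentially. (1 - z / \<sigma> i) * (\<Prod>m<n. if m \<in> insert i J then 1 else 1 - z / \<sigma> m)
     = (\<Prod>m<n. if m \<in> J then 1 else 1 - z / \<sigma> m)"
  proof (rule eventually_sequentiallyI[of "Suc i"])
    fix n assume "Suc i \<le> n"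
    then have i: "i \<in> {..<n}" by simp
    show "(1 - z / \<sigma> i) * (\<Prod>m<n. if m \<in> insert i J then 1 else 1 - z / \<sigma> m) = (\<Prod>m<n. if m \<in> J then 1 else 1 - z / \<sigma> m)"
      using assms unfolding prod.remove[OF finite_lessThan i] by (auto intro!: prod.cong)
  qed
  ultimately show "(\<lambda>n. \<Prod>m<n. if m \<in> J then 1 else 1 - z / \<sigma> m) \<longlonglongrightarrow> (1 - z / \<sigma> i) * Q (insert i J) z"
    by (rule Lim_transform_eventually)
qed

lemma Q_zero_iff: "Q J z = 0 \<longleftrightarrow> (\<exists>i. i \<notin> J \<and> z = \<sigma> i)"
proof
  assume "Q J z = 0"
  then have "\<exists>i. (if i \<in> J then 1 else 1 - z / \<sigma> i) = 0"
    unfolding Q_def using prodinf_nonzero[OF conv_Q[of J z]] by blast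
  then show "\<exists>i. i \<notin> J \<and> z = \<sigma> i" using \<sigma>_nz by (auto split: if_splits)
next
  assume "\<exists>i. i \<notin> J \<and> z = \<sigma> i"
  then show "Q J z = 0" using Q_split \<sigma>_nz by fastforce
qed

text \<open>The product over \<open>insert i J\<close> is the cofactor at node i. It does not vanish
  there because the nodes are distinct, so the zeros are simple and \<open>entire_divide\<close>
  applies.\<close>

lemma Q_divides:
  assumes f: "f holomorphic_on UNIV" and z: "\<And>i. i \<notin> J \<Longrightarrow> f (\<sigma> i) = 0"
  obtains H where "H holomorphic_on UNIV" "\<And>z. f z = Q J z * H z"
proof (rule entire_divide[OF f Q_holo[of J]])
  fix z assume "Q J z = 0"
  then obtain i where i: "i \<notin> J" "z = \<sigma> i" using Q_zero_iff by blast
  show "f z = 0 \<and> (\<exists>Q1. Q1 holomorphic_on UNIV \<and> Q1 z \<noteq> 0 \<and> (\<forall>w. Q J w = (w - z) * Q1 w))"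
  proof (intro conjI exI[of _ "\<lambda>w. - (1 / \<sigma> i) * Q (insert i J) w"] allI)
    show "f z = 0" using z i by simp
    show "(\<lambda>w. - (1 / \<sigma> i) * Q (insert i J) w) holomorphic_on UNIV"
      by (intro holomorphic_intros Q_holo)
    have "Q (insert i J) z \<noteq> 0" unfolding Q_zero_iff i(2) using inj_\<sigma> by blast
    then show "- (1 / \<sigma> i) * Q (insert i J) z \<noteq> 0" using \<sigma>_nz by simp
    show "Q J w = (w - z) * (- (1 / \<sigma> i) * Q (insert i J) w)" for w
      unfolding Q_split[OF i(1), of w] i(2) using \<sigma>_nz[of i] by (simp add: field_simps)
  qed
qed (use that in blast)

section \<open>Size of the canonical product on circles\<close>

definition qq :: "nat \<Rightarrow> nat \<Rightarrow> complex \<Rightarrow> nat \<Rightarrow> complex" where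
  "qq j k z i = (if i = j then 0 else if i < k then \<sigma> i / z else z / \<sigma> i)"
text \<open>Together with \<open>qq\<close> this splits each factor on a circle near position k. For
  i < k the large quotient z / \<sigma> i is extracted, \<open>qe\<close> is its log-modulus, and 1
  - \<sigma> i / z remains; for i >= k nothing is extracted. The remaining \<open>qq\<close> are
  geometrically small in |k - i|.\<close>

definition qe :: "nat \<Rightarrow> nat \<Rightarrow> complex \<Rightarrow> nat \<Rightarrow> real" where
  "qe j k z i = (if i < k \<and> i \<noteq> j then 2 * h * (pos z - pos (\<sigma> i)) else 0)"
text \<open>The geometric bound of \<open>norm_qq_le\<close>, summed over the indices.\<close>

definition qS :: real where "qS = exp (2 * h * (2 * B + 1)) * (2 / (1 - exp (- (2 * h))))"

lemma norm_factor:
  assumes "z \<noteq> 0"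
  shows "norm (if i \<in> {j} then 1 else 1 - z / \<sigma> i) = exp (qe j k z i) * norm (1 - qq j k z i)"
proof (cases "i < k \<and> i \<noteq> j")
  case True
  have "1 - z / \<sigma> i = - (z / \<sigma> i) * (1 - \<sigma> i / z)" using assms \<sigma>_nz[of i] by (simp add: field_simps)
  then have "norm (1 - z / \<sigma> i) = norm (z / \<sigma> i) * norm (1 - \<sigma> i / z)" by (metis norm_minus_cancel norm_mult)
  then show ?thesis using True assms by (simp add: qe_def qq_def norm_quot)
qed (auto simp: qe_def qq_def)

text \<open>The radius B + 1 accommodates circles between positions k and k + 1 as well as the node
  with index k. Together with the error B of node i it gives 2 B + 1 in the exponent.\<close>

lemma norm_qq_le:
  assumes z: "z \<noteq> 0" "\<bar>pos z - real k\<bar> \<le> B + 1"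
  shows "norm (qq j k z i) \<le> exp (2 * h * (2 * B + 1)) * exp (- (2 * h * \<bar>real k - real i\<bar>))"
proof -
  have "norm (qq j k z i) \<le> exp (2 * h * (2 * B + 1 - \<bar>real k - real i\<bar>))"
  proof (cases "i = j")
    case False
    show ?thesis
    proof (cases "i < k")
      case True
      have "norm (\<sigma> i / z) = exp (2 * h * (pos (\<sigma> i) - pos z))"
        by (simp add: norm_divide norm_\<sigma> norm_circ[OF z(1)] circ_quot)
      moreover have "2 * h * (pos (\<sigma> i) - pos z) \<le> 2 * h * (2 * B + 1 - \<bar>real k - real i\<bar>)"
        using h B[of i] z(2) True by (intro mult_left_mono) auto
      ultimately show ?thesis using True False by (simp add: qq_def)
    next
      case ge: False
      have "2 * h * (pos z - pos (\<sigma> i)) \<le> 2 * h * (2 * B + 1 - \<bar>real k - real i\<bar>)"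
        using h B[of i] z(2) ge by (intro mult_left_mono) auto
      then show ?thesis using ge False norm_quot[OF z(1), of i] by (simp add: qq_def)
    qed
  qed (simp add: qq_def)
  then show ?thesis by (simp add: exp_add[symmetric] algebra_simps)
qed

lemma sum_qq_le:
  assumes z: "z \<noteq> 0" "\<bar>pos z - real k\<bar> \<le> B + 1"
  shows "(\<Sum>i<n. norm (qq j k z i)) \<le> qS"
proof -
  have "ennreal (\<Sum>i<n. exp (- (2 * h * \<bar>real k - real i\<bar>))) = (\<Sum>i<n. ennreal (exp (- (2 * h * \<bar>real k - real i\<bar>))))" by simp
  also have "\<dots> \<le> (\<Sum>i. ennreal (exp (- (2 * h * \<bar>real k - real i\<bar>))))" by (rule sum_le_suminf) auto
  also have "\<dots> \<le> ennreal (2 / (1 - exp (- (2 * h))))" using h by (intro suminf_exp_dist_nat) auto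
  finally have *: "(\<Sum>i<n. exp (- (2 * h * \<bar>real k - real i\<bar>))) \<le> 2 / (1 - exp (- (2 * h)))"
    using h by (subst (asm) ennreal_le_iff) auto
  have "(\<Sum>i<n. norm (qq j k z i)) \<le> (\<Sum>i<n. exp (2 * h * (2 * B + 1)) * exp (- (2 * h * \<bar>real k - real i\<bar>)))"
    by (intro sum_mono norm_qq_le z)
  also have "\<dots> = exp (2 * h * (2 * B + 1)) * (\<Sum>i<n. exp (- (2 * h * \<bar>real k - real i\<bar>)))" by (rule sum_distrib_left[symmetric])
  also have "\<dots> \<le> qS" unfolding qS_def using * by (intro mult_left_mono) auto
  finally show ?thesis .
qed

text \<open>The extracted exponents add up to h (pos z)^2 plus terms in k, \<open>E k\<close> and
  the offset \<xi>, apart from the correction for the omitted index j. The square cancels the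
  Gaussian in \<open>om\<close>, so for bounded \<xi> the weighted size is governed by
  \<open>E\<close>.\<close>

lemma sum_qe:
  assumes "k \<le> n" "pos z = real k + \<xi>"
  shows "(\<Sum>i<n. qe j k z i) = h * (pos z)\<^sup>2 + (h * real k - 2 * h * E k - h * \<xi>\<^sup>2 - (if j < k then 2 * h * (pos z - pos (\<sigma> j)) else 0))"
proof -
  have g: "2 * (\<Sum>i<k. real i) = real k * real k - real k" for k :: nat by (induction k) (auto simp: algebra_simps)
  have s1: "(\<Sum>i<k. 2 * h * (pos z - pos (\<sigma> i))) = 2 * h * (real k * pos z) - 2 * h * (\<Sum>i<k. real i) - 2 * h * E k"
    by (simp add: E_def deviation_def sum_subtractf sum_distrib_left[symmetric] algebra_simps)
  have "(\<Sum>i<n. qe j k z i) = (\<Sum>i<k. qe j k z i)"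
    using assms(1) by (intro sum.mono_neutral_right) (auto simp: qe_def)
  also have "\<dots> = (\<Sum>i<k. 2 * h * (pos z - pos (\<sigma> i)) - (if i = j then 2 * h * (pos z - pos (\<sigma> j)) else 0))"
    by (intro sum.cong) (auto simp: qe_def)
  also have "\<dots> = (\<Sum>i<k. 2 * h * (pos z - pos (\<sigma> i))) - (if j < k then 2 * h * (pos z - pos (\<sigma> j)) else 0)"
    by (simp add: sum_subtractf)
  also have "(\<Sum>i<k. 2 * h * (pos z - pos (\<sigma> i))) = h * (pos z)\<^sup>2 + (h * real k - 2 * h * E k - h * \<xi>\<^sup>2)"
  proof -
    have "2 * h * (\<Sum>i<k. real i) = h * (real k * real k - real k)" using g[of k] by simp
    then have "(\<Sum>i<k. 2 * h * (pos z - pos (\<sigma> i))) = 2 * h * (real k * pos z) - h * (real k * real k - real k) - 2 * h * E k"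
      using s1 by linarith
    moreover have "2 * h * (real k * pos z) - h * (real k * real k - real k) = h * (pos z)\<^sup>2 + (h * real k - h * \<xi>\<^sup>2)"
      unfolding assms(2) by (simp add: power2_eq_square algebra_simps)
    ultimately show ?thesis by linarith
  qed
  finally show ?thesis by simp
qed

text \<open>Three losses: the constant in \<open>om\<close>, the square of the offset of z from k,
  and the replacement of \<open>pos z - pos (\<sigma> j)\<close> by k - j.\<close>

definition qC :: real where "qC = h * (2 / p)\<^sup>2 + h * (B + 1)\<^sup>2 + 2 * h * (2 * B + 1)"

lemma om_exp_qe:
  assumes z: "\<bar>pos z - real k\<bar> \<le> B + 1" and n: "k \<le> n"
  shows "om z * exp (\<Sum>i<n. qe j k z i) \<le> exp qC * \<Psi> j k" "\<Psi> j k \<le> exp qC * (om z * exp (\<Sum>i<n. qe j k z i))"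
proof -
  define \<xi> where "\<xi> = pos z - real k"
  have \<xi>: "pos z = real k + \<xi>" "\<bar>\<xi>\<bar> \<le> B + 1" using z by (auto simp: \<xi>_def)
  have x2: "h * \<xi>\<^sup>2 \<le> h * (B + 1)\<^sup>2" "0 \<le> h * \<xi>\<^sup>2"
    using h \<xi>(2) by (auto intro!: mult_left_mono simp: power2_le_iff_abs_le abs_le_square_iff[symmetric])
  define d where "d = (if j < k then 2 * h * (pos z - pos (\<sigma> j)) else 0)"
  define d' where "d' = (if j < k then 2 * h * (real k - real j) else 0)"
  have dd: "\<bar>d - d'\<bar> \<le> 2 * h * (2 * B + 1)"
  proof (cases "j < k")
    case True
    have "d - d' = 2 * h * (\<xi> - (pos (\<sigma> j) - real j))"
      using True by (simp add: d_def d'_def \<xi>(1) algebra_simps)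
    then have "\<bar>d - d'\<bar> = 2 * h * \<bar>\<xi> - (pos (\<sigma> j) - real j)\<bar>" using h by (simp add: abs_mult)
    also have "\<dots> \<le> 2 * h * (2 * B + 1)" using h \<xi>(2) B[of j] by (intro mult_left_mono) auto
    finally show ?thesis .
  next
    case False
    then show ?thesis using h B_nonneg by (simp add: d_def d'_def)
  qed
  have e: "om z * exp (\<Sum>i<n. qe j k z i) = exp (h * (2 / p)\<^sup>2 + (h * real k - 2 * h * E k - h * \<xi>\<^sup>2 - d))"
    unfolding sum_qe[OF n \<xi>(1)] om_def by (simp add: exp_add[symmetric] d_def)
  have P: "\<Psi> j k = exp (h * real k - 2 * h * E k - d')" by (simp add: \<Psi>_def d'_def)
  have t: "0 \<le> h * (2 / p)\<^sup>2" using h by simp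
  show "om z * exp (\<Sum>i<n. qe j k z i) \<le> exp qC * \<Psi> j k" 
    unfolding e P exp_add[symmetric] exp_le_cancel_iff qC_def using x2 dd t by linarith
  show "\<Psi> j k \<le> exp qC * (om z * exp (\<Sum>i<n. qe j k z i))"
    unfolding e P exp_add[symmetric] exp_le_cancel_iff qC_def using x2 dd t by linarith
qed

lemma Q_upper:
  assumes z: "z \<noteq> 0" "\<bar>pos z - real k\<bar> \<le> B + 1"
  shows "om z * norm (Q {j} z) \<le> exp (qC + qS) * \<Psi> j k"
proof (rule LIMSEQ_le_const2)
  show "(\<lambda>n. om z * norm (\<Prod>i<n. if i \<in> {j} then 1 else 1 - z / \<sigma> i)) \<longlonglongrightarrow> om z * norm (Q {j} z)"
    by (intro tendsto_intros Q_limit)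
  have "om z * norm (\<Prod>i<n. if i \<in> {j} then 1 else 1 - z / \<sigma> i) \<le> exp (qC + qS) * \<Psi> j k" if n: "n \<ge> k" for n
  proof -
    have "(\<Prod>i<n. norm (1 - qq j k z i)) \<le> (\<Prod>i<n. exp (norm (qq j k z i)))"
    proof (intro prod_mono conjI)
      fix i
      have "norm (1 - qq j k z i) \<le> 1 + norm (qq j k z i)" using norm_triangle_ineq4[of 1 "qq j k z i"] by simp
      then show "norm (1 - qq j k z i) \<le> exp (norm (qq j k z i))" using exp_ge_add_one_self order_trans by blast
    qed simp
    also have "\<dots> = exp (\<Sum>i<n. norm (qq j k z i))" by (simp add: exp_sum)
    also have "\<dots> \<le> exp qS" using sum_qq_le[OF z] by simp
    finally have 1: "(\<Prod>i<n. norm (1 - qq j k z i)) \<le> exp qS" .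
    have "om z * norm (\<Prod>i<n. if i \<in> {j} then 1 else 1 - z / \<sigma> i) = om z * (\<Prod>i<n. exp (qe j k z i) * norm (1 - qq j k z i))"
      by (simp only: prod_norm[symmetric] norm_factor[OF z(1), of _ j k])
    also have "\<dots> = (om z * exp (\<Sum>i<n. qe j k z i)) * (\<Prod>i<n. norm (1 - qq j k z i))"
      by (simp add: prod.distrib exp_sum)
    also have "\<dots> \<le> (exp qC * \<Psi> j k) * exp qS"
      by (rule mult_mono[OF om_exp_qe(1)[OF z(2) n] 1]) (auto simp: less_imp_le[OF \<Psi>_pos] prod_nonneg)
    finally show ?thesis by (simp add: exp_add mult_ac)
  qed
  then show "\<exists>N. \<forall>n\<ge>N. om z * norm (\<Prod>i<n. if i \<in> {j} then 1 else 1 - z / \<sigma> i) \<le> exp (qC + qS) * \<Psi> j k" by blast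
qed

text \<open>Unlike the upper bound, this requires a relative distance d from every node other than
  j. The halved d in the constant allows for the inversion of the factors with index below
  k.\<close>

lemma Q_lower:
  assumes z: "z \<noteq> 0" "\<bar>pos z - real k\<bar> \<le> B + 1"
    and d: "0 < d" "d \<le> 1" "\<And>i. i \<noteq> j \<Longrightarrow> d \<le> norm (1 - z / \<sigma> i)"
  shows "\<Psi> j k \<le> exp (qC + (2 + 2 * ln (2 / d)) * qS) * (om z * norm (Q {j} z))"
proof (rule LIMSEQ_le_const)
  define K where "K = 2 + 2 * ln (2 / d)"
  have K: "K \<ge> 0" using d by (simp add: K_def)
  show "(\<lambda>n. exp (qC + (2 + 2 * ln (2 / d)) * qS) * (om z * norm (\<Prod>i<n. if i \<in> {j} then 1 else 1 - z / \<sigma> i)))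
     \<longlonglongrightarrow> exp (qC + (2 + 2 * ln (2 / d)) * qS) * (om z * norm (Q {j} z))"
    by (intro tendsto_intros Q_limit)
  \<comment> \<open>For i < k the bound is known for 1 - z / \<sigma> i but wanted for 1 - w with w
    = \<sigma> i / z. The moduli differ by the factor norm w; either norm w is at least 1/2, or w is
    so small that 1 - w is far from 0.\<close>
  have dq: "d / 2 \<le> norm (1 - qq j k z i)" for i
  proof (cases "i = j")
    case False
    show ?thesis
    proof (cases "i < k")
      case True
      define w where "w = \<sigma> i / z"
      have "1 - z / \<sigma> i = - (1 - w) / w" using \<sigma>_nz[of i] z by (simp add: w_def field_simps)
      then have "norm (1 - z / \<sigma> i) = norm (1 - w) / norm w" by (metis norm_divide norm_minus_cancel)
      moreover have "0 < norm w" using \<sigma>_nz[of i] z by (simp add: w_def)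
      ultimately have 1: "d * norm w \<le> norm (1 - w)" using d(3)[OF False] by (simp add: pos_le_divide_eq)
      show ?thesis
      proof (cases "norm w \<ge> 1/2")
        case True
        have "d * (1/2) \<le> d * norm w" using d True by (intro mult_left_mono) auto
        then show ?thesis using 1 \<open>i < k\<close> False by (simp add: qq_def w_def)
      next
        case f: False
        have "1 - norm w \<le> norm (1 - w)" using norm_triangle_ineq2[of 1 w] by simp
        then show ?thesis using f d \<open>i < k\<close> False by (simp add: qq_def w_def)
      qed
    next
      case f: False
      then show ?thesis using d(3)[OF False] False d(1) by (simp add: qq_def)
    qed
  qed (use d in \<open>simp add: qq_def\<close>)
  have "\<Psi> j k \<le> exp (qC + K * qS) * (om z * norm (\<Prod>i<n. if i \<in> {j} then 1 else 1 - z / \<sigma> i))" if n: "n \<ge> k" for n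
  proof -
    have "exp (- (K * qS)) \<le> exp (- (K * (\<Sum>i<n. norm (qq j k z i))))" using sum_qq_le[OF z] K by (simp add: mult_left_mono)
    also have "\<dots> = (\<Prod>i<n. exp (- (K * norm (qq j k z i))))" by (simp add: exp_sum[symmetric] sum_negf sum_distrib_left)
    also have "\<dots> \<le> (\<Prod>i<n. norm (1 - qq j k z i))"
    proof (intro prod_mono conjI)
      fix i show "exp (- (K * norm (qq j k z i))) \<le> norm (1 - qq j k z i)"
        using norm_one_minus_ge_exp[OF _ _ dq, of i] d by (simp add: K_def)
    qed simp
    finally have 1: "exp (- (K * qS)) \<le> (\<Prod>i<n. norm (1 - qq j k z i))" .
    have eq: "om z * norm (\<Prod>i<n. if i \<in> {j} then 1 else 1 - z / \<sigma> i) = om z * (\<Prod>i<n. exp (qe j k z i) * norm (1 - qq j k z i))"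
      by (simp only: prod_norm[symmetric] norm_factor[OF z(1), of _ j k])
    also have "\<dots> = (om z * exp (\<Sum>i<n. qe j k z i)) * (\<Prod>i<n. norm (1 - qq j k z i))"
      by (simp add: prod.distrib exp_sum)
    finally have eq: "om z * norm (\<Prod>i<n. if i \<in> {j} then 1 else 1 - z / \<sigma> i) = (om z * exp (\<Sum>i<n. qe j k z i)) * (\<Prod>i<n. norm (1 - qq j k z i))" .
    have "\<Psi> j k \<le> exp qC * (om z * exp (\<Sum>i<n. qe j k z i))" by (rule om_exp_qe(2)[OF z(2) n])
    also have "\<dots> = exp (qC + K * qS) * ((om z * exp (\<Sum>i<n. qe j k z i)) * exp (- (K * qS)))"
      by (simp add: exp_add exp_minus field_simps)
    also have "\<dots> \<le> exp (qC + K * qS) * ((om z * exp (\<Sum>i<n. qe j k z i)) * (\<Prod>i<n. norm (1 - qq j k z i)))"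
      using 1 om_pos[of z] by (intro mult_left_mono) auto
    finally show ?thesis unfolding eq .
  qed
  then show "\<exists>N. \<forall>n\<ge>N. \<Psi> j k \<le> exp (qC + (2 + 2 * ln (2 / d)) * qS) * (om z * norm (\<Prod>i<n. if i \<in> {j} then 1 else 1 - z / \<sigma> i))"
    unfolding K_def by blast
qed

text \<open>The condition a <= b + 1 keeps the bound nonnegative, so an empty interval is
  covered.\<close>

lemma card_real_interval_nat:
  fixes a b :: real
  assumes "a \<le> b + 1"
  shows "finite {i::nat. a \<le> real i \<and> real i \<le> b}" "real (card {i::nat. a \<le> real i \<and> real i \<le> b}) \<le> b - a + 1"
proof -
  have sub: "int ` {i::nat. a \<le> real i \<and> real i \<le> b} \<subseteq> {\<lceil>a\<rceil>..\<lfloor>b\<rfloor>}"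
    by (auto simp: ceiling_le_iff le_floor_iff)
  have fin: "finite (int ` {i::nat. a \<le> real i \<and> real i \<le> b})" using sub finite_subset by blast
  then show f: "finite {i::nat. a \<le> real i \<and> real i \<le> b}" by (rule finite_imageD) auto
  have "card {i::nat. a \<le> real i \<and> real i \<le> b} = card (int ` {i::nat. a \<le> real i \<and> real i \<le> b})"
    by (rule card_image[symmetric]) auto
  also have "\<dots> \<le> card {\<lceil>a\<rceil>..\<lfloor>b\<rfloor>}" using sub by (intro card_mono) auto
  finally have "real (card {i::nat. a \<le> real i \<and> real i \<le> b}) \<le> real (nat (\<lfloor>b\<rfloor> - \<lceil>a\<rceil> + 1))" by simp
  also have "\<dots> \<le> b - a + 1" using assms by (cases "\<lfloor>b\<rfloor> - \<lceil>a\<rceil> + 1 \<ge> 0") (auto simp: of_nat_nat, linarith+)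
  finally show "real (card {i::nat. a \<le> real i \<and> real i \<le> b}) \<le> b - a + 1" .
qed

text \<open>Pigeonhole: boundedly many nodes have position near \<open>[k, k + 1]\<close>, so some circle in between avoids all of them.\<close>

lemma good_circle:
  obtains d where "0 < d" "d \<le> 1" "\<And>k::nat. \<exists>y. real k \<le> y \<and> y \<le> real k + 1 \<and> (\<forall>z. norm z = circ y \<longrightarrow> (\<forall>i. d \<le> norm (1 - z / \<sigma> i)))"
proof -
  \<comment> \<open>At most 2 B + 2 indices can have a node close to positions between k and k + 1,
    so N candidate circles cannot all be blocked.\<close>
  define N where "N = nat \<lceil>2 * B\<rceil> + 3"
  have N: "2 * B + 2 < real N" "N > 0" using B_nonneg unfolding N_def by (auto, linarith)
  define \<delta> where "\<delta> = 1 / (2 * real N)"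
  have \<delta>: "\<delta> > 0" using N by (simp add: \<delta>_def)
  \<comment> \<open>A distance \<delta> in position moves the modulus of z / \<sigma> i away from 1
    by a factor \<open>exp (2 * h * \<delta>)\<close>, up or down; d is the smaller of the two
    gaps.\<close>
  define d where "d = 1 - exp (- (2 * h * \<delta>))"
  have d: "0 < d" "d \<le> 1" using h \<delta> by (auto simp: d_def)
  show thesis
  proof
    fix k :: nat
    \<comment> \<open>Midpoints of N equal subintervals. They are 2 \<delta> apart, so a node closer
      than \<delta> blocks at most one of them.\<close>
    define y where "y l = real k + (real l + 1/2) / real N" for l
    have "\<exists>l<N. \<forall>i. \<delta> \<le> \<bar>y l - pos (\<sigma> i)\<bar>"
    proof (rule ccontr)
      assume "\<not> ?thesis"
      then have "\<forall>l. \<exists>i. l < N \<longrightarrow> \<bar>y l - pos (\<sigma> i)\<bar> < \<delta>" by (meson not_le)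
      then obtain g where g: "\<And>l. l < N \<Longrightarrow> \<bar>y l - pos (\<sigma> (g l))\<bar> < \<delta>" by metis
      have inj: "inj_on g {..<N}"
      proof (rule inj_onI)
        fix l m assume lm: "l \<in> {..<N}" "m \<in> {..<N}" "g l = g m"
        then have "\<bar>y l - y m\<bar> < 2 * \<delta>" using g[of l] g[of m] by auto
        then have "\<bar>real l - real m\<bar> / real N < 1 / real N"
          using N by (simp add: y_def \<delta>_def diff_divide_distrib[symmetric] abs_divide)
        then have "\<bar>real l - real m\<bar> < 1" using N by (simp add: divide_less_cancel)
        then show "l = m" by linarith
      qed
      have "g ` {..<N} \<subseteq> {i. real k - B \<le> real i \<and> real i \<le> real k + 1 + B}"
      proof (rule image_subsetI)
        fix l assume "l \<in> {..<N}"
        then have l: "l < N" by simp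
        have 1: "y l - real k \<ge> \<delta>" using N by (simp add: y_def \<delta>_def field_simps)
        have "(real l + 1) / real N \<le> 1" using l N by simp
        moreover have "y l - real k + \<delta> = (real l + 1) / real N" using N by (simp add: y_def \<delta>_def field_simps)
        ultimately have 2: "y l - real k \<le> 1 - \<delta>" by linarith
        show "g l \<in> {i. real k - B \<le> real i \<and> real i \<le> real k + 1 + B}"
          using 1 2 g[OF l] B[of "g l"] by (simp add: abs_less_iff abs_le_iff)
      qed
      then have "card (g ` {..<N}) \<le> card {i. real k - B \<le> real i \<and> real i \<le> real k + 1 + B}"
        using B_nonneg by (intro card_mono card_real_interval_nat) auto
      then have "real N \<le> real (card {i. real k - B \<le> real i \<and> real i \<le> real k + 1 + B})"
        by (simp add: card_image[OF inj])
      also have "\<dots> \<le> real k + 1 + B - (real k - B) + 1" using B_nonneg by (intro card_real_interval_nat) auto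
      finally show False using N by linarith
    qed
    then obtain l where l: "l < N" "\<And>i. \<delta> \<le> \<bar>y l - pos (\<sigma> i)\<bar>" by blast
    have "real l + 1 \<le> real N" using l by linarith
    then have y1: "y l \<le> real k + 1" using N by (simp add: y_def field_simps)
    show "\<exists>y. real k \<le> y \<and> y \<le> real k + 1 \<and> (\<forall>z. norm z = circ y \<longrightarrow> (\<forall>i. d \<le> norm (1 - z / \<sigma> i)))"
    proof (intro exI[of _ "y l"] conjI allI impI)
      show "real k \<le> y l" by (simp add: y_def)
      show "y l \<le> real k + 1" by fact
      fix z :: complex and i assume z: "norm z = circ (y l)"
      have znz: "z \<noteq> 0" using z circ_pos[of "y l"] by auto
      have q: "norm (z / \<sigma> i) = exp (2 * h * (y l - pos (\<sigma> i)))" using norm_quot[OF znz] pos_circ[OF z] by simp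
      show "d \<le> norm (1 - z / \<sigma> i)"
      proof (cases "y l \<ge> pos (\<sigma> i)")
        case True
        then have "2 * h * \<delta> \<le> 2 * h * (y l - pos (\<sigma> i))" using l(2)[of i] h by (intro mult_left_mono) auto
        then have "exp (2 * h * \<delta>) \<le> norm (z / \<sigma> i)" by (simp add: q)
        moreover have "norm (z / \<sigma> i) - 1 \<le> norm (1 - z / \<sigma> i)" using norm_triangle_ineq2[of "z / \<sigma> i" 1] by (simp add: norm_minus_commute)
        moreover have "1 + 2 * h * \<delta> \<le> exp (2 * h * \<delta>)" by (rule exp_ge_add_one_self)
        moreover have "1 + - (2 * h * \<delta>) \<le> exp (- (2 * h * \<delta>))" by (rule exp_ge_add_one_self)
        ultimately show ?thesis unfolding d_def by linarith
      next
        case False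
        then have "2 * h * (y l - pos (\<sigma> i)) \<le> 2 * h * (- \<delta>)" using l(2)[of i] h by (intro mult_left_mono) auto
        then have "norm (z / \<sigma> i) \<le> exp (- (2 * h * \<delta>))" by (simp add: q)
        moreover have "1 - norm (z / \<sigma> i) \<le> norm (1 - z / \<sigma> i)" using norm_triangle_ineq2[of 1 "z / \<sigma> i"] by simp
        ultimately show ?thesis unfolding d_def by linarith
      qed
    qed
  qed (use d in auto)
qed

text \<open>On a circle near position k that avoids the nodes, H is at most of order exp(h k + 2 h E
  k), while the m-th power of the radius is at least exp(2 h m k). The assumption on
  \<open>E\<close> makes the ratio tend to 0.\<close>

lemma quotient_coef_zero:
  assumes H: "H holomorphic_on UNIV" and fQ: "\<And>z. f z = Q {j} z * H z"
    and D: "\<And>z. z \<noteq> 0 \<Longrightarrow> om z * norm (f z) \<le> D"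
    and \<eta>: "\<eta> > 0" and EE: "\<And>k. E k \<le> (real m - 1/2 - \<eta>) * real k + C"
  shows "coef H m = 0"
proof (rule coef_eq_zeroI[OF H])
  fix e :: real assume e: "e > 0"
  obtain d where d: "0 < d" "d \<le> 1" and gc: "\<And>k::nat. \<exists>y. real k \<le> y \<and> y \<le> real k + 1 \<and> (\<forall>z. norm z = circ y \<longrightarrow> (\<forall>i. d \<le> norm (1 - z / \<sigma> i)))"
    using good_circle by blast
  define A where "A = exp (qC + (2 + 2 * ln (2 / d)) * qS)"
  have A: "A > 0" by (simp add: A_def)
  have D0: "D \<ge> 0" using D[of 1] om_pos[of 1] by (meson less_imp_le mult_nonneg_nonneg norm_ge_zero order_trans one_neq_zero)
  define G where "G k = D * A * exp (2 * h * C) * exp (- (2 * h * \<eta>)) ^ k" for k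
  have "G \<longlonglongrightarrow> D * A * exp (2 * h * C) * 0"
    unfolding G_def using h \<eta> by (intro tendsto_intros LIMSEQ_realpow_zero) auto
  then have "\<forall>\<^sub>F k in sequentially. G k < e" using e by (intro order_tendstoD) auto
  then obtain k where k: "G k < e" by (auto simp: eventually_sequentially)
  obtain y where y: "real k \<le> y" "y \<le> real k + 1" "\<And>z i. norm z = circ y \<Longrightarrow> d \<le> norm (1 - z / \<sigma> i)"
    using gc[of k] by blast
  show "\<exists>r>0. \<forall>z. norm z = r \<longrightarrow> norm (H z) \<le> e * r ^ m"
  proof (intro exI[of _ "circ y"] conjI allI impI)
    fix z :: complex assume z: "norm z = circ y"
    have znz: "z \<noteq> 0" using z circ_pos[of y] by auto
    have pz: "pos z = y" by (rule pos_circ[OF z])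
    have "\<Psi> j k \<le> A * (om z * norm (Q {j} z))"
      unfolding A_def by (rule Q_lower[OF znz]) (use y z pz d B_nonneg in auto)
    then have "\<Psi> j k * norm (H z) \<le> A * (om z * norm (Q {j} z)) * norm (H z)" by (intro mult_right_mono) auto
    also have "\<dots> = A * (om z * norm (f z))" by (simp add: fQ norm_mult mult_ac)
    also have "\<dots> \<le> A * D" using A D[OF znz] by (intro mult_left_mono) auto
    finally have "norm (H z) \<le> A * D / \<Psi> j k" using \<Psi>_pos[of j k] by (simp add: field_simps)
    also have "\<dots> \<le> A * D * exp (h * real k + 2 * h * E k)"
    proof -
      have "- (h * real k + 2 * h * E k) \<le> h * real k - 2 * h * E k - (if j < k then 2 * h * (real k - real j) else 0)"
        using h by (auto simp: algebra_simps)
      then have "exp (- (h * real k + 2 * h * E k)) \<le> \<Psi> j k" unfolding \<Psi>_def by simp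
      then have "A * D / \<Psi> j k \<le> A * D / exp (- (h * real k + 2 * h * E k))"
        using A D0 by (intro divide_left_mono) (auto simp: \<Psi>_pos)
      then show ?thesis by (simp only: exp_minus divide_inverse inverse_inverse_eq)
    qed
    also have "\<dots> \<le> A * D * (exp (2 * h * C) * exp (- (2 * h * \<eta>)) ^ k * exp (2 * h * real m * real k))"
    proof (intro mult_left_mono)
      have "2 * h * E k \<le> 2 * h * ((real m - 1/2 - \<eta>) * real k + C)" using EE[of k] h by (intro mult_left_mono) auto
      then show "exp (h * real k + 2 * h * E k) \<le> exp (2 * h * C) * exp (- (2 * h * \<eta>)) ^ k * exp (2 * h * real m * real k)"
        unfolding exp_of_nat_mult[symmetric] exp_add[symmetric] exp_le_cancel_iff by (simp add: algebra_simps)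
    qed (use A D0 in auto)
    also have "\<dots> = G k * exp (2 * h * real m * real k)" by (simp add: G_def)
    also have "\<dots> \<le> e * exp (2 * h * real m * real k)" using k by (intro mult_right_mono) auto
    also have "exp (2 * h * real m * real k) \<le> circ y ^ m"
    proof -
      have "exp (2 * h * real m * real k) = exp (2 * h * real k) ^ m" by (simp add: exp_of_nat_mult[symmetric] algebra_simps)
      also have "\<dots> \<le> circ y ^ m"
      proof (intro power_mono)
        have "real k \<le> y + 2 / p" using y(1) p by (smt (verit) divide_nonneg_nonneg)
        then show "exp (2 * h * real k) \<le> circ y" unfolding circ_eq using h by simp
      qed simp
      finally show ?thesis .
    qed
    finally show "norm (H z) \<le> e * circ y ^ m" using e by (simp add: mult_left_mono)
  qed (rule circ_pos)
qed

end

section \<open>Sufficiency\<close>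

lemma tendsto_zero_of_suminf_powr:
  fixes v :: "nat \<Rightarrow> complex" and p :: real
  assumes p: "p \<ge> 1" and fin: "(\<Sum>i. ennreal (norm (v i) powr p)) < \<infinity>"
  shows "v \<longlonglongrightarrow> 0"
proof -
  have "summable (\<lambda>i. norm (v i) powr p)" by (rule summable_suminf_not_top) (use fin in auto)
  then have "(\<lambda>i. norm (v i) powr p) \<longlonglongrightarrow> 0" by (rule summable_LIMSEQ_zero)
  then have "(\<lambda>i. (norm (v i) powr p) powr (1/p)) \<longlonglongrightarrow> 0 powr (1/p)"
    using p by (intro tendsto_powr2) auto
  then show ?thesis using p by (simp add: powr_powr tendsto_norm_zero_iff)
qed

text \<open>Schur's test for points x i of the line against the integers. The column bound is an
  assumption that the points do not cluster; the row sums are geometric.\<close>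

lemma schur_exp:
  fixes x c \<beta> :: "nat \<Rightarrow> real" and A M p :: real
  assumes sp: "\<And>y. (\<Sum>i. ennreal (exp (- \<bar>x i - y\<bar>))) \<le> ennreal A" and A: "A \<ge> 0" and M: "M > 0" and p: "p \<ge> 1"
    and \<beta>: "\<And>k. \<beta> k \<ge> 0" and c: "\<And>i. c i \<ge> 0"
    and cK: "\<And>i. ennreal (c i) \<le> (\<Sum>k. ennreal (M * exp (- \<bar>x i - real k\<bar>) * \<beta> k))"
  shows "(\<Sum>i. ennreal (c i powr p)) \<le> ennreal ((M * (A + 2 * exp 1 / (1 - exp (- 1)))) powr p) * (\<Sum>k. ennreal (\<beta> k powr p))"
proof (rule schur_test[where K = "\<lambda>i k. M * exp (- \<bar>x i - real k\<bar>)"])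
  define S where "S = 2 * exp 1 / (1 - exp (- 1 :: real))"
  have S: "S > 0" by (simp add: S_def)
  show "M * (A + 2 * exp 1 / (1 - exp (- 1))) > 0" unfolding S_def[symmetric] using M A S by simp
  have cm: "(\<Sum>k. ennreal (M * g k)) = ennreal M * (\<Sum>k. ennreal (g k))" if "\<And>k. g k \<ge> 0" for g :: "nat \<Rightarrow> real"
    using M that by (subst ennreal_suminf_cmult[symmetric]) (simp add: ennreal_mult)
  fix i k
  have "(\<Sum>k. ennreal (M * exp (- \<bar>x i - real k\<bar>))) = ennreal M * (\<Sum>k. ennreal (exp (- (1 * \<bar>x i - real k\<bar>))))" by (simp add: cm)
  also have "\<dots> \<le> ennreal M * ennreal S" unfolding S_def by (intro mult_left_mono suminf_exp_dist_real) auto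
  also have "\<dots> = ennreal (M * S)" using M S by (simp add: ennreal_mult)
  also have "\<dots> \<le> ennreal (M * (A + S))" using M A by (intro ennreal_leI mult_left_mono) auto
  finally show "(\<Sum>k. ennreal (M * exp (- \<bar>x i - real k\<bar>))) \<le> ennreal (M * (A + 2 * exp 1 / (1 - exp (- 1))))" by (simp add: S_def)
  have "(\<Sum>i. ennreal (M * exp (- \<bar>x i - real k\<bar>))) = ennreal M * (\<Sum>i. ennreal (exp (- \<bar>x i - real k\<bar>)))" by (simp add: cm)
  also have "\<dots> \<le> ennreal M * ennreal A" by (intro mult_left_mono sp) auto
  also have "\<dots> = ennreal (M * A)" using M A by (simp add: ennreal_mult)
  also have "\<dots> \<le> ennreal (M * (A + S))" using M S by (intro ennreal_leI mult_left_mono) auto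
  finally show "(\<Sum>i. ennreal (M * exp (- \<bar>x i - real k\<bar>))) \<le> ennreal (M * (A + 2 * exp 1 / (1 - exp (- 1))))" by (simp add: S_def)
qed (use assms in auto)

context small_fock
begin

text \<open>\<open>sampling_basis\<close> says that evaluation at the nodes is an isomorphism from the \<open>\<ell>\<^sup>p\<close> model of the Fock space onto \<open>\<ell>\<^sup>p\<close>.\<close>

definition tn :: "(nat \<Rightarrow> complex) \<Rightarrow> (complex \<Rightarrow> complex) \<Rightarrow> ennreal" where
  "tn \<sigma> f = (\<Sum>i. ennreal ((om (\<sigma> i) * norm (f (\<sigma> i))) powr p))"

definition sampling_basis :: "(nat \<Rightarrow> complex) \<Rightarrow> bool" where
  "sampling_basis \<sigma> \<longleftrightarrow>
     (\<exists>C>0. \<forall>f. f holomorphic_on UNIV \<longrightarrow> nrm f < \<infinity> \<longrightarrow> nrm f \<le> ennreal C * tn \<sigma> f \<and> tn \<sigma> f \<le> ennreal C * nrm f) \<and>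
     (\<forall>v. (\<Sum>i. ennreal (norm (v i) powr p)) < \<infinity> \<longrightarrow>
        (\<exists>f. f holomorphic_on UNIV \<and> nrm f < \<infinity> \<and> (\<forall>i. of_real (om (\<sigma> i)) * f (\<sigma> i) = v i)))"

text \<open>This half of the sampling inequality comes from sparsity of the positions alone.\<close>

lemma tn_le:
  assumes nz: "\<And>i. \<sigma> i \<noteq> 0" and A: "A \<ge> 0" and sp: "\<And>y. (\<Sum>i. ennreal (exp (- \<bar>pos (\<sigma> i) - y\<bar>))) \<le> ennreal A"
    and f: "f holomorphic_on UNIV"
  shows "tn \<sigma> f \<le> ennreal ((exp (1 / (4 * h)) * (A + 2 * exp 1 / (1 - exp (- 1)))) powr p) * nrm f"
  unfolding tn_def nrm_def
proof (rule schur_exp[OF sp A _ p])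
  fix i
  show "0 \<le> om (\<sigma> i) * norm (f (\<sigma> i))" using om_pos[of "\<sigma> i"] by simp
  have "ennreal (om (\<sigma> i) * norm (f (\<sigma> i))) \<le> (\<Sum>k. ennreal (exp (- (h * (pos (\<sigma> i) - real k)\<^sup>2)) * norm (bc f k)))"
    by (rule eval_le[OF f nz])
  also have "\<dots> \<le> (\<Sum>k. ennreal (exp (1 / (4 * h)) * exp (- \<bar>pos (\<sigma> i) - real k\<bar>) * norm (bc f k)))"
  proof (intro suminf_mono_ennreal ennreal_leI mult_right_mono)
    fix k show "exp (- (h * (pos (\<sigma> i) - real k)\<^sup>2)) \<le> exp (1 / (4 * h)) * exp (- \<bar>pos (\<sigma> i) - real k\<bar>)"
      using gaussian_le_exp[OF h, of "pos (\<sigma> i) - real k" 1] by simp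
  qed simp
  finally show "ennreal (om (\<sigma> i) * norm (f (\<sigma> i))) \<le> (\<Sum>k. ennreal (exp (1 / (4 * h)) * exp (- \<bar>pos (\<sigma> i) - real k\<bar>) * norm (bc f k)))" .
qed auto

lemma holo_sum_bc:
  fixes f :: "nat \<Rightarrow> complex \<Rightarrow> complex" and a :: "nat \<Rightarrow> complex" and n :: nat
  assumes "\<And>j. j < n \<Longrightarrow> f j holomorphic_on UNIV"
  shows "(\<lambda>z. \<Sum>j<n. a j * f j z) holomorphic_on UNIV \<and> bc (\<lambda>z. \<Sum>j<n. a j * f j z) k = (\<Sum>j<n. a j * bc (f j) k)"
  using assms
proof (induction n)
  case 0
  have "(\<lambda>k. (\<lambda>_. 0) k * z ^ k) sums (\<lambda>_. 0) z" for z :: complex by simp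
  from entire_of_sums(2)[OF this] show ?case by (simp add: bc_def)
next
  case (Suc n)
  then have IH: "(\<lambda>z. \<Sum>j<n. a j * f j z) holomorphic_on UNIV" "bc (\<lambda>z. \<Sum>j<n. a j * f j z) k = (\<Sum>j<n. a j * bc (f j) k)" by auto
  have fn: "f n holomorphic_on UNIV" using Suc by auto
  have "bc (\<lambda>z. 1 * (\<Sum>j<n. a j * f j z) + a n * f n z) k = 1 * bc (\<lambda>z. \<Sum>j<n. a j * f j z) k + a n * bc (f n) k"
    by (rule bc_linear[OF IH(1) fn])
  then show ?case using IH fn by (auto intro!: holomorphic_intros)
qed

end

section \<open>Lagrange functions of the canonical product\<close>

context near_regular
begin

lemma sparse: "(\<Sum>i. ennreal (exp (- \<bar>pos (\<sigma> i) - y\<bar>))) \<le> ennreal (exp B * (2 * exp 1 / (1 - exp (- 1))))"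
proof -
  have "ennreal (exp (- \<bar>pos (\<sigma> i) - y\<bar>)) \<le> ennreal (exp B) * ennreal (exp (- (1 * \<bar>y - real i\<bar>)))" for i
  proof -
    have "- \<bar>pos (\<sigma> i) - y\<bar> \<le> B + - (1 * \<bar>y - real i\<bar>)" using B[of i] by (auto simp: abs_if split: if_splits)
    then show ?thesis by (simp add: ennreal_mult[symmetric] exp_add[symmetric])
  qed
  then have "(\<Sum>i. ennreal (exp (- \<bar>pos (\<sigma> i) - y\<bar>))) \<le> (\<Sum>i. ennreal (exp B) * ennreal (exp (- (1 * \<bar>y - real i\<bar>))))"
    by (rule suminf_mono_ennreal)
  also have "\<dots> = ennreal (exp B) * (\<Sum>i. ennreal (exp (- (1 * \<bar>y - real i\<bar>))))" by (rule ennreal_suminf_cmult)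
  also have "\<dots> \<le> ennreal (exp B) * ennreal (2 * exp 1 / (1 - exp (- 1)))"
    by (intro mult_left_mono suminf_exp_dist_real) auto
  also have "\<dots> = ennreal (exp B * (2 * exp 1 / (1 - exp (- 1))))" by (simp add: ennreal_mult[symmetric])
  finally show ?thesis .
qed

text \<open>Here separation is used: divided by norm (\<sigma> i), it keeps each remaining factor
  away from 0.\<close>

lemma Q_at_node:
  "\<Psi> j j \<le> exp (qC + (2 + 2 * ln (2 / min c 1)) * qS) * (om (\<sigma> j) * norm (Q {j} (\<sigma> j)))"
proof (rule Q_lower)
  show "\<bar>pos (\<sigma> j) - real j\<bar> \<le> B + 1" using B[of j] by simp
  show "0 < min c 1" "min c 1 \<le> 1" using c by auto
  fix i assume "i \<noteq> j"
  then have "c * norm (\<sigma> i) \<le> norm (\<sigma> i - \<sigma> j)" by (rule sep)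
  moreover have "1 - \<sigma> j / \<sigma> i = (\<sigma> i - \<sigma> j) / \<sigma> i" using \<sigma>_nz[of i] by (simp add: field_simps)
  ultimately have "c \<le> norm (1 - \<sigma> j / \<sigma> i)" using \<sigma>_nz[of i] by (simp add: norm_divide pos_le_divide_eq)
  then show "min c 1 \<le> norm (1 - \<sigma> j / \<sigma> i)" by simp
qed (rule \<sigma>_nz)

definition lag :: "nat \<Rightarrow> complex \<Rightarrow> complex" where
  "lag j z = 1 / (of_real (om (\<sigma> j)) * Q {j} (\<sigma> j)) * Q {j} z"

lemma Q_node_nz: "Q {j} (\<sigma> j) \<noteq> 0"
  unfolding Q_zero_iff using inj_\<sigma> by blast

lemma lag_holo: "lag j holomorphic_on UNIV"
  unfolding lag_def by (intro holomorphic_intros Q_holo)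

lemma lag_node: "of_real (om (\<sigma> i)) * lag j (\<sigma> i) = (if i = j then 1 else 0)"
proof (cases "i = j")
  case True
  then show ?thesis using Q_node_nz[of j] om_pos[of "\<sigma> j"] by (simp add: lag_def)
next
  case False
  then have "Q {j} (\<sigma> i) = 0" unfolding Q_zero_iff by blast
  then show ?thesis using False by (simp add: lag_def)
qed

end

text \<open>C lets short windows violate the bound; only the slope over long windows has to stay
  below 1/2.\<close>

locale balanced = near_regular +
  fixes \<eta> C :: real
  assumes \<eta>: "\<eta> > 0" and cum: "\<And>m n. m \<le> n \<Longrightarrow> \<bar>E n - E m\<bar> \<le> (1/2 - \<eta>) * (real n - real m) + C"
begin

definition lagC :: real where
  "lagC = exp (qC + qS) * exp (qC + (2 + 2 * ln (2 / min c 1)) * qS) * exp (2 * h * C)"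

lemma lagC_pos: "lagC > 0" by (simp add: lagC_def)

text \<open>Cauchy's estimate on the circle of position k bounds the coefficient by a multiple of
  \<open>\<Psi> j k / \<Psi> j j\<close>. The terms linear in k - j combine to -h |k - j|, and after
  subtracting the increments of \<open>E\<close> the rate 2 h \<eta> is left.\<close>

lemma bc_lag: "norm (bc (lag j) k) \<le> lagC * exp (- (2 * h * \<eta> * \<bar>real k - real j\<bar>))"
proof -
  define L where "L = exp (qC + (2 + 2 * ln (2 / min c 1)) * qS)"
  have "norm (bc (lag j) k) * exp (- (h * (real k - real k)\<^sup>2)) \<le> lagC * exp (- (2 * h * \<eta> * \<bar>real k - real j\<bar>))"
  proof (rule coef_le[OF lag_holo])
    fix z :: complex assume z: "norm z = circ (real k)"
    have znz: "z \<noteq> 0" using z circ_pos[of "real k"] by auto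
    have pz: "pos z = real k" by (rule pos_circ[OF z])
    have nd: "0 < om (\<sigma> j) * norm (Q {j} (\<sigma> j))" using om_pos[of "\<sigma> j"] Q_node_nz[of j] by simp
    have u: "om z * norm (Q {j} z) \<le> exp (qC + qS) * \<Psi> j k" using B_nonneg pz by (intro Q_upper znz) auto
    have "1 / (om (\<sigma> j) * norm (Q {j} (\<sigma> j))) \<le> L / \<Psi> j j"
      using Q_at_node[of j] nd \<Psi>_pos[of j j] unfolding L_def[symmetric] by (simp add: field_simps)
    note iq = this
    have "om z * norm (Q {j} z) * (1 / (om (\<sigma> j) * norm (Q {j} (\<sigma> j)))) \<le> (exp (qC + qS) * \<Psi> j k) * (L / \<Psi> j j)"
      by (rule mult_mono[OF u iq]) (use nd \<Psi>_pos[of j k] in auto)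
    also have "\<dots> = exp (qC + qS) * L * (\<Psi> j k / \<Psi> j j)" by simp
    also have "\<Psi> j k / \<Psi> j j \<le> exp (2 * h * C - 2 * h * \<eta> * \<bar>real k - real j\<bar>)"
    proof -
      have e: "\<Psi> j k / \<Psi> j j = exp (h * (real k - real j) - 2 * h * (E k - E j) - (if j < k then 2 * h * (real k - real j) else 0))"
        by (simp add: \<Psi>_def exp_diff[symmetric] algebra_simps)
      have "\<bar>E k - E j\<bar> \<le> (1/2 - \<eta>) * \<bar>real k - real j\<bar> + C"
        using cum[of j k] cum[of k j] by (cases "j \<le> k") (auto simp: abs_minus_commute)
      then have "2 * h * \<bar>E k - E j\<bar> \<le> 2 * h * ((1/2 - \<eta>) * \<bar>real k - real j\<bar> + C)" using h by (intro mult_left_mono) auto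
      moreover have "2 * h * (- (E k - E j)) \<le> 2 * h * \<bar>E k - E j\<bar>" using h by (intro mult_left_mono) auto
      then have "- (2 * h * (E k - E j)) \<le> 2 * h * \<bar>E k - E j\<bar>" by (simp only: mult_minus_right)
      moreover have "2 * h * ((1/2 - \<eta>) * \<bar>real k - real j\<bar> + C) = h * \<bar>real k - real j\<bar> - 2 * h * \<eta> * \<bar>real k - real j\<bar> + 2 * h * C"
        by (simp add: algebra_simps)
      moreover have "h * (real k - real j) - (if j < k then 2 * h * (real k - real j) else 0) = - (h * \<bar>real k - real j\<bar>)"
        by (auto simp: algebra_simps)
      ultimately have "h * (real k - real j) - 2 * h * (E k - E j) - (if j < k then 2 * h * (real k - real j) else 0) \<le> 2 * h * C - 2 * h * \<eta> * \<bar>real k - real j\<bar>"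
        by linarith
      then show ?thesis unfolding e by simp
    qed
    finally have "om z * norm (Q {j} z) * (1 / (om (\<sigma> j) * norm (Q {j} (\<sigma> j)))) \<le> exp (qC + qS) * L * exp (2 * h * C - 2 * h * \<eta> * \<bar>real k - real j\<bar>)"
      by (simp add: L_def mult_left_mono)
    note that_le = this
    show "om z * norm (lag j z) \<le> lagC * exp (- (2 * h * \<eta> * \<bar>real k - real j\<bar>))"
    proof -
      have "om z * norm (lag j z) = om z * norm (Q {j} z) * (1 / (om (\<sigma> j) * norm (Q {j} (\<sigma> j))))"
        using om_pos[of "\<sigma> j"] by (simp add: lag_def norm_mult norm_divide)
      moreover have "lagC * exp (- (2 * h * \<eta> * \<bar>real k - real j\<bar>)) = exp (qC + qS) * L * exp (2 * h * C - 2 * h * \<eta> * \<bar>real k - real j\<bar>)"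
        by (simp add: lagC_def L_def mult.assoc flip: exp_add)
      ultimately show ?thesis using that_le by simp
    qed
  qed
  then show ?thesis by simp
qed

text \<open>Node 0 is kept in reserve. After division by the product over the other nodes the growth
  bound leaves only a constant quotient, and the zero at node 0 forces this constant to
  vanish.\<close>

lemma vanishing_imp_zero:
  assumes f: "f holomorphic_on UNIV" and fin: "nrm f < \<infinity>" and z: "\<And>i. f (\<sigma> i) = 0"
  shows "f w = 0"
proof -
  obtain D where D: "\<And>k. norm (bc f k) \<le> D" using bc_bounded[OF fin] by blast
  obtain H where H: "H holomorphic_on UNIV" "\<And>z. f z = Q {0} z * H z" using Q_divides[OF f, of "{0}"] z by blast
  have c0: "coef H m = 0" if m: "m \<ge> 1" for m
  proof (rule quotient_coef_zero[OF H])
    show "om z * norm (f z) \<le> D * gsum" if "z \<noteq> 0" for z by (rule eval_bounded[OF f that D])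
    show "E k \<le> (real m - 1/2 - \<eta>) * real k + C" for k
    proof -
      have "E k \<le> (1/2 - \<eta>) * real k + C" using cum[of 0 k] by (simp add: E_def)
      also have "\<dots> \<le> (real m - 1/2 - \<eta>) * real k + C" using m by (intro add_right_mono mult_right_mono) auto
      finally show ?thesis .
    qed
  qed (rule \<eta>)
  have Hc: "H z = coef H 0" for z
  proof -
    have "(\<lambda>k. coef H k * z ^ k) sums (\<Sum>k\<in>{0}. coef H k * z ^ k)" by (rule sums_finite) (use c0 in auto)
    then show ?thesis using coef_sums[OF H(1), of z] sums_unique2 by fastforce
  qed
  have "H (\<sigma> 0) = 0" using H(2)[of "\<sigma> 0"] z[of 0] Q_node_nz[of 0] by simp
  then have "H w = 0" using Hc by metis
  then show ?thesis by (simp add: H(2))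
qed

definition lagS :: real where "lagS = lagC * (2 / (1 - exp (- (2 * h * \<eta>))))"

lemma lagS_pos: "lagS > 0" using lagC_pos h \<eta> by (simp add: lagS_def)

lemma lag_kernel_sum: "(\<Sum>j. ennreal (lagC * exp (- (2 * h * \<eta> * \<bar>real k - real j\<bar>)))) \<le> ennreal lagS"
proof -
  have "(\<Sum>j. ennreal (lagC * exp (- (2 * h * \<eta> * \<bar>real k - real j\<bar>)))) = ennreal lagC * (\<Sum>j. ennreal (exp (- (2 * h * \<eta> * \<bar>real k - real j\<bar>))))"
    using lagC_pos by (subst ennreal_suminf_cmult[symmetric]) (simp add: ennreal_mult)
  also have "\<dots> \<le> ennreal lagC * ennreal (2 / (1 - exp (- (2 * h * \<eta>))))"
    using h \<eta> by (intro mult_left_mono suminf_exp_dist_nat) auto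
  also have "\<dots> = ennreal lagS" using lagC_pos h \<eta> by (simp add: lagS_def ennreal_mult[symmetric])
  finally show ?thesis .
qed

text \<open>A bounded v is enough. The last bound, uniform in k, controls the tail when
  interpolation is verified by truncation.\<close>

lemma lag_series:
  assumes V: "\<And>j. norm (v j) \<le> V"
  shows "summable (\<lambda>j. v j * bc (lag j) k)"
    and "ennreal (norm (\<Sum>j. v j * bc (lag j) k)) \<le> (\<Sum>j. ennreal (lagC * exp (- (2 * h * \<eta> * \<bar>real k - real j\<bar>)) * norm (v j)))"
    and "norm (\<Sum>j. v j * bc (lag j) k) \<le> V * lagS"
proof -
  have V0: "V \<ge> 0" using V[of 0] norm_ge_zero order_trans by blast
  have le: "norm (v j * bc (lag j) k) \<le> lagC * exp (- (2 * h * \<eta> * \<bar>real k - real j\<bar>)) * norm (v j)" for j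
    using mult_left_mono[OF bc_lag[of j k], of "norm (v j)"] by (simp add: norm_mult mult_ac)
  have bd: "(\<Sum>j. ennreal (lagC * exp (- (2 * h * \<eta> * \<bar>real k - real j\<bar>)) * norm (v j))) \<le> ennreal (V * lagS)"
  proof -
    have "(\<Sum>j. ennreal (lagC * exp (- (2 * h * \<eta> * \<bar>real k - real j\<bar>)) * norm (v j))) \<le> (\<Sum>j. ennreal V * ennreal (lagC * exp (- (2 * h * \<eta> * \<bar>real k - real j\<bar>))))"
    proof (rule suminf_mono_ennreal)
      fix j
      have "lagC * exp (- (2 * h * \<eta> * \<bar>real k - real j\<bar>)) * norm (v j) \<le> V * (lagC * exp (- (2 * h * \<eta> * \<bar>real k - real j\<bar>)))"
        using mult_left_mono[OF V[of j], of "lagC * exp (- (2 * h * \<eta> * \<bar>real k - real j\<bar>))"] lagC_pos by (simp add: mult_ac)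
      then show "ennreal (lagC * exp (- (2 * h * \<eta> * \<bar>real k - real j\<bar>)) * norm (v j)) \<le> ennreal V * ennreal (lagC * exp (- (2 * h * \<eta> * \<bar>real k - real j\<bar>)))"
        using V0 lagC_pos by (subst ennreal_mult[symmetric]) (auto intro: ennreal_leI)
    qed
    also have "\<dots> = ennreal V * (\<Sum>j. ennreal (lagC * exp (- (2 * h * \<eta> * \<bar>real k - real j\<bar>))))" by (rule ennreal_suminf_cmult)
    also have "\<dots> \<le> ennreal V * ennreal lagS" by (intro mult_left_mono lag_kernel_sum) auto
    also have "\<dots> = ennreal (V * lagS)" using V0 lagS_pos by (simp add: ennreal_mult)
    finally show ?thesis .
  qed
  have "(\<Sum>j. ennreal (norm (v j * bc (lag j) k))) \<le> (\<Sum>j. ennreal (lagC * exp (- (2 * h * \<eta> * \<bar>real k - real j\<bar>)) * norm (v j)))"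
    by (intro suminf_mono_ennreal ennreal_leI le)
  note le2 = this
  have "summable (\<lambda>j. norm (v j * bc (lag j) k))"
    by (rule summable_suminf_not_top) (use order_trans[OF le2 bd] in \<open>auto simp: top_unique\<close>)
  then show s: "summable (\<lambda>j. v j * bc (lag j) k)" by (rule summable_norm_cancel)
  have "ennreal (norm (\<Sum>j. v j * bc (lag j) k)) \<le> (\<Sum>j. ennreal (norm (v j * bc (lag j) k)))"
    by (rule norm_suminf_le_ennreal[OF summable_sums[OF s]])
  then show 2: "ennreal (norm (\<Sum>j. v j * bc (lag j) k)) \<le> (\<Sum>j. ennreal (lagC * exp (- (2 * h * \<eta> * \<bar>real k - real j\<bar>)) * norm (v j)))"
    using le2 by (rule order_trans)
  have "ennreal (norm (\<Sum>j. v j * bc (lag j) k)) \<le> ennreal (V * lagS)" using 2 bd by (rule order_trans)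
  then show "norm (\<Sum>j. v j * bc (lag j) k) \<le> V * lagS" using V0 lagS_pos by (simp add: ennreal_le_iff)
qed

text \<open>The function is built from its coefficients, so its norm follows from Schur's test. Its
  values at the nodes require an exchange of limits, which is done by comparison with finite sums: v
  tends to 0, hence the coefficients differ uniformly little and \<open>eval_bounded\<close>
  applies.\<close>

lemma interpolation:
  assumes fin: "(\<Sum>i. ennreal (norm (v i) powr p)) < \<infinity>"
  obtains f where "f holomorphic_on UNIV" "nrm f \<le> ennreal (lagS powr p) * (\<Sum>i. ennreal (norm (v i) powr p))"
    "\<And>i. of_real (om (\<sigma> i)) * f (\<sigma> i) = v i"
proof -
  have lim: "v \<longlonglongrightarrow> 0" by (rule tendsto_zero_of_suminf_powr[OF p fin])
  then have "Bseq v" by (rule convergent_imp_Bseq[OF convergentI])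
  then obtain V where V: "\<And>j. norm (v j) \<le> V" by (auto simp: Bseq_def)
  define \<beta> where "\<beta> k = (\<Sum>j. v j * bc (lag j) k)" for k
  obtain f where f: "f holomorphic_on UNIV" "bc f = \<beta>"
    using synth[of \<beta> "V * lagS"] lag_series(3)[of v V, OF V] unfolding \<beta>_def by blast
  show thesis
  proof
    show "f holomorphic_on UNIV" by fact
    show "nrm f \<le> ennreal (lagS powr p) * (\<Sum>i. ennreal (norm (v i) powr p))"
      unfolding nrm_def f(2)
    proof (rule schur_test[where K = "\<lambda>k j. lagC * exp (- (2 * h * \<eta> * \<bar>real k - real j\<bar>))"])
      show "(\<Sum>k. ennreal (lagC * exp (- (2 * h * \<eta> * \<bar>real k - real j\<bar>)))) \<le> ennreal lagS" for j
        using lag_kernel_sum[of j] by (simp add: abs_minus_commute)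
      show "ennreal (norm (\<beta> k)) \<le> (\<Sum>j. ennreal (lagC * exp (- (2 * h * \<eta> * \<bar>real k - real j\<bar>)) * norm (v j)))" for k
        unfolding \<beta>_def by (rule lag_series(2)[OF V])
    qed (use p lagS_pos lagC_pos lag_kernel_sum in auto)
    fix i
    have "norm (of_real (om (\<sigma> i)) * f (\<sigma> i) - v i) \<le> e * (lagS * gsum)" if e: "e > 0" for e
    proof -
      obtain N where N: "\<And>j. j \<ge> N \<Longrightarrow> norm (v j) < e" using LIMSEQ_D[OF lim e] by auto
      \<comment> \<open>With n > i the finite sum already takes the value v i at node i.\<close>
      define n where "n = max N (Suc i)"
      define g where "g z = (\<Sum>j<n. v j * lag j z)" for z
      define d where "d z = 1 * f z + (- 1) * g z" for z
      have g: "g holomorphic_on UNIV" "\<And>k. bc g k = (\<Sum>j<n. v j * bc (lag j) k)"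
        using holo_sum_bc[of n lag v] lag_holo unfolding g_def by blast+
      have d: "d holomorphic_on UNIV" unfolding d_def by (intro holomorphic_intros f(1) g(1))
      have bd: "norm (bc d k) \<le> e * lagS" for k
      proof -
        define v' where "v' j = (if j < n then 0 else v j)" for j
        have v': "norm (v' j) \<le> e" for j using N[of j] e by (auto simp: v'_def n_def intro: less_imp_le)
        have "bc d k = \<beta> k - (\<Sum>j<n. v j * bc (lag j) k)"
          unfolding d_def by (subst bc_linear[OF f(1) g(1)]) (simp add: g(2) f(2))
        also have "\<dots> = (\<Sum>j. v' j * bc (lag j) k)"
        proof -
          have "(\<lambda>j. v j * bc (lag j) k) sums \<beta> k" unfolding \<beta>_def by (rule summable_sums[OF lag_series(1)[OF V]])
          moreover have "(\<lambda>j. if j \<in> {..<n} then v j * bc (lag j) k else 0) sums (\<Sum>j<n. v j * bc (lag j) k)"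
            by (rule sums_If_finite_set) simp
          ultimately have "(\<lambda>j. v j * bc (lag j) k - (if j \<in> {..<n} then v j * bc (lag j) k else 0)) sums (\<beta> k - (\<Sum>j<n. v j * bc (lag j) k))"
            by (rule sums_diff)
          also have "(\<lambda>j. v j * bc (lag j) k - (if j \<in> {..<n} then v j * bc (lag j) k else 0)) = (\<lambda>j. v' j * bc (lag j) k)"
            by (auto simp: v'_def)
          finally show ?thesis by (simp add: sums_iff)
        qed
        also have "norm \<dots> \<le> e * lagS" by (rule lag_series(3)[OF v'])
        finally show ?thesis .
      qed
      have "of_real (om (\<sigma> i)) * g (\<sigma> i) = (\<Sum>j<n. v j * (of_real (om (\<sigma> i)) * lag j (\<sigma> i)))"
        by (simp add: g_def sum_distrib_left mult_ac)
      also have "\<dots> = (\<Sum>j<n. if i = j then v j else 0)" by (intro sum.cong) (auto simp: lag_node)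
      also have "\<dots> = v i" by (simp add: n_def)
      finally have gi: "of_real (om (\<sigma> i)) * g (\<sigma> i) = v i" .
      have "om (\<sigma> i) * norm (d (\<sigma> i)) \<le> e * lagS * gsum" by (rule eval_bounded[OF d \<sigma>_nz bd])
      moreover have "norm (of_real (om (\<sigma> i)) * f (\<sigma> i) - v i) = om (\<sigma> i) * norm (d (\<sigma> i))"
        unfolding gi[symmetric] d_def using om_pos[of "\<sigma> i"] by (simp add: norm_mult flip: right_diff_distrib)
      ultimately show ?thesis by (simp add: mult_ac)
    qed
    note small = this
    have "norm (of_real (om (\<sigma> i)) * f (\<sigma> i) - v i) \<le> 0 + e" if e: "e > 0" for e
      using small[of "e / (lagS * gsum)"] e lagS_pos gsum(1) by simp
    then have "norm (of_real (om (\<sigma> i)) * f (\<sigma> i) - v i) \<le> 0" by (rule field_le_epsilon)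
    then show "of_real (om (\<sigma> i)) * f (\<sigma> i) = v i" by simp
  qed
qed

theorem sampling_basis: "sampling_basis \<sigma>"
proof -
  define A where "A = exp B * (2 * exp 1 / (1 - exp (- 1)))"
  define C1 where "C1 = (exp (1 / (4 * h)) * (A + 2 * exp 1 / (1 - exp (- 1)))) powr p"
  define C2 where "C2 = lagS powr p"
  have up: "tn \<sigma> f \<le> ennreal C1 * nrm f" if "f holomorphic_on UNIV" for f
    unfolding C1_def by (rule tn_le[OF \<sigma>_nz _ _ that]) (use sparse in \<open>auto simp: A_def\<close>)
  \<comment> \<open>The samples of f are interpolated with control of the norm; by uniqueness the
    interpolant is f itself.\<close>
  have lo: "nrm f \<le> ennreal C2 * tn \<sigma> f" if f: "f holomorphic_on UNIV" "nrm f < \<infinity>" for f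
  proof -
    define v where "v i = of_real (om (\<sigma> i)) * f (\<sigma> i)" for i
    have tv: "tn \<sigma> f = (\<Sum>i. ennreal (norm (v i) powr p))"
      using om_pos by (simp add: tn_def v_def norm_mult less_imp_le)
    have "tn \<sigma> f < \<infinity>" using up[OF f(1)] f(2)
      by (metis ennreal_mult_less_top ennreal_less_top infinity_ennreal_def le_less_trans)
    then obtain g where g: "g holomorphic_on UNIV" "nrm g \<le> ennreal (lagS powr p) * tn \<sigma> f" "\<And>i. of_real (om (\<sigma> i)) * g (\<sigma> i) = v i"
      using interpolation[of v] unfolding tv by blast
    have gf: "nrm g < \<infinity>" using g(2) \<open>tn \<sigma> f < \<infinity>\<close>
      by (metis ennreal_mult_less_top ennreal_less_top infinity_ennreal_def le_less_trans)
    have "1 * f w + (- 1) * g w = 0" for w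
    proof (rule vanishing_imp_zero[where f = "\<lambda>w. 1 * f w + (- 1) * g w"])
      show "(\<lambda>w. 1 * f w + (- 1) * g w) holomorphic_on UNIV" by (intro holomorphic_intros f g)
      show "nrm (\<lambda>w. 1 * f w + (- 1) * g w) < \<infinity>"
        by (rule le_less_trans[OF nrm_linear[OF f(1) g(1)]]) (use f gf in \<open>auto simp: ennreal_mult_less_top\<close>)
      show "1 * f (\<sigma> i) + (- 1) * g (\<sigma> i) = 0" for i
        using g(3)[of i] om_pos[of "\<sigma> i"] by (simp add: v_def)
    qed
    then have "f = g" by auto
    then show ?thesis using g(2) by (simp add: C2_def)
  qed
  show ?thesis unfolding sampling_basis_def
  proof (intro conjI allI impI exI[of _ "max C1 C2 + 1"])
    have "0 \<le> C1" by (simp add: C1_def)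
    then show "max C1 C2 + 1 > 0" by (simp add: max.coboundedI1 add_nonneg_pos)
    fix f assume f: "f holomorphic_on UNIV" "nrm f < \<infinity>"
    show "nrm f \<le> ennreal (max C1 C2 + 1) * tn \<sigma> f"
      by (rule order_trans[OF lo[OF f]]) (auto intro!: mult_right_mono ennreal_leI)
    show "tn \<sigma> f \<le> ennreal (max C1 C2 + 1) * nrm f"
      by (rule order_trans[OF up[OF f(1)]]) (auto intro!: mult_right_mono ennreal_leI)
  next
    fix v :: "nat \<Rightarrow> complex" assume v: "(\<Sum>i. ennreal (norm (v i) powr p)) < \<infinity>"
    obtain f where f: "f holomorphic_on UNIV" "nrm f \<le> ennreal (lagS powr p) * (\<Sum>i. ennreal (norm (v i) powr p))"
      "\<And>i. of_real (om (\<sigma> i)) * f (\<sigma> i) = v i" using interpolation[OF v] by blast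
    have "nrm f < \<infinity>" using f(2) v
      by (metis ennreal_mult_less_top ennreal_less_top infinity_ennreal_def le_less_trans)
    then show "\<exists>f. f holomorphic_on UNIV \<and> nrm f < \<infinity> \<and> (\<forall>i. of_real (om (\<sigma> i)) * f (\<sigma> i) = v i)" using f by blast
  qed
qed

end

section \<open>Necessity\<close>

context small_fock
begin

lemma coef_shift:
  assumes u: "u holomorphic_on UNIV"
  shows "coef (\<lambda>z. z ^ n * u z) k = (if k < n then 0 else coef u (k - n))"
proof -
  define c where "c k = (if k < n then 0 else coef u (k - n))" for k
  have "(\<lambda>k. c k * z ^ k) sums (z ^ n * u z)" for z
  proof -
    have "(\<lambda>k. z ^ n * (coef u k * z ^ k)) sums (z ^ n * u z)" by (intro sums_mult coef_sums u)
    then have "(\<lambda>k. c (k + n) * z ^ (k + n)) sums (z ^ n * u z)" by (simp add: c_def power_add mult_ac)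
    then have "(\<lambda>k. c k * z ^ k) sums (z ^ n * u z + (\<Sum>k<n. c k * z ^ k))" by (subst (asm) sums_iff_shift)
    then show ?thesis by (simp add: c_def)
  qed
  then show ?thesis using entire_of_sums(2)[of c "\<lambda>z. z ^ n * u z"] by (simp add: c_def)
qed

lemma coef_poly: "coef (poly P) k = coeff P k"
proof -
  have "(\<lambda>k. coeff P k * z ^ k) sums poly P z" for z
    unfolding poly_altdef by (rule sums_finite) (auto simp: coeff_eq_0)
  then show ?thesis using entire_of_sums(2)[of "coeff P" "poly P"] by simp
qed

lemma nrm_finite_support:
  assumes "\<And>k. k > K \<Longrightarrow> bc f k = 0"
  shows "nrm f < \<infinity>"
proof -
  have "nrm f = (\<Sum>k\<le>K. ennreal (norm (bc f k) powr p))"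
    unfolding nrm_def by (rule suminf_finite) (use assms in auto)
  then show ?thesis by (simp add: less_top[symmetric])
qed

text \<open>Cauchy's estimate on the circle of position i passes the pointwise domination to the
  coefficients, up to a Gaussian kernel that Schur's test handles. Only finitely many of these
  circles lie inside radius R, and finitely many coefficients do not affect finiteness.\<close>

lemma nrm_dominated:
  assumes f: "f holomorphic_on UNIV" "nrm f < \<infinity>" and g: "g holomorphic_on UNIV"
    and dom: "\<And>z. norm z \<ge> R \<Longrightarrow> norm (g z) \<le> M * norm (f z)" and M: "M > 0"
  shows "nrm g < \<infinity>"
proof -
  obtain k0 :: nat where k0: "\<And>k. k \<ge> k0 \<Longrightarrow> R \<le> circ (real k)"
  proof -
    define k0 where "k0 = nat \<lceil>R / (2 * h)\<rceil>"
    have "R \<le> circ (real k)" if "k \<ge> k0" for k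
    proof -
      have "R / (2 * h) \<le> real k" using that unfolding k0_def by linarith
      then have "R \<le> 2 * h * real k" using h by (simp add: field_simps)
      also have "\<dots> \<le> 2 * h * (real k + 2 / p)" using h p by simp
      also have "\<dots> \<le> circ (real k)" unfolding circ_eq using exp_ge_add_one_self[of "2 * h * (real k + 2 / p)"] by linarith
      finally show ?thesis .
    qed
    then show thesis using that by blast
  qed
  define c where "c k = (if k < k0 then 0 else norm (bc g k))" for k
  have c: "(\<Sum>k. ennreal (c k powr p)) \<le> ennreal ((M * exp (1 / (4 * h)) * (2 * exp 1 / (1 - exp (- 1)) + 2 * exp 1 / (1 - exp (- 1)))) powr p) * nrm f"
    unfolding nrm_def
  proof (rule schur_exp[where x = real])
    show "(\<Sum>i. ennreal (exp (- \<bar>real i - y\<bar>))) \<le> ennreal (2 * exp 1 / (1 - exp (- 1)))" for y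
    proof -
      have "1 * \<bar>y - real i\<bar> = \<bar>real i - y\<bar>" for i by simp
      then show ?thesis using suminf_exp_dist_real[of 1 y] by (simp only: zero_less_one True_implies_equals)
    qed
    fix i
    show "ennreal (c i) \<le> (\<Sum>k. ennreal (M * exp (1 / (4 * h)) * exp (- \<bar>real i - real k\<bar>) * norm (bc f k)))" (is "_ \<le> ?S")
    proof (cases "i < k0 \<or> ?S = \<infinity>")
      case True
      then show ?thesis by (auto simp: c_def)
    next
      case False
      then obtain r where r: "?S = ennreal r" "r \<ge> 0" using ennreal_finite_ex[of ?S] by blast
      have "norm (bc g i) * exp (- (h * (real i - real i)\<^sup>2)) \<le> r"
      proof (rule coef_le[OF g])
        fix z :: complex assume z: "norm z = circ (real i)"
        have znz: "z \<noteq> 0" using z circ_pos[of "real i"] by auto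
        have pz: "pos z = real i" by (rule pos_circ[OF z])
        have "norm (g z) \<le> M * norm (f z)" using k0[of i] False z by (intro dom) auto
        then have "om z * norm (g z) \<le> M * (om z * norm (f z))" using om_pos[of z] by (simp add: mult.left_commute)
        then have "ennreal (om z * norm (g z)) \<le> ennreal M * ennreal (om z * norm (f z))"
          using M om_pos[of z] by (simp add: ennreal_mult[symmetric] ennreal_leI)
        also have "\<dots> \<le> ennreal M * (\<Sum>k. ennreal (exp (- (h * (pos z - real k)\<^sup>2)) * norm (bc f k)))"
          by (intro mult_left_mono eval_le f znz) simp
        also have "\<dots> = (\<Sum>k. ennreal M * ennreal (exp (- (h * (pos z - real k)\<^sup>2)) * norm (bc f k)))" by (rule ennreal_suminf_cmult[symmetric])
        also have "\<dots> \<le> ?S"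
        proof (rule suminf_mono_ennreal)
          fix k
          have "exp (- (h * (real i - real k)\<^sup>2)) \<le> exp (1 / (4 * h)) * exp (- \<bar>real i - real k\<bar>)"
            using gaussian_le_exp[OF h, of "real i - real k" 1] by simp
          then have "M * (exp (- (h * (real i - real k)\<^sup>2)) * norm (bc f k)) \<le> M * (exp (1 / (4 * h)) * exp (- \<bar>real i - real k\<bar>) * norm (bc f k))"
            using M by (intro mult_left_mono mult_right_mono) auto
          then show "ennreal M * ennreal (exp (- (h * (pos z - real k)\<^sup>2)) * norm (bc f k)) \<le> ennreal (M * exp (1 / (4 * h)) * exp (- \<bar>real i - real k\<bar>) * norm (bc f k))"
            using M by (simp add: pz ennreal_mult[symmetric] mult.assoc ennreal_leI)
        qed
        finally show "om z * norm (g z) \<le> r" unfolding r(1) using r(2) by (simp add: ennreal_le_iff)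
      qed
      then show ?thesis unfolding r(1) using False by (simp add: c_def ennreal_leI)
    qed
  qed (use M p in \<open>auto simp: c_def\<close>)
  have "nrm g \<le> (\<Sum>k. ennreal (if k < k0 then norm (bc g k) powr p else 0) + ennreal (c k powr p))"
    unfolding nrm_def by (rule suminf_mono_ennreal) (auto simp: c_def)
  also have "\<dots> = (\<Sum>k. ennreal (if k < k0 then norm (bc g k) powr p else 0)) + (\<Sum>k. ennreal (c k powr p))"
    by (rule suminf_add[symmetric]) auto
  also have "(\<Sum>k. ennreal (if k < k0 then norm (bc g k) powr p else 0)) = (\<Sum>k<k0. ennreal (if k < k0 then norm (bc g k) powr p else 0))"
    by (rule suminf_finite) auto
  also have "\<dots> + (\<Sum>k. ennreal (c k powr p)) < \<infinity>"
    using c f(2) by (auto simp: less_top[symmetric] ennreal_mult_eq_top_iff top_unique)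
  finally show ?thesis .
qed

text \<open>Moves a zero of f from w to u. The quotient of the linear factors is bounded by 3 far
  out, which is all that \<open>nrm_dominated\<close> asks for.\<close>

lemma nrm_swap_zero:
  assumes f: "f holomorphic_on UNIV" "nrm f < \<infinity>" and g: "g holomorphic_on UNIV"
    and fg: "\<And>z. (z - w) * g z = (z - u) * f z"
  shows "nrm g < \<infinity>"
proof (rule nrm_dominated[OF f g])
  fix z :: complex assume z: "norm z \<ge> 2 * norm w + norm u + 1"
  have n: "norm (z - w) > 0" "norm (z - u) \<le> 3 * norm (z - w)"
    using z norm_triangle_ineq2[of z w] norm_triangle_ineq4[of z u] norm_ge_zero[of w] norm_ge_zero[of u] by linarith+
  have "norm (z - w) * norm (g z) = norm (z - u) * norm (f z)" using fg[of z] by (metis norm_mult)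
  also have "\<dots> \<le> 3 * norm (z - w) * norm (f z)" using n by (intro mult_right_mono) auto
  finally show "norm (g z) \<le> 3 * norm (f z)" using n by simp
qed simp

lemma nrm_monomial:
  "bc (\<lambda>z. z ^ k / of_real (wt k)) m = (if m = k then 1 else 0)" "nrm (\<lambda>z. z ^ k / of_real (wt k)) = 1"
proof -
  have "(\<lambda>m. (if m = k then 1 / of_real (wt k) else 0) * z ^ m) sums (z ^ k / of_real (wt k))" for z :: complex
    using sums_single[of k "\<lambda>m. 1 / of_real (wt k) * z ^ m"] by (simp add: if_distrib[of "\<lambda>x. x * _"] cong: if_cong)
  then have cf: "coef (\<lambda>z. z ^ k / of_real (wt k)) = (\<lambda>m. if m = k then 1 / of_real (wt k) else 0)" by (rule entire_of_sums(2))
  show b: "bc (\<lambda>z. z ^ k / of_real (wt k)) m = (if m = k then 1 else 0)" for m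
    using wt_pos[of k] by (simp add: bc_def cf)
  have "nrm (\<lambda>z. z ^ k / of_real (wt k)) = (\<Sum>m\<in>{k}. ennreal (norm (bc (\<lambda>z. z ^ k / of_real (wt k)) m) powr p))"
    unfolding nrm_def by (rule suminf_finite) (auto simp: b)
  then show "nrm (\<lambda>z. z ^ k / of_real (wt k)) = 1" by (simp add: b)
qed

end

section \<open>Dual functions, sparsity and separation of the nodes\<close>

locale basis_sequence = small_fock +
  fixes \<sigma> :: "nat \<Rightarrow> complex"
  assumes nz: "\<And>i. \<sigma> i \<noteq> 0" and mono: "\<And>i j. i \<le> j \<Longrightarrow> pos (\<sigma> i) \<le> pos (\<sigma> j)"
    and basis: "sampling_basis \<sigma>"
begin

definition C0 :: real where
  "C0 = (SOME C. C > 0 \<and> (\<forall>f. f holomorphic_on UNIV \<longrightarrow> nrm f < \<infinity> \<longrightarrow> nrm f \<le> ennreal C * tn \<sigma> f \<and> tn \<sigma> f \<le> ennreal C * nrm f))"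

lemma C0: "C0 > 0"
  "f holomorphic_on UNIV \<Longrightarrow> nrm f < \<infinity> \<Longrightarrow> nrm f \<le> ennreal C0 * tn \<sigma> f"
  "f holomorphic_on UNIV \<Longrightarrow> nrm f < \<infinity> \<Longrightarrow> tn \<sigma> f \<le> ennreal C0 * nrm f"
proof -
  have "\<exists>C. C > 0 \<and> (\<forall>f. f holomorphic_on UNIV \<longrightarrow> nrm f < \<infinity> \<longrightarrow> nrm f \<le> ennreal C * tn \<sigma> f \<and> tn \<sigma> f \<le> ennreal C * nrm f)"
    using basis unfolding sampling_basis_def by blast
  from someI_ex[OF this] show "C0 > 0"
    "f holomorphic_on UNIV \<Longrightarrow> nrm f < \<infinity> \<Longrightarrow> nrm f \<le> ennreal C0 * tn \<sigma> f"
    "f holomorphic_on UNIV \<Longrightarrow> nrm f < \<infinity> \<Longrightarrow> tn \<sigma> f \<le> ennreal C0 * nrm f"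
    unfolding C0_def by blast+
qed

lemma zero_if_vanishing:
  assumes "f holomorphic_on UNIV" "nrm f < \<infinity>" "\<And>i. f (\<sigma> i) = 0"
  shows "f z = 0"
proof (rule nrm_eq_zero[OF assms(1)])
  have "tn \<sigma> f = 0" by (simp add: tn_def assms(3))
  then show "nrm f = 0" using C0(2)[OF assms(1,2)] by simp
qed

lemma dual_ex:
  "\<exists>f. f holomorphic_on UNIV \<and> nrm f < \<infinity> \<and> (\<forall>i. of_real (om (\<sigma> i)) * f (\<sigma> i) = (if i = j then 1 else 0))"
proof -
  have "(\<Sum>i. ennreal (norm (if i = j then 1 else 0 :: complex) powr p)) = (\<Sum>i\<in>{j}. ennreal (norm (if i = j then 1 else 0 :: complex) powr p))"
    by (rule suminf_finite) auto
  then have fin: "(\<Sum>i. ennreal (norm (if i = j then 1 else 0 :: complex) powr p)) < \<infinity>" by simp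
  show ?thesis
    by (rule basis[unfolded sampling_basis_def, THEN conjunct2, rule_format, of "\<lambda>i. if i = j then 1 else 0", OF fin])
qed

definition dual :: "nat \<Rightarrow> complex \<Rightarrow> complex" where
  "dual j = (SOME f. f holomorphic_on UNIV \<and> nrm f < \<infinity> \<and> (\<forall>i. of_real (om (\<sigma> i)) * f (\<sigma> i) = (if i = j then 1 else 0)))"

lemma dual: "dual j holomorphic_on UNIV" "nrm (dual j) < \<infinity>" "of_real (om (\<sigma> i)) * dual j (\<sigma> i) = (if i = j then 1 else 0)"
  using someI_ex[OF dual_ex[of j]] unfolding dual_def by auto

lemma dual_zero: "i \<noteq> j \<Longrightarrow> dual j (\<sigma> i) = 0" and dual_nz: "dual j (\<sigma> j) \<noteq> 0"
  and om_dual: "om (\<sigma> i) * norm (dual j (\<sigma> i)) = (if i = j then 1 else 0)"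
proof -
  show "i \<noteq> j \<Longrightarrow> dual j (\<sigma> i) = 0" "dual j (\<sigma> j) \<noteq> 0"
    using dual(3)[of i j] dual(3)[of j j] om_pos[of "\<sigma> i"] by auto
  have "om (\<sigma> i) * norm (dual j (\<sigma> i)) = norm (of_real (om (\<sigma> i)) * dual j (\<sigma> i))" using om_pos[of "\<sigma> i"] by (simp add: norm_mult)
  then show "om (\<sigma> i) * norm (dual j (\<sigma> i)) = (if i = j then 1 else 0)" by (simp add: dual(3))
qed

lemma inj_nodes: "\<sigma> i = \<sigma> j \<Longrightarrow> i = j"
  using dual_zero[of i j] dual_nz[of j] by metis

definition D0 :: real where "D0 = C0 powr (1 / p)"

lemma tn_dual: "tn \<sigma> (dual j) = 1"
proof -
  have "tn \<sigma> (dual j) = (\<Sum>i\<in>{j}. ennreal ((om (\<sigma> i) * norm (dual j (\<sigma> i))) powr p))"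
    unfolding tn_def by (rule suminf_finite) (auto simp: om_dual)
  then show ?thesis by (simp add: om_dual)
qed

lemma bc_dual_le: "norm (bc (dual j) k) \<le> D0"
  unfolding D0_def using C0(2)[OF dual(1,2), of j] C0(1) by (intro bc_le_of_nrm_le) (auto simp: tn_dual)

text \<open>\<open>nn\<close> rounds positions and sends negative ones to 0. All positions are at
  least that of node 0, so \<open>r0\<close> bounds the rounding error for every node.\<close>

definition r0 :: real where "r0 = 1 + \<bar>pos (\<sigma> 0)\<bar>"
definition nn :: "nat \<Rightarrow> nat" where "nn i = nat \<lfloor>pos (\<sigma> i)\<rfloor>"

lemma nn: "\<bar>pos (\<sigma> i) - real (nn i)\<bar> \<le> r0"
  using mono[of 0 i] unfolding nn_def r0_def by linarith

definition A0 :: real where "A0 = exp (r0 + p * h * r0\<^sup>2) * (2 * exp 1 / (1 - exp (- 1))) * C0"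

lemma A0: "A0 \<ge> 0" using C0(1) by (simp add: A0_def)

text \<open>Testing the upper sampling inequality on the monomial of degree k limits how many nodes
  lie near position k. Each node is charged to its own degree \<open>nn i\<close>.\<close>

lemma sparse: "(\<Sum>i. ennreal (exp (- \<bar>pos (\<sigma> i) - y\<bar>))) \<le> ennreal A0"
proof -
  define G where "G = exp (r0 + p * h * r0\<^sup>2)"
  define g where "g i k = exp (- (h * (pos (\<sigma> i) - real k)\<^sup>2)) powr p" for i k
  have col: "(\<Sum>i. ennreal (g i k)) \<le> ennreal C0" for k
  proof -
    define f where "f z = z ^ k / of_real (wt k)" for z :: complex
    have f: "f holomorphic_on UNIV" unfolding f_def using wt_pos[of k] by (intro holomorphic_intros) auto
    have "nrm f = 1" unfolding f_def by (rule nrm_monomial)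
    then have "tn \<sigma> f \<le> ennreal C0" using C0(3)[OF f] by simp
    moreover have "om (\<sigma> i) * norm (f (\<sigma> i)) = exp (- (h * (pos (\<sigma> i) - real k)\<^sup>2))" for i
      using om_mult_power[OF nz, of i k] wt_pos[of k] by (simp add: f_def norm_divide norm_power)
    ultimately show ?thesis by (simp add: tn_def g_def)
  qed
  have pt: "ennreal (exp (- \<bar>pos (\<sigma> i) - y\<bar>)) \<le> (\<Sum>k. ennreal (G * exp (- (1 * \<bar>y - real k\<bar>))) * ennreal (g i k))" for i
  proof -
    let ?k = "nn i"
    have "(pos (\<sigma> i) - real ?k)\<^sup>2 \<le> r0\<^sup>2" using nn[of i] by (simp add: r0_def abs_le_square_iff[symmetric])
    then have "p * (h * (pos (\<sigma> i) - real ?k)\<^sup>2) \<le> p * (h * r0\<^sup>2)" using h p by (intro mult_left_mono) auto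
    moreover have "\<bar>y - real ?k\<bar> \<le> \<bar>pos (\<sigma> i) - y\<bar> + r0" using nn[of i] by linarith
    ultimately have "exp (- \<bar>pos (\<sigma> i) - y\<bar>) \<le> exp (r0 + p * h * r0\<^sup>2 + (- (1 * \<bar>y - real ?k\<bar>)) + - (p * (h * (pos (\<sigma> i) - real ?k)\<^sup>2)))"
      by simp
    also have "\<dots> = G * exp (- (1 * \<bar>y - real ?k\<bar>)) * g i ?k"
      by (simp add: G_def g_def powr_def exp_add[symmetric])
    finally have "ennreal (exp (- \<bar>pos (\<sigma> i) - y\<bar>)) \<le> ennreal (G * exp (- (1 * \<bar>y - real ?k\<bar>))) * ennreal (g i ?k)"
      by (subst ennreal_mult[symmetric]) (auto simp: G_def g_def intro: ennreal_leI)
    also have "\<dots> \<le> (\<Sum>k. ennreal (G * exp (- (1 * \<bar>y - real k\<bar>))) * ennreal (g i k))"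
      by (rule le_suminf_ennreal)
    finally show ?thesis .
  qed
  have "(\<Sum>i. ennreal (exp (- \<bar>pos (\<sigma> i) - y\<bar>))) \<le> (\<Sum>i. \<Sum>k. ennreal (G * exp (- (1 * \<bar>y - real k\<bar>))) * ennreal (g i k))"
    by (intro suminf_mono_ennreal pt)
  also have "\<dots> = (\<Sum>k. \<Sum>i. ennreal (G * exp (- (1 * \<bar>y - real k\<bar>))) * ennreal (g i k))" by (rule suminf_swap_ennreal)
  also have "\<dots> = (\<Sum>k. ennreal (G * exp (- (1 * \<bar>y - real k\<bar>))) * (\<Sum>i. ennreal (g i k)))" by (rule suminf_cong) (rule ennreal_suminf_cmult)
  also have "\<dots> \<le> (\<Sum>k. ennreal (G * exp (- (1 * \<bar>y - real k\<bar>))) * ennreal C0)"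
    by (intro suminf_mono_ennreal mult_left_mono col) simp
  also have "\<dots> = (\<Sum>k. ennreal (exp (- (1 * \<bar>y - real k\<bar>))) * ennreal (G * C0))"
    using C0(1) by (intro suminf_cong) (simp add: ennreal_mult[symmetric] G_def mult_ac)
  also have "\<dots> = (\<Sum>k. ennreal (exp (- (1 * \<bar>y - real k\<bar>)))) * ennreal (G * C0)" by (rule ennreal_suminf_multc)
  also have "\<dots> \<le> ennreal (2 * exp 1 / (1 - exp (- 1))) * ennreal (G * C0)"
    by (intro mult_right_mono suminf_exp_dist_real) auto
  also have "\<dots> = ennreal A0" using C0(1) by (simp add: A0_def G_def ennreal_mult[symmetric] mult_ac)
  finally show ?thesis .
qed

definition A1 :: real where "A1 = A0 + 2 * exp 1 / (1 - exp (- 1))"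

lemma A1: "A1 > 0" using A0 by (simp add: A1_def add_nonneg_pos)

text \<open>The division by \<open>z ^ nn j\<close> is needed: without it the weighted dual function has logarithmic derivative of order \<open>pos (\<sigma> j)\<close>.\<close>

lemma separated:
  obtains c where "c > 0" "\<And>i j. i \<noteq> j \<Longrightarrow> c * norm (\<sigma> i) \<le> norm (\<sigma> i - \<sigma> j)"
proof -
  \<comment> \<open>The change of position when the modulus is doubled or halved.\<close>
  define s where "s = 2 * \<alpha> * ln 2"
  define U where "U = D0 * gsum * exp (h * (s + r0)\<^sup>2)"
  have D0: "D0 > 0" using C0(1) by (simp add: D0_def)
  have U: "U > 0" using D0 gsum(1) by (simp add: U_def)
  have main: "min (1/4) (1 / (4 * U)) * norm (\<sigma> j) \<le> norm (\<sigma> i - \<sigma> j)" if ij: "i \<noteq> j" for i j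
  proof (cases "norm (\<sigma> i - \<sigma> j) \<le> norm (\<sigma> j) / 4")
    case False
    have "min (1/4) (1 / (4 * U)) * norm (\<sigma> j) \<le> 1/4 * norm (\<sigma> j)" by (intro mult_right_mono) auto
    then show ?thesis using False by linarith
  next
    case True
    define R where "R = norm (\<sigma> j)"
    have R: "R > 0" using nz by (simp add: R_def)
    define u where "u z = dual j z / z ^ nn j" for z
    have zb: "R / 2 \<le> norm z" "norm z \<le> 2 * R" "z \<noteq> 0" if "norm (z - \<sigma> j) \<le> R / 2" for z
    proof -
      show "R / 2 \<le> norm z" using that norm_triangle_ineq2[of "\<sigma> j" z] by (simp add: R_def norm_minus_commute)
      then show "z \<noteq> 0" using R by auto
      show "norm z \<le> 2 * R" using that norm_triangle_ineq2[of z "\<sigma> j"] R unfolding R_def by linarith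
    qed
    have ub: "norm (u z) \<le> U / wt (nn j)" if z: "norm (z - \<sigma> j) \<le> R / 2" for z
    proof -
      have "ln (norm z) \<le> ln (2 * R)" "ln (R / 2) \<le> ln (norm z)" using zb[OF z] R by (auto intro: ln_mono)
      then have "\<bar>ln (norm z) - ln R\<bar> \<le> ln 2" using R by (simp add: ln_mult ln_div)
      then have "2 * \<alpha> * \<bar>ln (norm z) - ln R\<bar> \<le> s" unfolding s_def using \<alpha> by (intro mult_left_mono) auto
      moreover have "pos z - pos (\<sigma> j) = 2 * \<alpha> * (ln (norm z) - ln R)" by (simp add: pos_def R_def algebra_simps)
      ultimately have "\<bar>pos z - pos (\<sigma> j)\<bar> \<le> s" using \<alpha> by (simp add: abs_mult)
      then have "\<bar>pos z - real (nn j)\<bar> \<le> s + r0" using nn[of j] by linarith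
      then have "(pos z - real (nn j))\<^sup>2 \<le> (s + r0)\<^sup>2" by (simp add: abs_le_square_iff[symmetric])
      then have e: "exp (h * (pos z - real (nn j))\<^sup>2) \<le> exp (h * (s + r0)\<^sup>2)" using h by simp
      have "om z * norm (dual j z) \<le> D0 * gsum" by (rule eval_bounded[OF dual(1) zb(3)[OF z] bc_dual_le])
      then have "norm (dual j z) \<le> D0 * gsum / om z" using om_pos[of z] by (simp add: field_simps)
      then have "norm (u z) \<le> D0 * gsum / om z / norm z ^ nn j"
        unfolding u_def norm_divide norm_power by (rule divide_right_mono) simp
      also have "\<dots> = D0 * gsum / (om z * norm z ^ nn j)" by simp
      also have "\<dots> = D0 * gsum * exp (h * (pos z - real (nn j))\<^sup>2) / wt (nn j)"
        unfolding om_mult_power[OF zb(3)[OF z]] by (simp add: exp_minus field_simps)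
      also have "\<dots> \<le> U / wt (nn j)" unfolding U_def using e D0 gsum(1) wt_pos[of "nn j"] by (intro divide_right_mono mult_left_mono) auto
      finally show ?thesis .
    qed
    \<comment> \<open>u vanishes at \<sigma> i and has modulus at least \<open>1 / wt (nn j)\<close>
      at \<sigma> j, while Cauchy's estimate on discs of radius R / 4 bounds its derivative; so the
      two nodes cannot be too close.\<close>
    have "norm (u (\<sigma> i) - u (\<sigma> j)) \<le> U / wt (nn j) / (R / 4) * norm (\<sigma> i - \<sigma> j)"
    proof (rule field_differentiable_bound[where f' = "deriv u" and S = "cball (\<sigma> j) (R / 4)"])
      show "convex (cball (\<sigma> j) (R / 4))" by simp
      show "\<sigma> i \<in> cball (\<sigma> j) (R / 4)" using True by (simp add: R_def dist_norm norm_minus_commute)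
      show "\<sigma> j \<in> cball (\<sigma> j) (R / 4)" using R by simp
      fix z assume z: "z \<in> cball (\<sigma> j) (R / 4)"
      have sub: "norm (x - \<sigma> j) \<le> R / 2" if "x \<in> cball z (R / 4)" for x
        using z that norm_triangle_ineq[of "x - z" "z - \<sigma> j"] by (simp add: dist_norm norm_minus_commute)
      have holc: "u holomorphic_on cball (\<sigma> j) (R / 2)"
        unfolding u_def using zb(3) by (intro holomorphic_intros holomorphic_on_subset[OF dual(1)]) (auto simp: dist_norm norm_minus_commute)
      have hol: "u holomorphic_on ball (\<sigma> j) (R / 2)" by (rule holomorphic_on_subset[OF holc ball_subset_cball])
      have "cball z (R / 4) \<subseteq> cball (\<sigma> j) (R / 2)" using sub by (auto simp: dist_norm norm_minus_commute)
      then have holz: "u holomorphic_on cball z (R / 4)" by (rule holomorphic_on_subset[OF holc])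
      have zb2: "z \<in> ball (\<sigma> j) (R / 2)" using z R by simp
      show "(u has_field_derivative deriv u z) (at z within cball (\<sigma> j) (R / 4))"
        by (rule holomorphic_derivI[OF hol open_ball zb2, THEN has_field_derivative_at_within])
      have "norm ((deriv ^^ 1) u z) \<le> fact 1 * (U / wt (nn j)) / (R / 4) ^ 1"
      proof (rule Cauchy_inequality)
        show "u holomorphic_on ball z (R / 4)" using holz by (rule holomorphic_on_subset) auto
        show "continuous_on (cball z (R / 4)) u" using holz by (rule holomorphic_on_imp_continuous_on)
        fix x assume "norm (z - x) = R / 4"
        then show "norm (u x) \<le> U / wt (nn j)" by (intro ub sub) (simp add: dist_norm)
      qed (use R in simp)
      then show "norm (deriv u z) \<le> U / wt (nn j) / (R / 4)" by simp
    qed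
    moreover have "u (\<sigma> i) = 0" using dual_zero[OF ij] by (simp add: u_def)
    moreover have "1 / wt (nn j) \<le> norm (u (\<sigma> j))"
    proof -
      have "norm (dual j (\<sigma> j)) = 1 / om (\<sigma> j)" using om_dual[of j j] om_pos[of "\<sigma> j"] by (simp add: field_simps)
      then have "norm (u (\<sigma> j)) = 1 / (om (\<sigma> j) * norm (\<sigma> j) ^ nn j)" by (simp add: u_def norm_divide norm_power)
      also have "\<dots> = exp (h * (pos (\<sigma> j) - real (nn j))\<^sup>2) / wt (nn j)"
        unfolding om_mult_power[OF nz] by (simp add: exp_minus field_simps)
      finally show ?thesis using h wt_pos[of "nn j"] by (simp add: divide_right_mono)
    qed
    ultimately have "1 / wt (nn j) \<le> U / wt (nn j) / (R / 4) * norm (\<sigma> i - \<sigma> j)" by simp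
    then have "R \<le> 4 * U * norm (\<sigma> i - \<sigma> j)" using R wt_pos[of "nn j"] by (simp add: field_simps)
    then have "1 / (4 * U) * R \<le> norm (\<sigma> i - \<sigma> j)" using U by (simp add: field_simps)
    moreover have "min (1/4) (1 / (4 * U)) * R \<le> 1 / (4 * U) * R" using R by (intro mult_right_mono) auto
    ultimately show ?thesis unfolding R_def by linarith
  qed
  show thesis
  proof
    show "min (1/4) (1 / (4 * U)) > 0" using U by simp
    show "min (1/4) (1 / (4 * U)) * norm (\<sigma> i) \<le> norm (\<sigma> i - \<sigma> j)" if "i \<noteq> j" for i j
      using main[of j i] that by (simp add: norm_minus_commute)
  qed
qed

section \<open>Bounded distance between positions and indices\<close>

lemma ennreal_absorb:
  fixes x :: ennreal
  assumes "x < \<infinity>" "x \<le> ennreal (1/2) * x + ennreal b" "b \<ge> 0"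
  shows "x \<le> ennreal (2 * b)"
proof -
  obtain r where r: "x = ennreal r" "r \<ge> 0" using assms(1) by (metis ennreal_cases infinity_ennreal_def less_irrefl)
  have "ennreal (1/2 * r) = ennreal (1/2) * ennreal r" by (rule ennreal_mult) (use r in auto)
  moreover have "ennreal (1/2 * r + b) = ennreal (1/2 * r) + ennreal b" by (rule ennreal_plus) (use r assms(3) in auto)
  ultimately have "ennreal r \<le> ennreal (1/2 * r + b)" using assms(2) r(1) by metis
  then have "r \<le> 1/2 * r + b" using r assms by (subst (asm) ennreal_le_iff) auto
  then show ?thesis unfolding r by (intro ennreal_leI) simp
qed

text \<open>Chosen so that \<open>exp (1 / h) * exp (- Ab) * A1\<close>, the Schur bound for samples
  at distance \<open>Ab\<close> from the coefficients, has p-th power 1 / (2 C0). The lower sampling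
  bound then gives nrm f <= nrm f / 2.\<close>

definition Ab :: real where "Ab = ln (exp (1 / h) * A1 / (1 / (2 * C0)) powr (1 / p))"

text \<open>
  A function whose coefficients live far from all the nodes where it does not vanish has small sample norm;
  this replaces a dimension count in the proof that \<open>pos (\<sigma> j) - j\<close> is bounded.
\<close>

lemma block_zero:
  assumes f: "f holomorphic_on UNIV" "nrm f < \<infinity>"
    and far: "\<And>i k. f (\<sigma> i) \<noteq> 0 \<Longrightarrow> bc f k \<noteq> 0 \<Longrightarrow> Ab \<le> \<bar>pos (\<sigma> i) - real k\<bar>"
  shows "f z = 0"
proof (rule nrm_eq_zero[OF f(1)])
  define t where "t = (1 / (2 * C0)) powr (1 / p)"
  have t: "t > 0" using C0(1) by (simp add: t_def)
  define M where "M = exp (1 / h) * exp (- Ab)"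
  have M: "M > 0" by (simp add: M_def)
  have "exp Ab = exp (1 / h) * A1 / t" unfolding Ab_def t_def[symmetric] using A1 t by (intro exp_ln) auto
  then have MA: "M * A1 = t" using A1 t by (simp add: M_def exp_minus field_simps)
  have "tn \<sigma> f \<le> ennreal ((M * A1) powr p) * nrm f"
    unfolding tn_def nrm_def A1_def
  proof (rule schur_exp[OF sparse A0 M p])
    fix i
    show "0 \<le> om (\<sigma> i) * norm (f (\<sigma> i))" using om_pos[of "\<sigma> i"] by simp
    show "ennreal (om (\<sigma> i) * norm (f (\<sigma> i))) \<le> (\<Sum>k. ennreal (M * exp (- \<bar>pos (\<sigma> i) - real k\<bar>) * norm (bc f k)))"
    proof (cases "f (\<sigma> i) = 0")
      case False
      have "ennreal (om (\<sigma> i) * norm (f (\<sigma> i))) \<le> (\<Sum>k. ennreal (exp (- (h * (pos (\<sigma> i) - real k)\<^sup>2)) * norm (bc f k)))"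
        by (rule eval_le[OF f(1) nz])
      also have "\<dots> \<le> (\<Sum>k. ennreal (M * exp (- \<bar>pos (\<sigma> i) - real k\<bar>) * norm (bc f k)))"
      proof (intro suminf_mono_ennreal ennreal_leI)
        fix k
        show "exp (- (h * (pos (\<sigma> i) - real k)\<^sup>2)) * norm (bc f k) \<le> M * exp (- \<bar>pos (\<sigma> i) - real k\<bar>) * norm (bc f k)"
        proof (cases "bc f k = 0")
          case b: False
          let ?y = "pos (\<sigma> i) - real k"
          have "Ab \<le> \<bar>?y\<bar>" by (rule far[OF False b])
          \<comment> \<open>Half of the rate 2 is spent on the gap \<open>Ab\<close>; the other half
            keeps the kernel summable.\<close>
          then have "exp (1 / h) * exp (- (2 * \<bar>?y\<bar>)) \<le> M * exp (- \<bar>?y\<bar>)"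
            by (simp add: M_def mult.assoc exp_add[symmetric])
          then have "exp (- (h * ?y\<^sup>2)) \<le> M * exp (- \<bar>?y\<bar>)"
            using gaussian_le_exp[OF h, of ?y 2] by simp
          then show ?thesis by (intro mult_right_mono) auto
        qed simp
      qed
      finally show ?thesis .
    qed simp
  qed simp
  also have "(M * A1) powr p = 1 / (2 * C0)" unfolding MA t_def using p C0(1) by (simp add: powr_powr)
  finally have "nrm f \<le> ennreal C0 * (ennreal (1 / (2 * C0)) * nrm f)"
    using C0(2)[OF f] by (meson mult_left_mono order_trans zero_le)
  also have "\<dots> = ennreal (1/2) * nrm f"
    using C0(1) by (simp add: mult.assoc[symmetric] ennreal_mult[symmetric])
  finally have "nrm f \<le> ennreal (1/2) * nrm f + ennreal 0" by simp
  from ennreal_absorb[OF f(2) this] show "nrm f = 0" by simp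
qed

text \<open>If node K lay too far out, the polynomial with zeros at the K nodes before it would
  contradict \<open>block_zero\<close>: its coefficients stop at degree K, and it can be nonzero
  only at nodes from K on.\<close>

lemma pos_upper: "pos (\<sigma> K) \<le> real K + Ab"
proof (rule ccontr)
  assume "\<not> ?thesis"
  then have K: "real K + Ab < pos (\<sigma> K)" by simp
  define P where "P = (\<Prod>j<K. [:- \<sigma> j, 1:])"
  have deg: "degree P \<le> K"
  proof -
    have "degree P \<le> sum (degree \<circ> (\<lambda>j. [:- \<sigma> j, 1:])) {..<K}" unfolding P_def by (rule degree_prod_sum_le) simp
    then show ?thesis by simp
  qed
  have b0: "bc (poly P) k = 0" if "k > K" for k using that deg by (simp add: bc_def coef_poly coeff_eq_0)
  have Pz: "poly P z = (\<Prod>j<K. z - \<sigma> j)" for z by (simp add: P_def poly_prod)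
  have "poly P 0 = 0"
  proof (rule block_zero[where f = "poly P"])
    show "poly P holomorphic_on UNIV" unfolding Pz[abs_def] by (intro holomorphic_intros)
    show "nrm (poly P) < \<infinity>" by (rule nrm_finite_support[OF b0])
    fix i k assume "poly P (\<sigma> i) \<noteq> 0" and k: "bc (poly P) k \<noteq> 0"
    then have "K \<le> i" unfolding Pz by (metis finite_lessThan lessThan_iff not_le prod_zero_iff right_minus_eq)
    then have "pos (\<sigma> K) \<le> pos (\<sigma> i)" by (rule mono)
    moreover have "k \<le> K" using b0 k not_le by blast
    ultimately show "Ab \<le> \<bar>pos (\<sigma> i) - real k\<bar>" using K by linarith
  qed
  then show False unfolding Pz using nz by simp
qed

text \<open>The zeros of \<open>dual 0\<close> at nodes 1, ..., n are moved to the origin one at a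
  time. The result has order at least n at 0, while the zeros at later nodes and the nonzero value
  at node 0 survive.\<close>

lemma shifted_zeros:
  "\<exists>u. u holomorphic_on UNIV \<and> nrm (\<lambda>z. z ^ n * u z) < \<infinity> \<and> u (\<sigma> 0) \<noteq> 0 \<and> (\<forall>i>n. u (\<sigma> i) = 0)"
proof (induction n)
  case 0
  then show ?case using dual[of 0] dual_nz[of 0] dual_zero[of _ 0] by (intro exI[of _ "dual 0"]) auto
next
  case (Suc n)
  then obtain u where u: "u holomorphic_on UNIV" "nrm (\<lambda>z. z ^ n * u z) < \<infinity>" "u (\<sigma> 0) \<noteq> 0" "\<And>i. i > n \<Longrightarrow> u (\<sigma> i) = 0" by blast
  define a where "a = \<sigma> (Suc n)"
  define v where "v z = (if z = a then deriv u a else (u z - u a) / (z - a))" for z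
  have v: "v holomorphic_on UNIV" unfolding v_def by (rule pole_lemma_open) (use u in auto)
  have uv: "u z = (z - a) * v z" for z using u(4)[of "Suc n"] by (simp add: v_def a_def)
  have "nrm (\<lambda>z. z ^ Suc n * v z) < \<infinity>"
  proof (rule nrm_swap_zero[where f = "\<lambda>z. z ^ n * u z" and w = a and u = 0])
    show "(z - a) * (z ^ Suc n * v z) = (z - 0) * (z ^ n * u z)" for z by (simp add: uv)
  qed (use u v in \<open>auto intro!: holomorphic_intros\<close>)
  moreover have "v (\<sigma> i) = 0" if "i > Suc n" for i
    using uv[of "\<sigma> i"] u(4)[of i] that inj_nodes[of i "Suc n"] by (auto simp: a_def)
  moreover have "v (\<sigma> 0) \<noteq> 0" using uv[of "\<sigma> 0"] u(3) by auto
  ultimately show ?case using v by blast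
qed

text \<open>Mirror image of \<open>pos_upper\<close>: now the coefficients start at degree K and the
  function can be nonzero only at nodes up to K, yet it does not vanish at node 0.\<close>

lemma pos_lower: "real K - Ab \<le> pos (\<sigma> K)"
proof (rule ccontr)
  assume "\<not> ?thesis"
  then have K: "pos (\<sigma> K) < real K - Ab" by simp
  obtain u where u: "u holomorphic_on UNIV" "nrm (\<lambda>z. z ^ K * u z) < \<infinity>" "u (\<sigma> 0) \<noteq> 0" "\<And>i. i > K \<Longrightarrow> u (\<sigma> i) = 0"
    using shifted_zeros[of K] by blast
  have "(\<sigma> 0) ^ K * u (\<sigma> 0) = 0"
  proof (rule block_zero[where f = "\<lambda>z. z ^ K * u z"])
    show "(\<lambda>z. z ^ K * u z) holomorphic_on UNIV" using u by (intro holomorphic_intros)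
    fix i k assume i: "\<sigma> i ^ K * u (\<sigma> i) \<noteq> 0" and k: "bc (\<lambda>z. z ^ K * u z) k \<noteq> 0"
    have "i \<le> K" using i u(4)[of i] by (cases "i \<le> K") auto
    then have "pos (\<sigma> i) \<le> pos (\<sigma> K)" by (rule mono)
    moreover have "K \<le> k" using k by (cases "k < K") (auto simp: bc_def coef_shift[OF u(1)])
    ultimately show "Ab \<le> \<bar>pos (\<sigma> i) - real k\<bar>" using K by linarith
  qed (rule u)
  then show False using u(3) nz[of 0] by simp
qed

end

section \<open>Exponential off-diagonal decay of the dual functions\<close>

lemma abs_one_minus_exp_le:
  fixes t s \<epsilon> :: real
  assumes "\<bar>t\<bar> \<le> \<epsilon> * s" "0 \<le> \<epsilon>" "\<epsilon> \<le> 1" "s \<ge> 0"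
  shows "\<bar>1 - exp t\<bar> \<le> \<epsilon> * exp (2 * s)"
proof -
  have "\<bar>1 - exp t\<bar> \<le> exp \<bar>t\<bar> - 1"
  proof (cases "t \<ge> 0")
    case False
    have "exp t + exp (- t) \<ge> 2"
      using exp_ge_add_one_self[of t] exp_ge_add_one_self[of "- t"] by linarith
    then show ?thesis using False by simp
  qed simp
  also have "\<dots> \<le> exp (\<epsilon> * s) - 1" using assms by simp
  also have "\<dots> \<le> (\<epsilon> * s) * exp (\<epsilon> * s)"
  proof -
    have "(1 + - (\<epsilon> * s)) * exp (\<epsilon> * s) \<le> exp (- (\<epsilon> * s)) * exp (\<epsilon> * s)"
      by (intro mult_right_mono exp_ge_add_one_self) simp
    then show ?thesis by (simp add: exp_minus algebra_simps)
  qed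
  \<comment> \<open>One factor exp s pays for the linear s, the other for the exponential. The final
    rate 2 does not depend on \<epsilon>, so \<epsilon> can be chosen small afterwards.\<close>
  also have "\<dots> \<le> (\<epsilon> * exp s) * exp s"
  proof (rule mult_mono)
    have "s \<le> exp s" using exp_ge_add_one_self[of s] by linarith
    then show "\<epsilon> * s \<le> \<epsilon> * exp s" using assms by (intro mult_left_mono)
    have "\<epsilon> * s \<le> 1 * s" using assms by (intro mult_right_mono) auto
    then show "exp (\<epsilon> * s) \<le> exp s" by simp
  qed (use assms in auto)
  also have "\<dots> = \<epsilon> * exp (2 * s)" by (simp add: mult.assoc exp_add[symmetric])
  finally show ?thesis .
qed

context basis_sequence
begin

text \<open>
  Combes--Thomas argument: multiplying the coefficients of a dual function by a truncated exponential weight changes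
  its samples by a small multiple of the new norm, which the lower sampling bound absorbs.
\<close>

lemma dual_decay:
  obtains \<epsilon> D where "\<epsilon> > 0" "\<epsilon> \<le> 1" "D > 0"
    "\<And>j k. norm (bc (dual j) k) \<le> D * exp (- (\<epsilon> * \<bar>real k - pos (\<sigma> j)\<bar>))"
proof -
  \<comment> \<open>The Gaussian is used with rate 3: 2 for the factor exp(2 y) caused by a change
    of weight over the distance y, and 1 to stay summable.\<close>
  define M where "M = exp (9 / (4 * h))"
  define T where "T = C0 * 2 powr p"
  have T: "T > 0" using C0(1) by (simp add: T_def)
  \<comment> \<open>Makes the p-th power of the perturbation bound 1 / (2 T), so that multiplication
    by T leaves half of \<open>nrm g\<close>.\<close>
  define t where "t = (1 / (2 * T)) powr (1 / p)"
  have t: "t > 0" using T by (simp add: t_def)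
  have M: "M > 0" by (simp add: M_def)
  define \<epsilon> where "\<epsilon> = min 1 (t / (M * A1))"
  have \<epsilon>: "\<epsilon> > 0" "\<epsilon> \<le> 1" using t M A1 by (auto simp: \<epsilon>_def)
  define D where "D = (2 * T) powr (1 / p)"
  have D: "D > 0" using T by (simp add: D_def)
  have "norm (bc (dual j) k) \<le> D * exp (- (\<epsilon> * \<bar>real k - pos (\<sigma> j)\<bar>))" for j k
  proof -
    \<comment> \<open>The weight is cut off at the distance of the index k under study. Being
      bounded, it keeps g in the space, so that its norm can be absorbed; yet it attains its full
      size at k.\<close>
    define R where "R = \<bar>real k - pos (\<sigma> j)\<bar>"
    define W where "W m = exp (\<epsilon> * min \<bar>real m - pos (\<sigma> j)\<bar> R)" for m
    define V where "V i = exp (\<epsilon> * min \<bar>pos (\<sigma> i) - pos (\<sigma> j)\<bar> R)" for i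
    have W: "0 < W m" "W m \<le> exp (\<epsilon> * R)" for m using \<epsilon> by (auto simp: W_def)
    have "norm (of_real (W m) * bc (dual j) m) \<le> exp (\<epsilon> * R) * D0" for m
      using mult_mono[OF W(2) bc_dual_le[of j m]] W(1)[of m] by (simp add: norm_mult)
    then obtain g where g: "g holomorphic_on UNIV" "bc g = (\<lambda>m. of_real (W m) * bc (dual j) m)"
      using synth[of "\<lambda>m. of_real (W m) * bc (dual j) m" "exp (\<epsilon> * R) * D0"] by blast
    have gW: "norm (bc g m) = W m * norm (bc (dual j) m)" for m using W(1)[of m] by (simp add: g(2) norm_mult)
    have "nrm g \<le> (\<Sum>m. ennreal (exp (\<epsilon> * R) powr p) * ennreal (norm (bc (dual j) m) powr p))"
      unfolding nrm_def
    proof (rule suminf_mono_ennreal)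
      fix m
      have "norm (bc g m) powr p \<le> (exp (\<epsilon> * R) * norm (bc (dual j) m)) powr p"
        unfolding gW using W[of m] p by (intro powr_mono2 mult_right_mono) auto
      then show "ennreal (norm (bc g m) powr p) \<le> ennreal (exp (\<epsilon> * R) powr p) * ennreal (norm (bc (dual j) m) powr p)"
        by (simp add: powr_mult ennreal_mult[symmetric] ennreal_leI)
    qed
    also have "\<dots> = ennreal (exp (\<epsilon> * R) powr p) * nrm (dual j)" unfolding nrm_def by (rule ennreal_suminf_cmult)
    also have "\<dots> < \<infinity>" using dual(2) by (simp add: ennreal_mult_less_top)
    finally have gfin: "nrm g < \<infinity>" .
    \<comment> \<open>The defect between weighting coefficients and weighting samples. Both weights
      come from one function of position, which varies slowly for small \<epsilon>.\<close>
    define c where "c i = om (\<sigma> i) * norm (g (\<sigma> i) - of_real (V i) * dual j (\<sigma> i))" for i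
    have c0: "c i \<ge> 0" for i using om_pos[of "\<sigma> i"] by (simp add: c_def)
    have cs: "(\<Sum>i. ennreal (c i powr p)) \<le> ennreal ((\<epsilon> * M * A1) powr p) * nrm g"
      unfolding nrm_def A1_def
    proof (rule schur_exp[OF sparse A0 _ p])
      fix i
      define d where "d z = 1 * g z + (- of_real (V i)) * dual j z" for z
      have d: "d holomorphic_on UNIV" unfolding d_def by (intro holomorphic_intros g dual)
      have bd: "bc d m = of_real (W m - V i) * bc (dual j) m" for m
        unfolding d_def by (subst bc_linear[OF g(1) dual(1)]) (simp add: g(2) algebra_simps)
      have "ennreal (c i) = ennreal (om (\<sigma> i) * norm (d (\<sigma> i)))" by (simp add: c_def d_def)
      also have "\<dots> \<le> (\<Sum>m. ennreal (exp (- (h * (pos (\<sigma> i) - real m)\<^sup>2)) * norm (bc d m)))" by (rule eval_le[OF d nz])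
      also have "\<dots> \<le> (\<Sum>m. ennreal (\<epsilon> * M * exp (- \<bar>pos (\<sigma> i) - real m\<bar>) * norm (bc g m)))"
      proof (intro suminf_mono_ennreal ennreal_leI)
        fix m
        define y where "y = \<bar>pos (\<sigma> i) - real m\<bar>"
        define e where "e = \<epsilon> * min \<bar>pos (\<sigma> i) - pos (\<sigma> j)\<bar> R - \<epsilon> * min \<bar>real m - pos (\<sigma> j)\<bar> R"
        have "\<bar>min \<bar>pos (\<sigma> i) - pos (\<sigma> j)\<bar> R - min \<bar>real m - pos (\<sigma> j)\<bar> R\<bar> \<le> y" unfolding y_def by linarith
        then have "\<epsilon> * \<bar>min \<bar>pos (\<sigma> i) - pos (\<sigma> j)\<bar> R - min \<bar>real m - pos (\<sigma> j)\<bar> R\<bar> \<le> \<epsilon> * y" using \<epsilon> by (intro mult_left_mono) auto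
        then have "\<bar>e\<bar> \<le> \<epsilon> * y" unfolding e_def right_diff_distrib[symmetric] abs_mult using \<epsilon> by simp
        then have 1: "\<bar>1 - exp e\<bar> \<le> \<epsilon> * exp (2 * y)" using \<epsilon> by (intro abs_one_minus_exp_le) (auto simp: y_def)
        have "V i = W m * exp e" by (simp add: V_def W_def e_def exp_add[symmetric])
        then have "W m - V i = W m * (1 - exp e)" by (simp add: algebra_simps)
        then have "norm (bc d m) = \<bar>1 - exp e\<bar> * norm (bc g m)" unfolding bd gW norm_mult norm_of_real using W(1)[of m] by (simp add: abs_mult)
        also have "\<dots> \<le> \<epsilon> * exp (2 * y) * norm (bc g m)" using 1 by (intro mult_right_mono) auto
        finally have 2: "norm (bc d m) \<le> \<epsilon> * exp (2 * y) * norm (bc g m)" .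
        have 3: "exp (- (h * (pos (\<sigma> i) - real m)\<^sup>2)) \<le> M * exp (- (3 * y))"
          using gaussian_le_exp[OF h, of "pos (\<sigma> i) - real m" 3] by (simp add: M_def y_def)
        have "exp (- (h * (pos (\<sigma> i) - real m)\<^sup>2)) * norm (bc d m) \<le> (M * exp (- (3 * y))) * (\<epsilon> * exp (2 * y) * norm (bc g m))"
          by (rule mult_mono[OF 3 2]) (use M in auto)
        also have "\<dots> = \<epsilon> * M * (exp (- (3 * y)) * exp (2 * y)) * norm (bc g m)" by simp
        also have "exp (- (3 * y)) * exp (2 * y) = exp (- y)" by (simp add: exp_add[symmetric])
        finally show "exp (- (h * (pos (\<sigma> i) - real m)\<^sup>2)) * norm (bc d m) \<le> \<epsilon> * M * exp (- \<bar>pos (\<sigma> i) - real m\<bar>) * norm (bc g m)"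
          by (simp add: y_def)
      qed
      finally show "ennreal (c i) \<le> (\<Sum>m. ennreal (\<epsilon> * M * exp (- \<bar>pos (\<sigma> i) - real m\<bar>) * norm (bc g m)))" .
    qed (use \<epsilon> M c0 in auto)
    \<comment> \<open>At node j itself the weight is 1, so the weighted samples of
      \<open>dual j\<close> still form a unit vector.\<close>
    have Vj: "V j = 1" by (simp add: V_def R_def)
    have "tn \<sigma> g \<le> ennreal (2 powr p) * ((\<Sum>i. ennreal (c i powr p)) + (\<Sum>i. ennreal ((if i = j then 1 else 0) powr p)))"
      unfolding tn_def
    proof (rule suminf_powr_add_le[OF p])
      fix i
      show "0 \<le> om (\<sigma> i) * norm (g (\<sigma> i))" using om_pos[of "\<sigma> i"] by simp
      have "norm (g (\<sigma> i)) \<le> norm (g (\<sigma> i) - of_real (V i) * dual j (\<sigma> i)) + norm (of_real (V i) * dual j (\<sigma> i))"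
        by (metis diff_add_cancel norm_triangle_ineq)
      then have "om (\<sigma> i) * norm (g (\<sigma> i)) \<le> om (\<sigma> i) * (norm (g (\<sigma> i) - of_real (V i) * dual j (\<sigma> i)) + norm (of_real (V i) * dual j (\<sigma> i)))"
        using om_pos[of "\<sigma> i"] by (intro mult_left_mono) auto
      also have "\<dots> = c i + V i * (om (\<sigma> i) * norm (dual j (\<sigma> i)))" by (simp add: c_def norm_mult V_def algebra_simps)
      also have "V i * (om (\<sigma> i) * norm (dual j (\<sigma> i))) = (if i = j then 1 else 0)" by (simp add: om_dual Vj)
      finally show "om (\<sigma> i) * norm (g (\<sigma> i)) \<le> c i + (if i = j then 1 else 0)" .
    qed (use c0 in auto)
    also have "(\<Sum>i. ennreal ((if i = j then 1 else 0) powr p)) = (\<Sum>i\<in>{j}. ennreal ((if i = j then 1 else 0) powr p))"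
      by (rule suminf_finite) auto
    also have "\<dots> = 1" by simp
    finally have tg: "tn \<sigma> g \<le> ennreal (2 powr p) * ((\<Sum>i. ennreal (c i powr p)) + 1)" .
    have "(\<epsilon> * M * A1) powr p \<le> 1 / (2 * T)"
    proof -
      have "\<epsilon> * (M * A1) \<le> t / (M * A1) * (M * A1)" using M A1 by (intro mult_right_mono) (auto simp: \<epsilon>_def)
      then have "\<epsilon> * M * A1 \<le> t" using M A1 by (simp add: mult.assoc)
      then have "(\<epsilon> * M * A1) powr p \<le> t powr p" using p \<epsilon> M A1 by (intro powr_mono2) auto
      also have "\<dots> = 1 / (2 * T)" unfolding t_def using p T by (simp add: powr_powr)
      finally show ?thesis .
    qed
    then have cs2: "(\<Sum>i. ennreal (c i powr p)) \<le> ennreal (1 / (2 * T)) * nrm g"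
      by (intro order_trans[OF cs] mult_right_mono ennreal_leI) auto
    have "nrm g \<le> ennreal C0 * tn \<sigma> g" by (rule C0(2)[OF g(1) gfin])
    also have "\<dots> \<le> ennreal C0 * (ennreal (2 powr p) * (ennreal (1 / (2 * T)) * nrm g + 1))"
      by (intro mult_left_mono order_trans[OF tg] add_right_mono cs2) auto
    also have "\<dots> = ennreal T * (ennreal (1 / (2 * T)) * nrm g + 1)"
      unfolding T_def using C0(1) by (simp add: ennreal_mult mult.assoc)
    also have "\<dots> = ennreal T * ennreal (1 / (2 * T)) * nrm g + ennreal T" by (simp add: distrib_left mult.assoc)
    also have "ennreal T * ennreal (1 / (2 * T)) = ennreal (1/2)" using T by (subst ennreal_mult[symmetric]) auto
    finally have "nrm g \<le> ennreal (1/2) * nrm g + ennreal T" .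
    then have "nrm g \<le> ennreal (2 * T)" using T by (intro ennreal_absorb gfin) auto
    then have "norm (bc g k) \<le> D" unfolding D_def using T by (intro bc_le_of_nrm_le) auto
    then have "exp (\<epsilon> * R) * norm (bc (dual j) k) \<le> D" unfolding gW W_def R_def by simp
    then show ?thesis by (simp add: R_def[symmetric] exp_minus field_simps)
  qed
  then show thesis using that \<epsilon> D by blast
qed

lemma near: obtains c where "near_regular \<alpha> p \<sigma> \<bar>Ab\<bar> c"
proof -
  obtain c where c: "c > 0" "\<And>i j. i \<noteq> j \<Longrightarrow> c * norm (\<sigma> i) \<le> norm (\<sigma> i - \<sigma> j)" using separated by blast
  have "near_regular \<alpha> p \<sigma> \<bar>Ab\<bar> c"
  proof unfold_locales
    show "\<bar>pos (\<sigma> i) - real i\<bar> \<le> \<bar>Ab\<bar>" for i using pos_upper[of i] pos_lower[of i] by linarith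
  qed (use nz c in auto)
  then show thesis using that by blast
qed

end

section \<open>Identification of the dual functions and growth of the partial sums\<close>

locale near_basis = near_regular + basis_sequence
begin

text \<open>The quotient H by the product is a polynomial because of its growth. A zero of H could
  be moved to node j, giving a function of finite norm that vanishes at all nodes; so H has no zero
  and is constant by the fundamental theorem of algebra.\<close>

lemma dual_eq_lag: "dual j z = lag j z"
proof -
  obtain H where H: "H holomorphic_on UNIV" "\<And>z. dual j z = Q {j} z * H z"
    using Q_divides[OF dual(1), of "{j}"] dual_zero by blast
  have Ek: "E k \<le> B * real k" for k
  proof -
    have "E k \<le> (\<Sum>i<k. B)" unfolding E_def deviation_def using B by (intro sum_mono) (simp add: abs_le_iff)
    then show ?thesis by (simp add: mult.commute)
  qed
  \<comment> \<open>\<open>E\<close> has slope at most B, so \<open>quotient_coef_zero\<close> with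
    \<eta> = 1/2 excludes all degrees m >= B + 1.\<close>
  define m0 where "m0 = nat \<lceil>B\<rceil> + 2"
  have c0: "coef H m = 0" if m: "m \<ge> m0" for m
  proof (rule quotient_coef_zero[OF H])
    show "om z * norm (dual j z) \<le> D0 * gsum" if "z \<noteq> 0" for z by (rule eval_bounded[OF dual(1) that bc_dual_le])
    show "(0::real) < 1/2" by simp
    show "E k \<le> (real m - 1/2 - 1/2) * real k + 0" for k
    proof -
      have "B \<le> real m - 1" using m unfolding m0_def by linarith
      then have "B * real k \<le> (real m - 1) * real k" by (intro mult_right_mono) auto
      then show ?thesis using Ek[of k] by simp
    qed
  qed
  have HP: "H z = (\<Sum>k\<le>m0. coef H k * z ^ k)" for z
  proof -
    have "(\<lambda>k. coef H k * z ^ k) sums (\<Sum>k\<le>m0. coef H k * z ^ k)" by (rule sums_finite) (use c0 in auto)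
    then show ?thesis using coef_sums[OF H(1), of z] sums_unique2 by blast
  qed
  have nroot: "H w \<noteq> 0" for w
  proof
    assume w: "H w = 0"
    define H1 where "H1 z = (if z = w then deriv H w else (H z - H w) / (z - w))" for z
    have H1: "H1 holomorphic_on UNIV" unfolding H1_def by (rule pole_lemma_open) (use H in auto)
    have HH: "H z = (z - w) * H1 z" for z using w by (simp add: H1_def)
    define g where "g z = (z - \<sigma> j) * (Q {j} z * H1 z)" for z
    have g: "g holomorphic_on UNIV" unfolding g_def by (intro holomorphic_intros Q_holo H1)
    have gd: "(z - w) * g z = (z - \<sigma> j) * dual j z" for z by (simp add: g_def H(2) HH)
    have "nrm g < \<infinity>" by (rule nrm_swap_zero[OF dual(1) dual(2) g gd])
    moreover have "g (\<sigma> i) = 0" for i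
      using Q_zero_iff[of "{j}" "\<sigma> i"] by (cases "i = j") (auto simp: g_def)
    ultimately have "g z = 0" for z using zero_if_vanishing[OF g] by blast
    then have "(z - \<sigma> j) * dual j z = 0" for z using gd[of z] by simp
    then have "dual j (\<sigma> j) = 0" by (rule entire_zero_of_mult[OF dual(1)])
    then show False using dual_nz by simp
  qed
  have z1: "coef H k = 0" if "1 \<le> k" "k \<le> m0" for k
  proof (rule ccontr)
    assume "coef H k \<noteq> 0"
    then have "coef H 0 = 0 \<or> (\<exists>i\<in>{1..m0}. coef H i \<noteq> 0)" using that by auto
    then obtain z where "(\<Sum>k\<le>m0. coef H k * z ^ k) = 0" using fundamental_theorem_of_algebra by blast
    then show False using nroot[of z] HP[of z] by simp
  qed
  have Hc0: "H z = coef H 0" for z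
  proof -
    have "(\<Sum>k\<le>m0. coef H k * z ^ k) = (\<Sum>k\<in>{0}. coef H k * z ^ k)"
      by (rule sum.mono_neutral_right) (use z1 in auto)
    then show ?thesis by (simp add: HP)
  qed
  then have Hc: "H z = H (\<sigma> j)" by metis
  have "of_real (om (\<sigma> j)) * (Q {j} (\<sigma> j) * H (\<sigma> j)) = 1" using dual(3)[of j j] by (simp add: H(2))
  then have "H (\<sigma> j) = 1 / (of_real (om (\<sigma> j)) * Q {j} (\<sigma> j))"
    using Q_node_nz[of j] om_pos[of "\<sigma> j"] by (simp add: field_simps)
  then show ?thesis unfolding H(2) Hc lag_def by simp
qed

text \<open>On a circle near k that avoids the nodes, decay of the coefficients becomes decay of
  \<open>lag j\<close>, and the lower bound for the product turns it into a bound on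
  \<open>\<Psi> j k / \<Psi> j j\<close>. The logarithm of this ratio is linear in the increment of
  \<open>E\<close>.\<close>

lemma cumulative:
  obtains \<eta> C where "\<eta> > 0" "\<And>m n. m \<le> n \<Longrightarrow> \<bar>E n - E m\<bar> \<le> (1/2 - \<eta>) * (real n - real m) + C"
proof -
  obtain \<epsilon> D where \<epsilon>: "\<epsilon> > 0" "\<epsilon> \<le> 1" and D: "D > 0"
    and dec: "\<And>j k. norm (bc (dual j) k) \<le> D * exp (- (\<epsilon> * \<bar>real k - pos (\<sigma> j)\<bar>))" using dual_decay by blast
  obtain d where d: "0 < d" "d \<le> 1" and gc: "\<And>k::nat. \<exists>y. real k \<le> y \<and> y \<le> real k + 1 \<and> (\<forall>z. norm z = circ y \<longrightarrow> (\<forall>i. d \<le> norm (1 - z / \<sigma> i)))"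
    using good_circle by blast
  define M where "M = exp (4 / (4 * h))"
  define S where "S = 2 * exp 1 / (1 - exp (- 1 :: real))"
  have S: "S > 0" by (simp add: S_def)
  define L where "L = exp (qC + (2 + 2 * ln (2 / d)) * qS)"
  define G where "G = L * exp (qC + qS) * (D * M * S * exp (\<epsilon> * (1 + B)))"
  have G: "G > 0" using D S by (simp add: G_def L_def M_def)
  have main: "\<Psi> j k / \<Psi> j j \<le> G * exp (- (\<epsilon> * \<bar>real k - real j\<bar>))" for j k
  proof -
    obtain y where y: "real k \<le> y" "y \<le> real k + 1" "\<And>z i. norm z = circ y \<Longrightarrow> d \<le> norm (1 - z / \<sigma> i)" using gc[of k] by blast
    define z where "z = complex_of_real (circ y)"
    have z: "norm z = circ y" "z \<noteq> 0" using circ_pos[of y] by (auto simp: z_def)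
    have pz: "pos z = y" by (rule pos_circ[OF z(1)])
    have "ennreal (om z * norm (lag j z)) \<le> (\<Sum>m. ennreal (exp (- (h * (y - real m)\<^sup>2)) * norm (bc (dual j) m)))"
      using eval_le[OF dual(1) z(2), of j] by (simp add: pz dual_eq_lag)
    also have "\<dots> \<le> (\<Sum>m. ennreal (D * M * exp (- (\<epsilon> * \<bar>y - pos (\<sigma> j)\<bar>))) * ennreal (exp (- (1 * \<bar>y - real m\<bar>))))"
    proof (rule suminf_mono_ennreal)
      fix m
      have 1: "exp (- (h * (y - real m)\<^sup>2)) \<le> M * exp (- (2 * \<bar>y - real m\<bar>))"
        using gaussian_le_exp[OF h, of "y - real m" 2] by (simp add: M_def)
      have "exp (- (h * (y - real m)\<^sup>2)) * norm (bc (dual j) m) \<le> (M * exp (- (2 * \<bar>y - real m\<bar>))) * (D * exp (- (\<epsilon> * \<bar>real m - pos (\<sigma> j)\<bar>)))"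
        by (rule mult_mono[OF 1 dec]) (auto simp: M_def)
      also have "\<dots> = D * M * exp (- (2 * \<bar>y - real m\<bar>) - \<epsilon> * \<bar>real m - pos (\<sigma> j)\<bar>)" by (simp add: exp_diff exp_minus field_simps)
      also have "\<dots> \<le> D * M * exp (- (\<epsilon> * \<bar>y - pos (\<sigma> j)\<bar>) - \<bar>y - real m\<bar>)"
      proof (intro mult_left_mono)
        have "\<epsilon> * \<bar>y - pos (\<sigma> j)\<bar> \<le> \<epsilon> * (\<bar>y - real m\<bar> + \<bar>real m - pos (\<sigma> j)\<bar>)" using \<epsilon> by (intro mult_left_mono) auto
        moreover have "\<epsilon> * \<bar>y - real m\<bar> \<le> 1 * \<bar>y - real m\<bar>" using \<epsilon> by (intro mult_right_mono) auto
        ultimately have "- (2 * \<bar>y - real m\<bar>) - \<epsilon> * \<bar>real m - pos (\<sigma> j)\<bar> \<le> - (\<epsilon> * \<bar>y - pos (\<sigma> j)\<bar>) - \<bar>y - real m\<bar>"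
          by (simp add: distrib_left)
        then show "exp (- (2 * \<bar>y - real m\<bar>) - \<epsilon> * \<bar>real m - pos (\<sigma> j)\<bar>) \<le> exp (- (\<epsilon> * \<bar>y - pos (\<sigma> j)\<bar>) - \<bar>y - real m\<bar>)" by simp
      qed (use D in \<open>auto simp: M_def\<close>)
      also have "\<dots> = D * M * exp (- (\<epsilon> * \<bar>y - pos (\<sigma> j)\<bar>)) * exp (- (1 * \<bar>y - real m\<bar>))" by (simp add: exp_diff exp_minus field_simps)
      finally show "ennreal (exp (- (h * (y - real m)\<^sup>2)) * norm (bc (dual j) m)) \<le> ennreal (D * M * exp (- (\<epsilon> * \<bar>y - pos (\<sigma> j)\<bar>))) * ennreal (exp (- (1 * \<bar>y - real m\<bar>)))"
        using D by (subst ennreal_mult[symmetric]) (auto simp: M_def intro: ennreal_leI)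
    qed
    also have "\<dots> = ennreal (D * M * exp (- (\<epsilon> * \<bar>y - pos (\<sigma> j)\<bar>))) * (\<Sum>m. ennreal (exp (- (1 * \<bar>y - real m\<bar>))))" by (rule ennreal_suminf_cmult)
    also have "\<dots> \<le> ennreal (D * M * exp (- (\<epsilon> * \<bar>y - pos (\<sigma> j)\<bar>))) * ennreal S"
      unfolding S_def by (intro mult_left_mono suminf_exp_dist_real) auto
    also have "\<dots> = ennreal (D * M * exp (- (\<epsilon> * \<bar>y - pos (\<sigma> j)\<bar>)) * S)" using D S by (subst ennreal_mult[symmetric]) (auto simp: M_def)
    finally have "om z * norm (lag j z) \<le> D * M * exp (- (\<epsilon> * \<bar>y - pos (\<sigma> j)\<bar>)) * S"
      using D S by (subst (asm) ennreal_le_iff) (auto simp: M_def)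
    also have "\<dots> \<le> D * M * exp (\<epsilon> * (1 + B) - \<epsilon> * \<bar>real k - real j\<bar>) * S"
    proof -
      have "\<bar>real k - real j\<bar> \<le> \<bar>y - pos (\<sigma> j)\<bar> + (1 + B)" using y B[of j] by linarith
      then have "\<epsilon> * \<bar>real k - real j\<bar> \<le> \<epsilon> * (\<bar>y - pos (\<sigma> j)\<bar> + (1 + B))" using \<epsilon> by (intro mult_left_mono) auto
      then have "exp (- (\<epsilon> * \<bar>y - pos (\<sigma> j)\<bar>)) \<le> exp (\<epsilon> * (1 + B) - \<epsilon> * \<bar>real k - real j\<bar>)" by (simp add: distrib_left)
      then show ?thesis using D S by (intro mult_right_mono mult_left_mono) (auto simp: M_def)
    qed
    also have "\<dots> = D * M * S * exp (\<epsilon> * (1 + B)) * exp (- (\<epsilon> * \<bar>real k - real j\<bar>))" by (simp add: exp_diff exp_minus field_simps)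
    finally have up: "om z * norm (lag j z) \<le> D * M * S * exp (\<epsilon> * (1 + B)) * exp (- (\<epsilon> * \<bar>real k - real j\<bar>))" .
    have lo: "\<Psi> j k \<le> L * (om z * norm (Q {j} z))"
      unfolding L_def by (rule Q_lower[OF z(2)]) (use y z pz d B_nonneg in auto)
    have nd: "om (\<sigma> j) * norm (Q {j} (\<sigma> j)) \<le> exp (qC + qS) * \<Psi> j j"
      using B[of j] by (intro Q_upper \<sigma>_nz) auto
    have nd0: "0 < om (\<sigma> j) * norm (Q {j} (\<sigma> j))" using om_pos[of "\<sigma> j"] Q_node_nz[of j] by simp
    have "om z * norm (Q {j} z) = (om z * norm (lag j z)) * (om (\<sigma> j) * norm (Q {j} (\<sigma> j)))"
      using om_pos[of "\<sigma> j"] Q_node_nz[of j] by (simp add: lag_def norm_mult norm_divide)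
    also have "\<dots> \<le> (om z * norm (lag j z)) * (exp (qC + qS) * \<Psi> j j)" using nd om_pos[of z] by (intro mult_left_mono) auto
    also have "\<dots> \<le> (D * M * S * exp (\<epsilon> * (1 + B)) * exp (- (\<epsilon> * \<bar>real k - real j\<bar>))) * (exp (qC + qS) * \<Psi> j j)"
      using up \<Psi>_pos[of j j] by (intro mult_right_mono) auto
    finally have "L * (om z * norm (Q {j} z)) \<le> L * ((D * M * S * exp (\<epsilon> * (1 + B)) * exp (- (\<epsilon> * \<bar>real k - real j\<bar>))) * (exp (qC + qS) * \<Psi> j j))"
      by (intro mult_left_mono) (auto simp: L_def)
    also have "\<dots> = G * exp (- (\<epsilon> * \<bar>real k - real j\<bar>)) * \<Psi> j j" by (simp add: G_def mult_ac)
    finally have "\<Psi> j k \<le> G * exp (- (\<epsilon> * \<bar>real k - real j\<bar>)) * \<Psi> j j" using lo by linarith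
    then show ?thesis using \<Psi>_pos[of j j] by (simp add: pos_divide_le_eq)
  qed
  have lin: "h * (real k - real j) - 2 * h * (E k - E j) - (if j < k then 2 * h * (real k - real j) else 0) \<le> ln G - \<epsilon> * \<bar>real k - real j\<bar>" for j k
  proof -
    have "\<Psi> j k / \<Psi> j j = exp (h * (real k - real j) - 2 * h * (E k - E j) - (if j < k then 2 * h * (real k - real j) else 0))"
      by (simp add: \<Psi>_def exp_diff[symmetric] algebra_simps)
    moreover have "G * exp (- (\<epsilon> * \<bar>real k - real j\<bar>)) = exp (ln G - \<epsilon> * \<bar>real k - real j\<bar>)" using G by (simp add: exp_diff exp_minus field_simps)
    ultimately show ?thesis using main[of j k] by simp
  qed
  show thesis
  proof
    show "\<epsilon> / (2 * h) > 0" using \<epsilon> h by simp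
    fix m n :: nat assume mn: "m \<le> n"
    \<comment> \<open>An index k beyond j bounds the increment from below, an index before j from
      above.\<close>
    have 1: "- (2 * h * (E n - E m)) \<le> ln G - \<epsilon> * (real n - real m) + h * (real n - real m)"
      using lin[where j = m and k = n] mn by (cases "m < n") (auto simp: algebra_simps split: if_splits)
    have 2: "2 * h * (E n - E m) \<le> ln G - \<epsilon> * (real n - real m) + h * (real n - real m)"
      using lin[where j = n and k = m] mn by (auto simp: algebra_simps split: if_splits)
    have "2 * h * \<bar>E n - E m\<bar> \<le> ln G - \<epsilon> * (real n - real m) + h * (real n - real m)"
      using 1 2 by (simp add: abs_if algebra_simps)
    then have "\<bar>E n - E m\<bar> \<le> (ln G - \<epsilon> * (real n - real m) + h * (real n - real m)) / (2 * h)" using h by (simp add: field_simps)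
    also have "\<dots> = (1/2 - \<epsilon> / (2 * h)) * (real n - real m) + ln G / (2 * h)" using h by (simp add: field_simps)
    finally show "\<bar>E n - E m\<bar> \<le> (1/2 - \<epsilon> / (2 * h)) * (real n - real m) + ln G / (2 * h)" .
  qed
qed

end

context small_fock
begin

theorem sampling_basis_iff:
  assumes nz: "\<And>i. \<sigma> i \<noteq> 0" and mono: "\<And>i j. i \<le> j \<Longrightarrow> norm (\<sigma> i) \<le> norm (\<sigma> j)"
  shows "sampling_basis \<sigma> \<longleftrightarrow> (\<exists>B c \<eta> C. balanced \<alpha> p \<sigma> B c \<eta> C)"
proof
  assume "\<exists>B c \<eta> C. balanced \<alpha> p \<sigma> B c \<eta> C"
  then obtain B c \<eta> C where "balanced \<alpha> p \<sigma> B c \<eta> C" by blast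
  then interpret b: balanced \<alpha> p \<sigma> B c \<eta> C .
  show "sampling_basis \<sigma>" by (rule b.sampling_basis)
next
  assume sb: "sampling_basis \<sigma>"
  interpret bs: basis_sequence \<alpha> p \<sigma>
  proof
    show "pos (\<sigma> i) \<le> pos (\<sigma> j)" if "i \<le> j" for i j
      using mono[OF that] nz \<alpha> by (simp add: pos_def)
  qed (use nz sb in auto)
  obtain c where "near_regular \<alpha> p \<sigma> \<bar>bs.Ab\<bar> c" using bs.near by blast
  then interpret nr: near_regular \<alpha> p \<sigma> "\<bar>bs.Ab\<bar>" c .
  interpret nb: near_basis \<alpha> p \<sigma> "\<bar>bs.Ab\<bar>" c ..
  obtain \<eta> C where "\<eta> > 0" "\<And>m n. m \<le> n \<Longrightarrow> \<bar>nr.E n - nr.E m\<bar> \<le> (1/2 - \<eta>) * (real n - real m) + C"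
    using nb.cumulative by blast
  then have "balanced \<alpha> p \<sigma> \<bar>bs.Ab\<bar> c \<eta> C" by unfold_locales auto
  then show "\<exists>B c \<eta> C. balanced \<alpha> p \<sigma> B c \<eta> C" by blast
qed

end

section \<open>Rotation invariance of area measure\<close>

text \<open>Area measure is carried to \<open>real^2\<close>, where invariance under orthogonal
  transformations is applied.\<close>

definition vec2 :: "complex \<Rightarrow> real^2" where "vec2 z = (\<chi> i. if i = 1 then Re z else Im z)"
definition unvec2 :: "real^2 \<Rightarrow> complex" where "unvec2 v = Complex (v$1) (v$2)"

lemma vec2_inverse [simp]: "unvec2 (vec2 z) = z" "vec2 (unvec2 v) = v"
  by (auto simp: vec2_def unvec2_def vec_eq_iff complex_eq_iff forall_2)

lemma linear_vec2: "linear vec2" "linear unvec2"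
  by (auto simp: vec2_def unvec2_def linear_iff vec_eq_iff complex_eq_iff)

lemma measurable_vec2 [measurable]: "vec2 \<in> borel_measurable borel" "unvec2 \<in> borel_measurable borel"
  by (auto intro!: borel_measurable_continuous_onI linear_continuous_on linear_vec2 linear_conv_bounded_linear[THEN iffD1])

lemma prod_Basis_vec2: "(\<Prod>b\<in>Basis. (x::real^2) \<bullet> b) = x$1 * x$2"
proof -
  have "(Basis :: (real^2) set) = {axis 1 1, axis 2 1}"
    using exhaust_2 by (auto simp: Basis_vec_def) metis
  moreover have "axis 1 (1::real) \<noteq> (axis 2 1 :: real^2)" by (simp add: axis_eq_axis)
  ultimately have "(\<Prod>b\<in>Basis. x \<bullet> b) = (x \<bullet> axis 1 1) * (x \<bullet> axis 2 1)" by (metis (no_types, lifting) finite.emptyI finite.insertI insert_absorb insert_not_empty prod.empty prod.insert singletonD mult.right_neutral)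
  then show ?thesis by (simp add: inner_axis)
qed

lemma distr_vec2: "distr lborel borel vec2 = lborel"
proof (rule lborel_eqI[symmetric])
  fix l u :: "real^2"
  assume lu: "\<And>b. b \<in> Basis \<Longrightarrow> l \<bullet> b \<le> u \<bullet> b"
  have le: "l$1 \<le> u$1" "l$2 \<le> u$2"
    using lu[of "axis 1 1"] lu[of "axis 2 1"] by (auto simp: inner_axis)
  have "vec2 -` box l u = box (unvec2 l) (unvec2 u)"
    by (auto simp: mem_box_cart forall_2 vec2_def unvec2_def in_box_complex_iff)
  then have "emeasure (distr lborel borel vec2) (box l u) = emeasure lborel (box (unvec2 l) (unvec2 u))"
    by (simp add: emeasure_distr)
  also have "\<dots> = ennreal ((u$1 - l$1) * (u$2 - l$2))"
    using le by (subst emeasure_lborel_box) (auto simp: Basis_complex_def unvec2_def)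
  finally show "emeasure (distr lborel borel vec2) (box l u) = (\<Prod>b\<in>Basis. (u - l) \<bullet> b)"
    by (simp add: prod_Basis_vec2)
qed simp

text \<open>Boundedness of S gives finite measure, as the theorem on orthogonal images asks for.
  Boxes are bounded, and they determine the measure.\<close>

lemma emeasure_lborel_cmult_norm1:
  fixes w :: complex
  assumes w: "norm w = 1" and S: "S \<in> sets borel" "bounded S"
  shows "emeasure lborel ((*) w ` S) = emeasure lborel S"
proof -
  define L where "L v = vec2 (w * unvec2 v)" for v
  have linL: "linear L"
    using linear_compose[OF linear_vec2(2) linear_compose[OF _ linear_vec2(1)], of "(*) w"]
    by (simp add: L_def[abs_def] o_def bounded_linear.linear bounded_linear_mult_right)
  have nv: "norm (vec2 z) = norm z" for z
    by (simp add: vec2_def norm_vec_def L2_set_def UNIV_2 cmod_def)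
  have nu: "norm (unvec2 v) = norm v" for v using nv[of "unvec2 v"] by simp
  have orth: "orthogonal_transformation L"
    unfolding orthogonal_transformation using linL w by (simp add: L_def nv norm_mult nu)
  have em: "emeasure lborel (vec2 ` T) = emeasure lborel T" if "T \<in> sets borel" for T
  proof -
    have e: "vec2 ` T = unvec2 -` T" by (auto simp: image_iff) (metis vec2_inverse(2))
    have [measurable]: "unvec2 -` T \<in> sets borel" using that measurable_sets[OF measurable_vec2(2) that] by simp
    have "emeasure lborel (vec2 ` T) = emeasure (distr lborel borel vec2) (unvec2 -` T)" by (simp add: e distr_vec2)
    also have "\<dots> = emeasure lborel (vec2 -` (unvec2 -` T))" by (subst emeasure_distr) auto
    also have "vec2 -` (unvec2 -` T) = T" by auto
    finally show ?thesis .
  qed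
  have wnz: "w \<noteq> 0" using w by auto
  have wS: "(*) w ` S \<in> sets borel"
  proof -
    have "(*) w ` S = (\<lambda>z. z / w) -` S" using wnz by (auto simp: image_iff) (metis nonzero_mult_div_cancel_left times_divide_eq_right)
    moreover have "(\<lambda>z. z / w) \<in> borel_measurable borel" by (intro borel_measurable_divide) auto
    ultimately show ?thesis using measurable_sets[of "\<lambda>z. z/w" borel borel S] S by simp
  qed
  have vS: "vec2 ` S \<in> sets borel"
  proof -
    have e: "vec2 ` S = unvec2 -` S" by (auto simp: image_iff) (metis vec2_inverse(2))
    show ?thesis using S(1) measurable_sets[OF measurable_vec2(2) S(1)] by (simp add: e)
  qed
  have lm: "vec2 ` S \<in> lmeasurable"
  proof (rule bounded_set_imp_lmeasurable)
    show "bounded (vec2 ` S)" using S(2) by (auto simp: bounded_iff nv)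
    show "vec2 ` S \<in> sets lebesgue" using vS by simp
  qed
  have im: "vec2 ` ((*) w ` S) = L ` (vec2 ` S)" by (auto simp: L_def image_comp)
  have lm2: "L ` (vec2 ` S) \<in> lmeasurable" by (rule measurable_orthogonal_image[OF orth lm])
  have bLS: "L ` (vec2 ` S) \<in> sets borel"
  proof -
    have e: "vec2 ` ((*) w ` S) = unvec2 -` ((*) w ` S)" by (auto simp: image_iff) (metis vec2_inverse(2))
    show ?thesis unfolding im[symmetric] using wS measurable_sets[OF measurable_vec2(2) wS] by (simp add: e)
  qed
  have "emeasure lborel ((*) w ` S) = emeasure lborel (L ` (vec2 ` S))" using em[OF wS] by (simp add: im)
  also have "\<dots> = emeasure lebesgue (L ` (vec2 ` S))" using bLS by simp
  also have "\<dots> = ennreal (measure lebesgue (L ` (vec2 ` S)))" using lm2 by (simp add: emeasure_eq_measure2 fmeasurableD2)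
  also have "measure lebesgue (L ` (vec2 ` S)) = measure lebesgue (vec2 ` S)" by (rule measure_orthogonal_image[OF orth lm])
  also have "ennreal (measure lebesgue (vec2 ` S)) = emeasure lebesgue (vec2 ` S)" using lm by (simp add: emeasure_eq_measure2 fmeasurableD2)
  also have "\<dots> = emeasure lborel (vec2 ` S)" using vS by simp
  also have "\<dots> = emeasure lborel S" using em S by simp
  finally show ?thesis .
qed

lemma distr_lborel_rotation:
  fixes w :: complex
  assumes w: "norm w = 1"
  shows "distr lborel borel ((*) w) = lborel"
proof (rule lborel_eqI[symmetric])
  fix l u :: complex
  assume lu: "\<And>b. b \<in> Basis \<Longrightarrow> l \<bullet> b \<le> u \<bullet> b"
  have wnz: "w \<noteq> 0" using w by auto
  have e: "(*) w -` box l u = (*) (inverse w) ` box l u"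
    using wnz by (auto simp: image_iff field_simps)
  have "emeasure (distr lborel borel ((*) w)) (box l u) = emeasure lborel ((*) w -` box l u)"
    by (subst emeasure_distr) auto
  also have "\<dots> = emeasure lborel (box l u)"
    unfolding e using w by (intro emeasure_lborel_cmult_norm1) (auto simp: norm_inverse)
  finally show "emeasure (distr lborel borel ((*) w)) (box l u) = (\<Prod>b\<in>Basis. (u - l) \<bullet> b)"
    using lu by simp
qed simp

section \<open>Equivalence of the Fock norm and the coefficient norm\<close>

lemma emeasure_cball_complex: "r \<ge> 0 \<Longrightarrow> emeasure lborel (cball (a::complex) r) = ennreal (unit_ball_vol 2 * r\<^sup>2)"
  by (simp add: emeasure_cball)

lemma emeasure_ball_complex: "r \<ge> 0 \<Longrightarrow> emeasure lborel (ball (a::complex) r) = ennreal (unit_ball_vol 2 * r\<^sup>2)"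
  by (simp add: emeasure_ball)

text \<open>Half open, so that the annuli cut at half-integer positions are disjoint.\<close>

definition annulus :: "real \<Rightarrow> real \<Rightarrow> complex set" where
  "annulus r R = {z. r \<le> norm z \<and> norm z < R}"

lemma annulus_borel [measurable]: "annulus r R \<in> sets borel"
proof -
  have "annulus r R = ball 0 R - ball 0 r" by (auto simp: annulus_def)
  then show ?thesis by simp
qed

lemma annulus_finite: "emeasure lborel (annulus r R) < \<infinity>"
proof -
  have "emeasure lborel (annulus r R) \<le> emeasure lborel (ball (0::complex) R)"
    by (rule emeasure_mono) (auto simp: annulus_def)
  also have "\<dots> < \<infinity>"
    by (cases "R \<ge> 0") (auto simp: emeasure_ball_complex ball_empty)
  finally show ?thesis .
qed

lemma annulus_measure_ge:
  assumes "0 \<le> r" "r \<le> R"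
  shows "unit_ball_vol 2 * ((R - r) / 2)\<^sup>2 \<le> measure lborel (annulus r R)"
proof -
  have "ball (complex_of_real ((R + r) / 2)) ((R - r) / 2) \<subseteq> annulus r R"
  proof
    fix z assume z: "z \<in> ball (complex_of_real ((R + r) / 2)) ((R - r) / 2)"
    define c where "c = complex_of_real ((R + r) / 2)"
    have "norm c = (R + r) / 2" using assms by (simp add: c_def del: of_real_divide of_real_add)
    moreover have "norm (c - z) < (R - r) / 2" using z by (simp add: c_def dist_norm)
    ultimately show "z \<in> annulus r R"
      using norm_triangle_ineq2[of c z] norm_triangle_ineq2[of z c]
      by (simp add: annulus_def norm_minus_commute field_simps)
  qed
  then have "emeasure lborel (ball (complex_of_real ((R + r) / 2)) ((R - r) / 2)) \<le> emeasure lborel (annulus r R)"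
    by (intro emeasure_mono) auto
  then have "ennreal (unit_ball_vol 2 * ((R - r) / 2)\<^sup>2) \<le> ennreal (measure lborel (annulus r R))"
    using assms annulus_finite[of r R] by (subst (asm) emeasure_ball_complex) (auto simp: emeasure_eq_ennreal_measure)
  then show ?thesis by (simp add: ennreal_le_iff)
qed

text \<open>Rotation by the angle pi / (i - k) preserves the annulus and the measure but changes the
  sign of the integrand; this takes the place of polar coordinates.\<close>

lemma integral_annulus_power:
  assumes "i \<noteq> k"
  shows "(\<integral>z. indicat_real (annulus r R) z *\<^sub>R (z ^ i / z ^ k) \<partial>lborel) = 0"
proof -
  define g where "g z = indicat_real (annulus r R) z *\<^sub>R (z ^ i / z ^ k)" for z
  have [measurable]: "g \<in> borel_measurable borel" unfolding g_def by measurable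
  define \<theta> where "\<theta> = pi / (real i - real k)"
  define w where "w = cis \<theta>"
  have nw: "norm w = 1" by (simp add: w_def)
  have "w ^ i / w ^ k = cis (real i * \<theta>) / cis (real k * \<theta>)" unfolding w_def Complex.DeMoivre ..
  also have "\<dots> = cis (real i * \<theta> - real k * \<theta>)" by (rule cis_divide)
  also have "\<dots> = cis ((real i - real k) * \<theta>)" by (simp only: left_diff_distrib)
  also have "(real i - real k) * \<theta> = pi" using assms by (simp add: \<theta>_def)
  finally have ww: "w ^ i / w ^ k = - 1" by simp
  have "g (w * z) = - g z" for z
  proof -
    have "(w * z) ^ i / (w * z) ^ k = (w ^ i / w ^ k) * (z ^ i / z ^ k)" by (simp add: power_mult_distrib)
    then have "(w * z) ^ i / (w * z) ^ k = - (z ^ i / z ^ k)" by (simp add: ww)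
    moreover have "w * z \<in> annulus r R \<longleftrightarrow> z \<in> annulus r R" by (simp add: annulus_def norm_mult nw)
    ultimately show ?thesis by (simp add: g_def indicator_def)
  qed
  then have "(\<integral>z. g (w * z) \<partial>lborel) = - (\<integral>z. g z \<partial>lborel)" by simp
  moreover have "(\<integral>z. g (w * z) \<partial>lborel) = (\<integral>z. g z \<partial>distr lborel borel ((*) w))"
    by (subst integral_distr) auto
  ultimately have "(\<integral>z. g z \<partial>lborel) = - (\<integral>z. g z \<partial>lborel)" by (simp add: distr_lborel_rotation[OF nw])
  then have "(\<integral>z. g z \<partial>lborel) = 0" by simp
  then show ?thesis by (simp only: g_def)
qed

text \<open>Averaging over an annulus instead of a circle expresses a coefficient by an area
  integral, which can be compared with the Fock norm. Only the term with index k survives;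
  convergence of the power series at a larger radius justifies termwise integration.\<close>

lemma annulus_mean_coef:
  assumes f: "f holomorphic_on UNIV" and r: "0 < r"
  shows "(\<integral>z. indicat_real (annulus r R) z *\<^sub>R (f z / z ^ k) \<partial>lborel) = of_real (measure lborel (annulus r R)) * coef f k"
proof -
  define F where "F i z = indicat_real (annulus r R) z *\<^sub>R (coef f i * (z ^ i / z ^ k))" for i z
  have bd: "norm (F i z) \<le> norm (coef f i) * \<bar>R\<bar> ^ i / r ^ k * indicat_real (annulus r R) z" for i z
  proof (cases "z \<in> annulus r R")
    case True
    then have z: "r \<le> norm z" "norm z \<le> \<bar>R\<bar>" by (auto simp: annulus_def)
    have "norm z ^ i / norm z ^ k \<le> \<bar>R\<bar> ^ i / r ^ k"
      using z r by (intro frac_le power_mono) auto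
    then have "norm (coef f i) * (norm z ^ i / norm z ^ k) \<le> norm (coef f i) * (\<bar>R\<bar> ^ i / r ^ k)" by (intro mult_left_mono) auto
    then show ?thesis using True by (simp add: F_def norm_mult norm_divide norm_power)
  qed (simp add: F_def)
  have intI: "integrable lborel (indicat_real (annulus r R))"
    using annulus_finite[of r R] by (intro integrable_real_indicator) auto
  have [measurable]: "F i \<in> borel_measurable borel" for i unfolding F_def by measurable
  have intF: "integrable lborel (F i)" for i
  proof (rule Bochner_Integration.integrable_bound)
    show "integrable lborel (\<lambda>z. norm (coef f i) * \<bar>R\<bar> ^ i / r ^ k * indicat_real (annulus r R) z)"
      by (intro integrable_mult_right intI)
    show "AE z in lborel. norm (F i z) \<le> norm (norm (coef f i) * \<bar>R\<bar> ^ i / r ^ k * indicat_real (annulus r R) z)"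
      by (intro AE_I2) (metis bd abs_ge_self order_trans real_norm_def)
  qed simp
  have sm: "summable (\<lambda>i. norm (coef f i) * \<bar>R\<bar> ^ i / r ^ k)"
  proof (rule summable_divide)
    have "summable (\<lambda>i. coef f i * (of_real (\<bar>R\<bar> + 1)) ^ i)" using coef_sums[OF f] sums_summable by blast
    then have "summable (\<lambda>i. norm (coef f i * (of_real \<bar>R\<bar>) ^ i))"
      by (rule powser_insidea) simp
    then show "summable (\<lambda>i. norm (coef f i) * \<bar>R\<bar> ^ i)" by (simp add: norm_mult norm_power)
  qed
  have Fs: "(\<lambda>i. F i z) sums (indicat_real (annulus r R) z *\<^sub>R (f z / z ^ k))" for z
  proof -
    have "(\<lambda>i. indicat_real (annulus r R) z *\<^sub>R (coef f i * z ^ i / z ^ k)) sums (indicat_real (annulus r R) z *\<^sub>R (f z / z ^ k))"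
      by (intro sums_scaleR_right sums_divide coef_sums f)
    then show ?thesis by (simp add: F_def)
  qed
  have "(\<integral>z. indicat_real (annulus r R) z *\<^sub>R (f z / z ^ k) \<partial>lborel) = (\<integral>z. (\<Sum>i. F i z) \<partial>lborel)"
    using Fs by (simp add: sums_iff)
  also have "\<dots> = (\<Sum>i. \<integral>z. F i z \<partial>lborel)"
  proof (rule integral_suminf[OF intF])
    show "AE z in lborel. summable (\<lambda>i. norm (F i z))"
    proof (intro AE_I2)
      fix z
      have "summable (\<lambda>i. norm (coef f i) * \<bar>R\<bar> ^ i / r ^ k * indicat_real (annulus r R) z)" by (intro summable_mult2 sm)
      then show "summable (\<lambda>i. norm (F i z))" by (rule summable_comparison_test'[of _ 0]) (use bd in auto)
    qed
    have "summable (\<lambda>i. norm (coef f i) * \<bar>R\<bar> ^ i / r ^ k * measure lborel (annulus r R))" by (intro summable_mult2 sm)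
    then show "summable (\<lambda>i. \<integral>z. norm (F i z) \<partial>lborel)"
    proof (rule summable_comparison_test'[of _ 0])
      fix i
      have "(\<integral>z. norm (F i z) \<partial>lborel) \<le> (\<integral>z. norm (coef f i) * \<bar>R\<bar> ^ i / r ^ k * indicat_real (annulus r R) z \<partial>lborel)"
        by (intro integral_mono integrable_norm intF integrable_mult_right intI bd)
      also have "\<dots> = norm (coef f i) * \<bar>R\<bar> ^ i / r ^ k * measure lborel (annulus r R)" by simp
      finally show "norm (\<integral>z. norm (F i z) \<partial>lborel) \<le> norm (coef f i) * \<bar>R\<bar> ^ i / r ^ k * measure lborel (annulus r R)" by simp
    qed
  qed
  also have "\<dots> = (\<Sum>i\<in>{k}. \<integral>z. F i z \<partial>lborel)"
  proof (rule suminf_finite)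
    fix i assume "i \<notin> {k}"
    then have "(\<integral>z. coef f i * (indicat_real (annulus r R) z *\<^sub>R (z ^ i / z ^ k)) \<partial>lborel) = 0"
      using integral_annulus_power[of i k r R] by (subst integral_mult_right_zero) simp
    then show "(\<integral>z. F i z \<partial>lborel) = 0" by (simp only: F_def mult_scaleR_right)
  qed simp
  also have "\<dots> = (\<integral>z. F k z \<partial>lborel)" by simp
  also have "\<dots> = (\<integral>z. indicat_real (annulus r R) z *\<^sub>R coef f k \<partial>lborel)"
    using r by (intro Bochner_Integration.integral_cong) (auto simp: F_def indicator_def annulus_def)
  also have "\<dots> = of_real (measure lborel (annulus r R)) * coef f k"
    by (simp add: scaleR_conv_of_real)
  finally show ?thesis .
qed

lemma coef_annulus_le:
  assumes f: "f holomorphic_on UNIV" and r: "0 < r" "r < R" and p: "p \<ge> 1"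
  shows "ennreal (measure lborel (annulus r R) * norm (coef f k) powr p)
     \<le> (\<integral>\<^sup>+z. ennreal (indicat_real (annulus r R) z * (norm (f z) / norm z ^ k) powr p) \<partial>lborel)"
proof -
  define a where "a = measure lborel (annulus r R)"
  have "0 < unit_ball_vol 2 * ((R - r) / 2)\<^sup>2" using r by (intro mult_pos_pos unit_ball_vol_pos) auto
  also have "\<dots> \<le> a" unfolding a_def using r by (intro annulus_measure_ge) auto
  finally have a: "a > 0" .
  have [measurable]: "f \<in> borel_measurable borel"
    using f by (intro borel_measurable_continuous_onI holomorphic_on_imp_continuous_on)
  have "norm (coef f k) * a = norm (\<integral>z. indicat_real (annulus r R) z *\<^sub>R (f z / z ^ k) \<partial>lborel)"
    unfolding annulus_mean_coef[OF f r(1)] using a by (simp add: norm_mult a_def)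
  \<comment> \<open>Without integrability the Bochner integral is 0 and the bound is
    trivial.\<close>
  then have "ennreal (norm (coef f k) * a) \<le> (\<integral>\<^sup>+z. ennreal (norm (indicat_real (annulus r R) z *\<^sub>R (f z / z ^ k))) \<partial>lborel)"
    using integral_norm_bound_ennreal[of lborel "\<lambda>z. indicat_real (annulus r R) z *\<^sub>R (f z / z ^ k)"]
      not_integrable_integral_eq[of lborel "\<lambda>z. indicat_real (annulus r R) z *\<^sub>R (f z / z ^ k)"]
    by (cases "integrable lborel (\<lambda>z. indicat_real (annulus r R) z *\<^sub>R (f z / z ^ k))") auto
  also have "\<dots> = (\<integral>\<^sup>+z. ennreal (indicat_real (annulus r R) z * (norm (f z) / norm z ^ k)) \<partial>lborel)"
    by (intro nn_integral_cong) (simp add: norm_divide norm_power)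
  finally have 1: "ennreal (norm (coef f k) * a) \<le> (\<integral>\<^sup>+z. ennreal (indicat_real (annulus r R) z * (norm (f z) / norm z ^ k)) \<partial>lborel)" .
  have "ennreal ((norm (coef f k) * a) powr p) \<le> ennreal (a powr (p - 1)) * (\<integral>\<^sup>+z. ennreal (indicat_real (annulus r R) z * (norm (f z) / norm z ^ k) powr p) \<partial>lborel)"
  proof (rule nn_integral_jensen_powr[OF _ _ _ _ p a _ _ 1])
    have "(\<integral>\<^sup>+z. ennreal (indicat_real (annulus r R) z) \<partial>lborel) = emeasure lborel (annulus r R)"
      by (subst ennreal_indicator) simp
    then show "(\<integral>\<^sup>+z. ennreal (indicat_real (annulus r R) z) \<partial>lborel) \<le> ennreal a"
      using annulus_finite[of r R] by (simp add: a_def emeasure_eq_ennreal_measure)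
  qed (use a in auto)
  then have "ennreal (a powr (1 - p)) * ennreal ((norm (coef f k) * a) powr p)
    \<le> ennreal (a powr (1 - p)) * (ennreal (a powr (p - 1)) * (\<integral>\<^sup>+z. ennreal (indicat_real (annulus r R) z * (norm (f z) / norm z ^ k) powr p) \<partial>lborel))"
    by (intro mult_left_mono) auto
  also have "\<dots> = (\<integral>\<^sup>+z. ennreal (indicat_real (annulus r R) z * (norm (f z) / norm z ^ k) powr p) \<partial>lborel)"
    using a by (simp add: mult.assoc[symmetric] ennreal_mult[symmetric] powr_add[symmetric])
  also have "ennreal (a powr (1 - p)) * ennreal ((norm (coef f k) * a) powr p) = ennreal (a * norm (coef f k) powr p)"
    using a by (simp add: ennreal_mult[symmetric] powr_mult powr_diff)
  finally show ?thesis by (simp add: a_def)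
qed

section \<open>The weight compared with \<open>om\<close>, and the coefficient norm bounded by the
  Fock norm\<close>

context small_fock
begin

abbreviation \<phi> :: "complex \<Rightarrow> real" where "\<phi> \<equiv> log_weight \<alpha>"

lemma om_powr:
  assumes "z \<noteq> 0"
  shows "om z powr p = (norm z)\<^sup>2 * exp (- (p * \<alpha> * (ln (norm z))\<^sup>2))"
proof -
  define t where "t = ln (norm z)"
  have z: "norm z = exp t" using assms by (simp add: t_def)
  have e: "h * (2 / p)\<^sup>2 - h * (pos z)\<^sup>2 = 2 / p * t - \<alpha> * t\<^sup>2"
  proof -
    have "h * (2 / p)\<^sup>2 - h * (pos z)\<^sup>2 = h * (2 / p + pos z) * (2 / p - pos z)" by (simp add: power2_eq_square algebra_simps)
    also have "\<dots> = h * (2 * \<alpha> * t) * (4 / p - 2 * \<alpha> * t)" by (simp add: pos_def t_def)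
    also have "\<dots> = 2 / p * t - \<alpha> * t\<^sup>2" using \<alpha> p by (simp add: h_def power2_eq_square field_simps)
    finally show ?thesis .
  qed
  have "om z powr p = exp (p * (2 / p * t - \<alpha> * t\<^sup>2))" unfolding om_def e powr_def by simp
  also have "p * (2 / p * t - \<alpha> * t\<^sup>2) = 2 * t + - (p * \<alpha> * t\<^sup>2)" using p by (simp add: field_simps)
  also have "exp \<dots> = (exp t)\<^sup>2 * exp (- (p * \<alpha> * t\<^sup>2))" by (simp only: exp_add exp_double)
  finally show ?thesis by (simp add: z)
qed

lemma phi_le: "\<phi> z \<le> \<alpha> * (ln (norm z))\<^sup>2" and phi_nonneg: "\<phi> z \<ge> 0"
  using \<alpha> by (auto simp: log_weight_def log_plus_def max_def intro!: mult_left_mono)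

lemma om_powr_le: "z \<noteq> 0 \<Longrightarrow> om z powr p \<le> (norm z)\<^sup>2 * exp (- (p * \<phi> z))"
  unfolding om_powr using phi_le[of z] p by (intro mult_left_mono) auto

text \<open>Inside the unit disc the weight is flat while \<open>om\<close> carries a Gaussian in ln
  |z|. The converse of \<open>om_powr_le\<close> is therefore stated away from 0, with a constant
  depending on r.\<close>

lemma om_powr_ge:
  assumes r: "0 < r" "r \<le> 1" "r \<le> norm z"
  shows "(norm z)\<^sup>2 * exp (- (p * \<phi> z)) \<le> exp (p * \<alpha> * (ln r)\<^sup>2) * om z powr p"
proof -
  have znz: "z \<noteq> 0" using r by auto
  have "\<alpha> * (ln (norm z))\<^sup>2 \<le> \<phi> z + \<alpha> * (ln r)\<^sup>2"
  proof (cases "norm z \<ge> 1")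
    case True
    then show ?thesis using \<alpha> by (simp add: log_weight_def log_plus_def)
  next
    case False
    have "ln r \<le> ln (norm z)" "ln (norm z) \<le> 0" using r False znz by auto
    then have "(ln (norm z))\<^sup>2 \<le> (ln r)\<^sup>2" by (simp add: abs_le_square_iff[symmetric])
    then have "\<alpha> * (ln (norm z))\<^sup>2 \<le> \<alpha> * (ln r)\<^sup>2" using \<alpha> by (intro mult_left_mono) auto
    then show ?thesis using phi_nonneg[of z] by linarith
  qed
  then have "p * (\<alpha> * (ln (norm z))\<^sup>2) \<le> p * (\<phi> z + \<alpha> * (ln r)\<^sup>2)" using p by (intro mult_left_mono) auto
  then have "exp (- (p * \<phi> z)) \<le> exp (p * \<alpha> * (ln r)\<^sup>2) * exp (- (p * \<alpha> * (ln (norm z))\<^sup>2))"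
    by (simp add: exp_add[symmetric] algebra_simps)
  then have "(norm z)\<^sup>2 * exp (- (p * \<phi> z)) \<le> (norm z)\<^sup>2 * (exp (p * \<alpha> * (ln r)\<^sup>2) * exp (- (p * \<alpha> * (ln (norm z))\<^sup>2)))"
    by (intro mult_left_mono) auto
  then show ?thesis unfolding om_powr[OF znz] by (simp add: mult_ac)
qed

lemma fock_integrand:
  fixes f :: "complex \<Rightarrow> complex"
  shows "norm (f z * of_real (exp (- \<phi> z))) powr p = norm (f z) powr p * exp (- (p * \<phi> z))"
  by (simp add: norm_mult powr_mult exp_powr_real mult.commute)

lemma measurable_phi [measurable]: "\<phi> \<in> borel_measurable borel"
  unfolding log_weight_def[abs_def] log_plus_def by measurable

text \<open>The denominator comes from the area of a disc inscribed in the annulus, relative to the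
  outer radius; exp(p h / 4) is the Gaussian loss within half a unit of position from k.\<close>

definition fockC :: real where
  "fockC = 4 * exp (4 * h) * exp (p * h / 4) / (unit_ball_vol 2 * (1 - exp (- (2 * h)))\<^sup>2)"

text \<open>Each coefficient is estimated on the annulus where its monomial peaks. The annuli are
  disjoint, so the estimates add up to one integral over the plane.\<close>

lemma nrm_le_fock:
  assumes f: "f holomorphic_on UNIV"
  shows "nrm f \<le> ennreal fockC * fock_norm_pow p \<phi> f"
proof -
  have [measurable]: "f \<in> borel_measurable borel"
    using f by (intro borel_measurable_continuous_onI holomorphic_on_imp_continuous_on)
  define V where "V = unit_ball_vol (2::real)"
  have V: "V > 0" by (simp add: V_def)
  define A where "A k = annulus (circ (real k - 1/2)) (circ (real k + 1/2))" for k
  define W where "W z = norm (f z) powr p * exp (- (p * \<phi> z))" for z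
  have [measurable]: "W \<in> borel_measurable borel" unfolding W_def by measurable
  have W0: "W z \<ge> 0" for z by (simp add: W_def)
  have one: "ennreal (norm (bc f k) powr p) \<le> ennreal fockC * (\<integral>\<^sup>+z. ennreal (indicat_real (A k) z * W z) \<partial>lborel)" for k
  proof -
    define R where "R = circ (real k + 1/2)"
    define r where "r = circ (real k - 1/2)"
    have R: "R > 0" "r > 0" by (simp_all add: R_def r_def circ_pos)
    have rR: "r = exp (- (2 * h)) * R" by (simp add: r_def R_def circ_eq exp_add[symmetric] algebra_simps)
    have rltR: "r < R" unfolding rR using h R by simp
    define a where "a = measure lborel (annulus r R)"
    have age: "V * (1 - exp (- (2 * h)))\<^sup>2 / 4 * R\<^sup>2 \<le> a"
    proof -
      have "V * ((R - r) / 2)\<^sup>2 \<le> a" unfolding a_def V_def using R rltR by (intro annulus_measure_ge) auto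
      then show ?thesis unfolding rR by (simp add: power2_eq_square algebra_simps)
    qed
    define q where "q = V * (1 - exp (- (2 * h)))\<^sup>2 / 4 * R\<^sup>2"
    have q: "q > 0" using V h R by (simp add: q_def)
    have "ennreal (a * norm (coef f k) powr p) \<le> (\<integral>\<^sup>+z. ennreal (indicat_real (A k) z * (norm (f z) / norm z ^ k) powr p) \<partial>lborel)"
      using coef_annulus_le[OF f R(2) rltR p] by (simp add: a_def A_def r_def R_def)
    then have "ennreal (q * norm (coef f k) powr p) \<le> (\<integral>\<^sup>+z. ennreal (indicat_real (A k) z * (norm (f z) / norm z ^ k) powr p) \<partial>lborel)"
      using age by (elim order_trans[rotated]) (intro ennreal_leI mult_right_mono, auto simp: q_def)
    then have "ennreal (wt k powr p / q) * ennreal (q * norm (coef f k) powr p)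
       \<le> ennreal (wt k powr p / q) * (\<integral>\<^sup>+z. ennreal (indicat_real (A k) z * (norm (f z) / norm z ^ k) powr p) \<partial>lborel)"
      by (intro mult_left_mono) auto
    also have "\<dots> = (\<integral>\<^sup>+z. ennreal (wt k powr p / q) * ennreal (indicat_real (A k) z * (norm (f z) / norm z ^ k) powr p) \<partial>lborel)"
      unfolding A_def by (intro nn_integral_cmult[symmetric]) measurable
    also have "\<dots> \<le> (\<integral>\<^sup>+z. ennreal fockC * ennreal (indicat_real (A k) z * W z) \<partial>lborel)"
    proof (rule nn_integral_mono)
      fix z
      show "ennreal (wt k powr p / q) * ennreal (indicat_real (A k) z * (norm (f z) / norm z ^ k) powr p) \<le> ennreal fockC * ennreal (indicat_real (A k) z * W z)"
      proof (cases "z \<in> A k")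
        case True
        then have zz: "r \<le> norm z" "norm z < R" by (auto simp: A_def annulus_def r_def R_def)
        then have znz: "z \<noteq> 0" using R by auto
        have "circ (real k - 1/2) \<le> circ (pos z)" "circ (pos z) < circ (real k + 1/2)" using zz norm_circ[OF znz] by (auto simp: r_def R_def)
        then have "real k - 1/2 \<le> pos z" "pos z \<le> real k + 1/2" using h unfolding circ_eq by auto
        then have "\<bar>pos z - real k\<bar> \<le> 1/2" by linarith
        then have "(pos z - real k)\<^sup>2 \<le> (1/2)\<^sup>2" by (simp add: abs_le_square_iff[symmetric])
        then have hp: "p * (h * (pos z - real k)\<^sup>2) \<le> p * (h * (1/4))" using h p by (intro mult_left_mono) (auto simp: power2_eq_square)
        have "wt k powr p * (norm (f z) / norm z ^ k) powr p = (om z * exp (h * (pos z - real k)\<^sup>2) * norm (f z)) powr p"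
        proof -
          have w: "wt k = om z * norm z ^ k * exp (h * (pos z - real k)\<^sup>2)"
            unfolding om_mult_power[OF znz] by (simp add: exp_minus field_simps)
          have "wt k * (norm (f z) / norm z ^ k) = om z * exp (h * (pos z - real k)\<^sup>2) * norm (f z)"
            unfolding w using znz by simp
          then show ?thesis using wt_pos[of k] by (simp add: powr_mult[symmetric])
        qed
        also have "\<dots> = om z powr p * exp (p * (h * (pos z - real k)\<^sup>2)) * norm (f z) powr p"
          using om_pos[of z] by (simp add: powr_mult exp_powr_real mult.commute)
        also have "\<dots> \<le> ((norm z)\<^sup>2 * exp (- (p * \<phi> z))) * exp (p * h / 4) * norm (f z) powr p"
          using om_powr_le[OF znz] hp by (intro mult_right_mono mult_mono) auto
        also have "\<dots> = (norm z)\<^sup>2 * (exp (p * h / 4) * W z)" by (simp add: W_def)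
        also have "\<dots> \<le> R\<^sup>2 * (exp (p * h / 4) * W z)" using zz W0[of z] by (intro mult_right_mono power_mono) auto
        finally have "wt k powr p / q * (norm (f z) / norm z ^ k) powr p \<le> R\<^sup>2 * (exp (p * h / 4) * W z) / q"
          using q by (simp add: divide_right_mono)
        also have "\<dots> = 4 * exp (p * h / 4) / (V * (1 - exp (- (2 * h)))\<^sup>2) * W z" using R V by (simp add: q_def field_simps)
        also have "\<dots> \<le> fockC * W z"
        proof (intro mult_right_mono W0)
          have "4 * exp (p * h / 4) \<le> 4 * exp (4 * h) * exp (p * h / 4)" using h by simp
          then show "4 * exp (p * h / 4) / (V * (1 - exp (- (2 * h)))\<^sup>2) \<le> fockC"
            unfolding fockC_def V_def[symmetric] using V by (intro divide_right_mono) auto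
        qed
        finally show ?thesis using True W0[of z] V q by (simp add: ennreal_mult[symmetric] ennreal_leI fockC_def V_def)
      qed simp
    qed
    also have "\<dots> = ennreal fockC * (\<integral>\<^sup>+z. ennreal (indicat_real (A k) z * W z) \<partial>lborel)"
      unfolding A_def by (intro nn_integral_cmult) measurable
    finally have "ennreal (wt k powr p / q) * ennreal (q * norm (coef f k) powr p) \<le> ennreal fockC * (\<integral>\<^sup>+z. ennreal (indicat_real (A k) z * W z) \<partial>lborel)" .
    moreover have "ennreal (wt k powr p / q) * ennreal (q * norm (coef f k) powr p) = ennreal (norm (bc f k) powr p)"
      using q wt_pos[of k] by (simp add: ennreal_mult[symmetric] bc_def norm_mult powr_mult)
    ultimately show ?thesis by simp
  qed
  have "nrm f \<le> (\<Sum>k. ennreal fockC * (\<integral>\<^sup>+z. ennreal (indicat_real (A k) z * W z) \<partial>lborel))"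
    unfolding nrm_def by (intro suminf_mono_ennreal one)
  also have "\<dots> = ennreal fockC * (\<Sum>k. \<integral>\<^sup>+z. ennreal (indicat_real (A k) z * W z) \<partial>lborel)" by (rule ennreal_suminf_cmult)
  also have "(\<Sum>k. \<integral>\<^sup>+z. ennreal (indicat_real (A k) z * W z) \<partial>lborel) = (\<integral>\<^sup>+z. (\<Sum>k. ennreal (indicat_real (A k) z * W z)) \<partial>lborel)"
    unfolding A_def by (intro nn_integral_suminf[symmetric]) measurable
  also have "\<dots> \<le> (\<integral>\<^sup>+z. ennreal (W z) \<partial>lborel)"
  proof (rule nn_integral_mono)
    fix z
    show "(\<Sum>k. ennreal (indicat_real (A k) z * W z)) \<le> ennreal (W z)"
    proof (cases "\<exists>k. z \<in> A k")
      case True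
      then obtain k where k: "z \<in> A k" by blast
      have "k' = k" if "z \<in> A k'" for k'
      proof -
        have "circ (real k - 1/2) < circ (real k' + 1/2)" "circ (real k' - 1/2) < circ (real k + 1/2)"
          using k that by (auto simp: A_def annulus_def)
        then have "real k - 1/2 < real k' + 1/2" "real k' - 1/2 < real k + 1/2" using h unfolding circ_eq by auto
        then show ?thesis by linarith
      qed
      then have "(\<Sum>i. ennreal (indicat_real (A i) z * W z)) = (\<Sum>i\<in>{k}. ennreal (indicat_real (A i) z * W z))"
        by (intro suminf_finite) (auto simp: indicator_def)
      then show ?thesis using k by simp
    next
      case False
      then show ?thesis by simp
    qed
  qed
  also have "(\<integral>\<^sup>+z. ennreal (W z) \<partial>lborel) = fock_norm_pow p \<phi> f" unfolding fock_norm_pow_def fock_integrand W_def ..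
  finally show ?thesis by (simp add: mult_left_mono)
qed

section \<open>The Fock norm bounded by the coefficient norm\<close>

lemma cball_borel [measurable]: "cball (a::complex) r \<in> sets borel"
  by simp

text \<open>Bounds the contribution of coefficient k on ring i: the Gaussian is replaced by an
  exponential, and the factor 1 / |z|^2, left over from \<open>om\<close>, by its value at the inner
  radius. The shift by 2 is there because positions can be as low as -2 outside the unit
  disc.\<close>

definition ringw :: "nat \<Rightarrow> nat \<Rightarrow> real" where
  "ringw k i = exp (1 / (4 * h) + 1) * exp (- \<bar>real k + 2 - real i\<bar>) / (circ (real i - 2))\<^sup>2"

text \<open>The plane is covered by the unit disc and by discs of radius \<open>circ (i - 1)\<close>, which contain the rings \<open>i - 2 \<le> pos z \<le> i - 1\<close>.\<close>

definition fock_kernel :: "nat \<Rightarrow> complex \<Rightarrow> ennreal" where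
  "fock_kernel k z = indicator (cball 0 1) z + (\<Sum>i. ennreal (ringw k i) * indicator (cball 0 (circ (real i - 1))) z)"

definition kernC :: real where
  "kernC = unit_ball_vol 2 + exp (1 / (4 * h) + 1) * unit_ball_vol 2 * exp (4 * h) * (2 * exp 1 / (1 - exp (- 1)))"

text \<open>The area of each disc cancels the squared inner radius in \<open>ringw\<close> up to a
  factor independent of i, so a geometric series in |k + 2 - i| remains.\<close>

lemma fock_kernel_integral: "(\<integral>\<^sup>+z. fock_kernel k z \<partial>lborel) \<le> ennreal kernC"
proof -
  define V where "V = unit_ball_vol (2::real)"
  have V: "V > 0" by (simp add: V_def)
  have "(\<integral>\<^sup>+z. fock_kernel k z \<partial>lborel) = (\<integral>\<^sup>+z. indicator (cball (0::complex) 1) z \<partial>lborel) + (\<integral>\<^sup>+z. (\<Sum>i. ennreal (ringw k i) * indicator (cball (0::complex) (circ (real i - 1))) z) \<partial>lborel)"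
    unfolding fock_kernel_def by (rule nn_integral_add) measurable
  also have "(\<integral>\<^sup>+z. (\<Sum>i. ennreal (ringw k i) * indicator (cball (0::complex) (circ (real i - 1))) z) \<partial>lborel)
     = (\<Sum>i. \<integral>\<^sup>+z. ennreal (ringw k i) * indicator (cball (0::complex) (circ (real i - 1))) z \<partial>lborel)"
    by (rule nn_integral_suminf) measurable
  also have "\<dots> = (\<Sum>i. ennreal (exp (1 / (4 * h) + 1) * V * exp (4 * h)) * ennreal (exp (- (1 * \<bar>real k + 2 - real i\<bar>))))"
  proof (rule suminf_cong)
    fix i
    have "(\<integral>\<^sup>+z. ennreal (ringw k i) * indicator (cball (0::complex) (circ (real i - 1))) z \<partial>lborel)
      = ennreal (ringw k i) * emeasure lborel (cball (0::complex) (circ (real i - 1)))"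
      by (rule nn_integral_cmult_indicator) simp
    also have "\<dots> = ennreal (ringw k i) * ennreal (V * (circ (real i - 1))\<^sup>2)"
      using circ_pos[of "real i - 1"] by (simp add: emeasure_cball_complex V_def)
    also have "\<dots> = ennreal (ringw k i * (V * (circ (real i - 1))\<^sup>2))"
      using V by (subst ennreal_mult[symmetric]) (auto simp: ringw_def)
    also have "ringw k i * (V * (circ (real i - 1))\<^sup>2) = exp (1 / (4 * h) + 1) * V * exp (4 * h) * exp (- (1 * \<bar>real k + 2 - real i\<bar>))"
    proof -
      have "(circ (real i - 1))\<^sup>2 = exp (4 * h) * (circ (real i - 2))\<^sup>2"
        by (simp add: circ_eq exp_double[symmetric] exp_add[symmetric] algebra_simps)
      then show ?thesis using circ_pos[of "real i - 2"] by (simp add: ringw_def field_simps)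
    qed
    finally show "(\<integral>\<^sup>+z. ennreal (ringw k i) * indicator (cball (0::complex) (circ (real i - 1))) z \<partial>lborel)
      = ennreal (exp (1 / (4 * h) + 1) * V * exp (4 * h)) * ennreal (exp (- (1 * \<bar>real k + 2 - real i\<bar>)))"
      using V by (subst ennreal_mult[symmetric]) auto
  qed
  also have "\<dots> = ennreal (exp (1 / (4 * h) + 1) * V * exp (4 * h)) * (\<Sum>i. ennreal (exp (- (1 * \<bar>real k + 2 - real i\<bar>))))"
    by (rule ennreal_suminf_cmult)
  also have "(\<integral>\<^sup>+z. indicator (cball (0::complex) 1) z \<partial>lborel) = ennreal V" by (simp add: emeasure_cball_complex V_def)
  finally have "(\<integral>\<^sup>+z. fock_kernel k z \<partial>lborel) = ennreal V + ennreal (exp (1 / (4 * h) + 1) * V * exp (4 * h)) * (\<Sum>i. ennreal (exp (- (1 * \<bar>real k + 2 - real i\<bar>))))" .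
  also have "\<dots> \<le> ennreal V + ennreal (exp (1 / (4 * h) + 1) * V * exp (4 * h)) * ennreal (2 * exp 1 / (1 - exp (- 1)))"
    by (intro add_left_mono mult_left_mono suminf_exp_dist_real) auto
  also have "\<dots> = ennreal kernC"
  proof -
    have "0 \<le> (2 * exp 1 / (1 - exp (- 1 :: real)))" by simp
    then show ?thesis using V unfolding kernC_def V_def[symmetric]
      by (subst ennreal_mult[symmetric]) (auto simp: ennreal_plus[symmetric] simp del: ennreal_plus)
  qed
  finally show ?thesis .
qed

lemma fock_pointwise:
  assumes f: "f holomorphic_on UNIV"
  shows "ennreal (norm (f z) powr p * exp (- (p * \<phi> z))) \<le> ennreal (gsum powr (p - 1)) * (\<Sum>k. ennreal (norm (bc f k) powr p) * fock_kernel k z)"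
proof (cases "norm z \<le> 1")
  case True
  have "ennreal (norm (f z)) \<le> (\<Sum>k. ennreal (norm (coef f k * z ^ k)))" by (rule norm_suminf_le_ennreal[OF coef_sums[OF f]])
  \<comment> \<open>-2 / p is the position of the unit circle, where the Gaussian equals 1 / wt k;
    inside the disc powers of z are only smaller.\<close>
  also have "\<dots> \<le> (\<Sum>k. ennreal (exp (- (h * (- (2 / p) - real k)\<^sup>2)) * norm (bc f k)))"
  proof (intro suminf_mono_ennreal ennreal_leI)
    fix k
    have "(- (2 / p) - real k)\<^sup>2 = (real k + 2 / p)\<^sup>2" by (simp add: power2_eq_square algebra_simps)
    then have e: "exp (- (h * (- (2 / p) - real k)\<^sup>2)) = 1 / wt k" by (simp add: wt_def exp_minus field_simps)
    have "norm (coef f k * z ^ k) \<le> norm (coef f k) * 1" unfolding norm_mult norm_power using True by (intro mult_left_mono power_le_one) auto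
    also have "\<dots> = 1 / wt k * norm (bc f k)" using wt_pos[of k] by (simp add: bc_def norm_mult)
    finally show "norm (coef f k * z ^ k) \<le> exp (- (h * (- (2 / p) - real k)\<^sup>2)) * norm (bc f k)" unfolding e .
  qed
  finally have "ennreal (norm (f z) powr p) \<le> ennreal (gsum powr (p - 1)) * (\<Sum>k. ennreal (exp (- (h * (- (2 / p) - real k)\<^sup>2)) * norm (bc f k) powr p))"
    by (intro suminf_jensen_powr p gsum) auto
  also have "\<dots> \<le> ennreal (gsum powr (p - 1)) * (\<Sum>k. ennreal (norm (bc f k) powr p) * fock_kernel k z)"
  proof (intro mult_left_mono suminf_mono_ennreal)
    fix k
    have "exp (- (h * (- (2 / p) - real k)\<^sup>2)) * norm (bc f k) powr p \<le> 1 * norm (bc f k) powr p"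
      using h by (intro mult_right_mono) auto
    then have "ennreal (exp (- (h * (- (2 / p) - real k)\<^sup>2)) * norm (bc f k) powr p) \<le> ennreal (norm (bc f k) powr p) * 1"
      by (simp add: ennreal_leI)
    also have "\<dots> \<le> ennreal (norm (bc f k) powr p) * fock_kernel k z"
    proof (intro mult_left_mono)
      have "(indicator (cball 0 1) z :: ennreal) = 1" using True by (simp add: indicator_def)
      then show "1 \<le> fock_kernel k z" by (simp add: fock_kernel_def)
    qed simp
    finally show "ennreal (exp (- (h * (- (2 / p) - real k)\<^sup>2)) * norm (bc f k) powr p) \<le> ennreal (norm (bc f k) powr p) * fock_kernel k z" .
  qed simp
  finally have "ennreal (norm (f z) powr p) \<le> ennreal (gsum powr (p - 1)) * (\<Sum>k. ennreal (norm (bc f k) powr p) * fock_kernel k z)" .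
  moreover have "\<phi> z = 0"
    using True by (cases "z = 0") (auto simp: log_weight_def log_plus_def max_def)
  ultimately show ?thesis by simp
next
  case False
  then have z: "norm z > 1" "z \<noteq> 0" by auto
  have "ennreal ((om z * norm (f z)) powr p) \<le> ennreal (gsum powr (p - 1)) * (\<Sum>k. ennreal (exp (- (h * (pos z - real k)\<^sup>2)) * norm (bc f k) powr p))"
    by (rule suminf_jensen_powr[OF _ _ p gsum(1) _ gsum(2) eval_le[OF f z(2)]]) (use om_pos[of z] in auto)
  then have "ennreal (1 / (norm z)\<^sup>2) * ennreal ((om z * norm (f z)) powr p) \<le> ennreal (1 / (norm z)\<^sup>2) * (ennreal (gsum powr (p - 1)) * (\<Sum>k. ennreal (exp (- (h * (pos z - real k)\<^sup>2)) * norm (bc f k) powr p)))"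
    by (intro mult_left_mono) auto
  also have "\<dots> = ennreal (gsum powr (p - 1)) * (\<Sum>k. ennreal (1 / (norm z)\<^sup>2) * ennreal (exp (- (h * (pos z - real k)\<^sup>2)) * norm (bc f k) powr p))"
    by (subst ennreal_suminf_cmult) (simp add: mult.left_commute)
  also have "\<dots> \<le> ennreal (gsum powr (p - 1)) * (\<Sum>k. ennreal (norm (bc f k) powr p) * fock_kernel k z)"
  proof (intro mult_left_mono suminf_mono_ennreal)
    fix k
    \<comment> \<open>The ring containing z; adding 2 makes it a natural number for all positions
      from -2 on.\<close>
    define i where "i = nat (\<lfloor>pos z\<rfloor> + 2)"
    have "pos z \<ge> - 2"
    proof -
      have "0 \<le> 2 * \<alpha> * ln (norm z)" using z \<alpha> by simp
      moreover have "2 / p \<le> 2" using p by (simp add: field_simps)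
      ultimately show ?thesis unfolding pos_def by linarith
    qed
    then have i: "real i - 2 \<le> pos z" "pos z \<le> real i - 1" unfolding i_def by linarith+
    have nz1: "circ (real i - 2) \<le> norm z" "norm z \<le> circ (real i - 1)" unfolding norm_circ[OF z(2)] using i by (auto intro: circ_le)
    have "exp (- (h * (pos z - real k)\<^sup>2)) \<le> exp (1 / (4 * h)) * exp (- \<bar>pos z - real k\<bar>)"
      using gaussian_le_exp[OF h, of "pos z - real k" 1] by simp
    also have "\<dots> \<le> exp (1 / (4 * h)) * exp (1 - \<bar>real k + 2 - real i\<bar>)"
      using i by (intro mult_left_mono) auto
    also have "\<dots> = exp (1 / (4 * h) + 1) * exp (- \<bar>real k + 2 - real i\<bar>)" by (simp add: exp_add[symmetric])
    finally have "1 / (norm z)\<^sup>2 * exp (- (h * (pos z - real k)\<^sup>2)) \<le> 1 / (circ (real i - 2))\<^sup>2 * (exp (1 / (4 * h) + 1) * exp (- \<bar>real k + 2 - real i\<bar>))"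
      using nz1 circ_pos[of "real i - 2"] z by (intro mult_mono divide_left_mono power_mono mult_pos_pos zero_less_power) auto
    then have le: "1 / (norm z)\<^sup>2 * exp (- (h * (pos z - real k)\<^sup>2)) \<le> ringw k i" by (simp add: ringw_def)
    have "ennreal (1 / (norm z)\<^sup>2) * ennreal (exp (- (h * (pos z - real k)\<^sup>2)) * norm (bc f k) powr p)
       = ennreal (norm (bc f k) powr p * (1 / (norm z)\<^sup>2 * exp (- (h * (pos z - real k)\<^sup>2))))"
      by (simp add: ennreal_mult[symmetric] mult_ac)
    also have "\<dots> \<le> ennreal (norm (bc f k) powr p * ringw k i)" using le by (intro ennreal_leI mult_left_mono) auto
    also have "\<dots> = ennreal (norm (bc f k) powr p) * (ennreal (ringw k i) * indicator (cball 0 (circ (real i - 1))) z)"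
      by (subst ennreal_mult) (use nz1 in \<open>auto simp: indicator_def ringw_def\<close>)
    also have "\<dots> \<le> ennreal (norm (bc f k) powr p) * fock_kernel k z"
    proof (intro mult_left_mono)
      have "ennreal (ringw k i) * indicator (cball 0 (circ (real i - 1))) z \<le> (\<Sum>i. ennreal (ringw k i) * indicator (cball 0 (circ (real i - 1))) z)"
        by (rule le_suminf_ennreal)
      also have "\<dots> \<le> fock_kernel k z" by (simp add: fock_kernel_def)
      finally show "ennreal (ringw k i) * indicator (cball 0 (circ (real i - 1))) z \<le> fock_kernel k z" .
    qed simp
    finally show "ennreal (1 / (norm z)\<^sup>2) * ennreal (exp (- (h * (pos z - real k)\<^sup>2)) * norm (bc f k) powr p) \<le> ennreal (norm (bc f k) powr p) * fock_kernel k z" .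
  qed simp
  also have "ennreal (1 / (norm z)\<^sup>2) * ennreal ((om z * norm (f z)) powr p) = ennreal (norm (f z) powr p * exp (- (p * \<phi> z)))"
  proof -
    have "\<phi> z = \<alpha> * (ln (norm z))\<^sup>2" using z by (simp add: log_weight_def log_plus_def)
    then have "(om z * norm (f z)) powr p = (norm z)\<^sup>2 * (norm (f z) powr p * exp (- (p * \<phi> z)))"
      using om_pos[of z] om_powr[OF z(2)] by (simp add: powr_mult mult_ac)
    then show ?thesis using z by (simp add: ennreal_mult[symmetric])
  qed
  finally show ?thesis .
qed

lemma fock_le_nrm:
  assumes f: "f holomorphic_on UNIV"
  shows "fock_norm_pow p \<phi> f \<le> ennreal (gsum powr (p - 1) * kernC) * nrm f"
proof -
  have [measurable]: "fock_kernel k \<in> borel_measurable borel" for k unfolding fock_kernel_def by measurable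
  have "fock_norm_pow p \<phi> f \<le> (\<integral>\<^sup>+z. ennreal (gsum powr (p - 1)) * (\<Sum>k. ennreal (norm (bc f k) powr p) * fock_kernel k z) \<partial>lborel)"
    unfolding fock_norm_pow_def fock_integrand by (intro nn_integral_mono fock_pointwise f)
  also have "\<dots> = ennreal (gsum powr (p - 1)) * (\<integral>\<^sup>+z. (\<Sum>k. ennreal (norm (bc f k) powr p) * fock_kernel k z) \<partial>lborel)"
    by (intro nn_integral_cmult) measurable
  also have "(\<integral>\<^sup>+z. (\<Sum>k. ennreal (norm (bc f k) powr p) * fock_kernel k z) \<partial>lborel) = (\<Sum>k. \<integral>\<^sup>+z. ennreal (norm (bc f k) powr p) * fock_kernel k z \<partial>lborel)"
    by (intro nn_integral_suminf) measurable
  also have "\<dots> = (\<Sum>k. ennreal (norm (bc f k) powr p) * (\<integral>\<^sup>+z. fock_kernel k z \<partial>lborel))"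
    by (intro suminf_cong nn_integral_cmult) measurable
  finally have "fock_norm_pow p \<phi> f \<le> ennreal (gsum powr (p - 1)) * (\<Sum>k. ennreal (norm (bc f k) powr p) * (\<integral>\<^sup>+z. fock_kernel k z \<partial>lborel))" .
  also have "\<dots> \<le> ennreal (gsum powr (p - 1)) * (\<Sum>k. ennreal (norm (bc f k) powr p) * ennreal kernC)"
    by (intro mult_left_mono suminf_mono_ennreal fock_kernel_integral) auto
  also have "\<dots> = ennreal (gsum powr (p - 1)) * (nrm f * ennreal kernC)" unfolding nrm_def by (subst ennreal_suminf_multc) simp
  also have "\<dots> = ennreal (gsum powr (p - 1) * kernC) * nrm f"
    by (subst ennreal_mult) (auto simp: mult_ac kernC_def)
  finally show ?thesis .
qed

lemma fockC_nonneg: "fockC \<ge> 0" by (simp add: fockC_def)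
lemma kernC_nonneg: "kernC \<ge> 0" by (simp add: kernC_def)

lemma fock_space_eq: "fock_space p \<phi> = {f. f holomorphic_on UNIV \<and> nrm f < \<infinity>}"
proof -
  have "fock_norm_pow p \<phi> f < \<infinity> \<longleftrightarrow> nrm f < \<infinity>" if f: "f holomorphic_on UNIV" for f
    using nrm_le_fock[OF f] fock_le_nrm[OF f]
    by (metis ennreal_mult_less_top ennreal_less_top infinity_ennreal_def le_less_trans)
  then show ?thesis unfolding fock_space_def by blast
qed

end

section \<open>Complete interpolating sets\<close>

text \<open>Every family in \<open>ennreal\<close> is summable, so the unordered sum is the series
  along an injective enumeration.\<close>

lemma seq_norm_range:
  assumes "inj \<sigma>"
  shows "seq_norm_pow p \<phi> (range \<sigma>) v = (\<Sum>i::nat. ennreal ((1 + norm (\<sigma> i))\<^sup>2 * norm (v (\<sigma> i)) powr p * exp (- (p * \<phi> (\<sigma> i)))))"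
proof -
  define g where "g s = ennreal ((1 + norm s)\<^sup>2 * norm (v s) powr p * exp (- (p * \<phi> s)))" for s
  have "seq_norm_pow p \<phi> (range \<sigma>) v = infsum (g \<circ> \<sigma>) UNIV"
    unfolding seq_norm_pow_def g_def[symmetric] by (rule infsum_reindex) (use assms in auto)
  also have "\<dots> = (\<Sum>i. (g \<circ> \<sigma>) i)"
  proof -
    have "((g \<circ> \<sigma>) has_sum infsum (g \<circ> \<sigma>) UNIV) UNIV"
      by (rule has_sum_infsum) (rule nonneg_summable_on_complete, simp)
    then have "(g \<circ> \<sigma>) sums infsum (g \<circ> \<sigma>) UNIV" by (rule has_sum_imp_sums)
    then show ?thesis by (simp add: sums_iff o_def)
  qed
  finally show ?thesis by (simp add: g_def o_def)
qed

lemma seq_norm_insert: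
  assumes "x \<notin> S"
  shows "seq_norm_pow p \<phi> (insert x S) v = ennreal ((1 + norm x)\<^sup>2 * norm (v x) powr p * exp (- (p * \<phi> x))) + seq_norm_pow p \<phi> S v"
  unfolding seq_norm_pow_def
  by (rule infsum_insert) (use assms in \<open>auto intro: nonneg_summable_on_complete\<close>)

lemma seq_norm_cong: "(\<And>s. s \<in> S \<Longrightarrow> v s = w s) \<Longrightarrow> seq_norm_pow p \<phi> S v = seq_norm_pow p \<phi> S w"
  unfolding seq_norm_pow_def by (rule infsum_cong) simp

text \<open>Comparison up to an unspecified constant. Sampling consists of two such comparisons, and
  transitivity replaces the bookkeeping of constants when norms are exchanged for equivalent
  ones.\<close>

definition dominates :: "'a set \<Rightarrow> ('a \<Rightarrow> ennreal) \<Rightarrow> ('a \<Rightarrow> ennreal) \<Rightarrow> bool" where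
  "dominates X P R \<longleftrightarrow> (\<exists>C::real. C \<ge> 0 \<and> (\<forall>f\<in>X. P f \<le> ennreal C * R f))"

lemma dominatesI: "C \<ge> 0 \<Longrightarrow> (\<And>f. f \<in> X \<Longrightarrow> P f \<le> ennreal C * R f) \<Longrightarrow> dominates X P R"
  unfolding dominates_def by blast

lemma dominates_le: "(\<And>f. f \<in> X \<Longrightarrow> P f \<le> R f) \<Longrightarrow> dominates X P R"
  by (rule dominatesI[of 1]) auto

lemma dominates_trans:
  assumes "dominates X P R" "dominates X R S" shows "dominates X P S"
proof -
  obtain C D where C: "C \<ge> 0" "\<And>f. f \<in> X \<Longrightarrow> P f \<le> ennreal C * R f" and D: "D \<ge> 0" "\<And>f. f \<in> X \<Longrightarrow> R f \<le> ennreal D * S f"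
    using assms unfolding dominates_def by blast
  show ?thesis
  proof (rule dominatesI[of "C * D"])
    fix f assume f: "f \<in> X"
    have "P f \<le> ennreal C * (ennreal D * S f)" using C(2)[OF f] D(2)[OF f] by (meson mult_left_mono order_trans zero_le)
    then show "P f \<le> ennreal (C * D) * S f" using C(1) D(1) by (simp add: ennreal_mult mult.assoc)
  qed (use C D in simp)
qed

lemma dominates_add:
  assumes "dominates X P S" "dominates X R S" shows "dominates X (\<lambda>f. P f + R f) S"
proof -
  obtain C D where C: "C \<ge> 0" "\<And>f. f \<in> X \<Longrightarrow> P f \<le> ennreal C * S f" and D: "D \<ge> 0" "\<And>f. f \<in> X \<Longrightarrow> R f \<le> ennreal D * S f"
    using assms unfolding dominates_def by blast
  show ?thesis
  proof (rule dominatesI[of "C + D"])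
    fix f assume f: "f \<in> X"
    have "P f + R f \<le> ennreal C * S f + ennreal D * S f" using C(2)[OF f] D(2)[OF f] by (rule add_mono)
    then show "P f + R f \<le> ennreal (C + D) * S f" using C(1) D(1) by (simp add: ennreal_plus distrib_right)
  qed (use C D in simp)
qed

lemma dominates_cmult:
  assumes "dominates X P S" "c \<ge> 0" shows "dominates X (\<lambda>f. ennreal c * P f) S"
  by (rule dominates_trans[OF _ assms(1)], rule dominatesI[of c]) (use assms in auto)

lemma sampling_iff_dominates:
  "sampling p \<phi> S \<longleftrightarrow> dominates (fock_space p \<phi>) (fock_norm_pow p \<phi>) (seq_norm_pow p \<phi> S)
     \<and> dominates (fock_space p \<phi>) (seq_norm_pow p \<phi> S) (fock_norm_pow p \<phi>)"
proof
  assume "sampling p \<phi> S"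
  then obtain C where C: "C \<ge> 1" and lo: "\<And>f. f \<in> fock_space p \<phi> \<Longrightarrow> ennreal (1 / C) * fock_norm_pow p \<phi> f \<le> seq_norm_pow p \<phi> S f"
    and up: "\<And>f. f \<in> fock_space p \<phi> \<Longrightarrow> seq_norm_pow p \<phi> S f \<le> ennreal C * fock_norm_pow p \<phi> f"
    unfolding sampling_def by blast
  have "fock_norm_pow p \<phi> f \<le> ennreal C * seq_norm_pow p \<phi> S f" if f: "f \<in> fock_space p \<phi>" for f
  proof -
    have "ennreal C * (ennreal (1 / C) * fock_norm_pow p \<phi> f) \<le> ennreal C * seq_norm_pow p \<phi> S f" using lo[OF f] by (intro mult_left_mono) auto
    then show ?thesis using C by (simp add: mult.assoc[symmetric] ennreal_mult[symmetric])
  qed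
  then show "dominates (fock_space p \<phi>) (fock_norm_pow p \<phi>) (seq_norm_pow p \<phi> S) \<and> dominates (fock_space p \<phi>) (seq_norm_pow p \<phi> S) (fock_norm_pow p \<phi>)"
    using up C by (auto intro!: dominatesI[of C])
next
  assume "dominates (fock_space p \<phi>) (fock_norm_pow p \<phi>) (seq_norm_pow p \<phi> S) \<and> dominates (fock_space p \<phi>) (seq_norm_pow p \<phi> S) (fock_norm_pow p \<phi>)"
  then obtain C D where C: "C \<ge> 0" "\<And>f. f \<in> fock_space p \<phi> \<Longrightarrow> fock_norm_pow p \<phi> f \<le> ennreal C * seq_norm_pow p \<phi> S f"
    and D: "D \<ge> 0" "\<And>f. f \<in> fock_space p \<phi> \<Longrightarrow> seq_norm_pow p \<phi> S f \<le> ennreal D * fock_norm_pow p \<phi> f"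
    unfolding dominates_def by blast
  define K where "K = max 1 (max C D)"
  have K: "K \<ge> 1" "K \<ge> C" "K \<ge> D" by (auto simp: K_def)
  show "sampling p \<phi> S" unfolding sampling_def
  proof (intro exI[of _ K] conjI ballI)
    fix f assume f: "f \<in> fock_space p \<phi>"
    have "ennreal (1 / K) * fock_norm_pow p \<phi> f \<le> ennreal (1 / K) * (ennreal K * seq_norm_pow p \<phi> S f)"
      using K by (intro mult_left_mono order_trans[OF C(2)[OF f]] mult_right_mono ennreal_leI) auto
    also have "\<dots> = seq_norm_pow p \<phi> S f" using K by (simp add: mult.assoc[symmetric] ennreal_mult[symmetric])
    finally show "ennreal (1 / K) * fock_norm_pow p \<phi> f \<le> seq_norm_pow p \<phi> S f" .
    show "seq_norm_pow p \<phi> S f \<le> ennreal K * fock_norm_pow p \<phi> f"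
      using K by (intro order_trans[OF D(2)[OF f]] mult_right_mono ennreal_leI) auto
  qed (rule K)
qed

section \<open>From sets of nodes to sequences\<close>

context small_fock
begin

abbreviation "X \<equiv> fock_space p \<phi>"

lemma X_iff: "f \<in> X \<longleftrightarrow> f holomorphic_on UNIV \<and> nrm f < \<infinity>"
  by (simp add: fock_space_eq)

lemma dominates_fock: "dominates X (fock_norm_pow p \<phi>) nrm" "dominates X nrm (fock_norm_pow p \<phi>)"
proof -
  show "dominates X (fock_norm_pow p \<phi>) nrm"
    by (rule dominatesI[of "gsum powr (p - 1) * kernC"]) (auto simp: kernC_nonneg X_iff fock_le_nrm)
  show "dominates X nrm (fock_norm_pow p \<phi>)"
    by (rule dominatesI[OF fockC_nonneg]) (simp add: X_iff nrm_le_fock)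
qed

lemma sampling_iff: "sampling p \<phi> S \<longleftrightarrow> dominates X nrm (seq_norm_pow p \<phi> S) \<and> dominates X (seq_norm_pow p \<phi> S) nrm"
  unfolding sampling_iff_dominates using dominates_fock dominates_trans by blast

lemma seq_term_le:
  assumes r: "0 < r" "r \<le> 1" "r \<le> norm s" and x: "x \<ge> 0"
  shows "(1 + norm s)\<^sup>2 * x powr p * exp (- (p * \<phi> s)) \<le> (1 + 1 / r)\<^sup>2 * exp (p * \<alpha> * (ln r)\<^sup>2) * (om s * x) powr p"
proof -
  have "1 \<le> 1 / r * norm s" using r by (simp add: field_simps)
  then have "1 + norm s \<le> (1 + 1 / r) * norm s" by (simp add: distrib_right)
  then have "(1 + norm s)\<^sup>2 \<le> ((1 + 1 / r) * norm s)\<^sup>2" by (intro power_mono) auto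
  then have "(1 + norm s)\<^sup>2 * (x powr p * exp (- (p * \<phi> s))) \<le> ((1 + 1 / r) * norm s)\<^sup>2 * (x powr p * exp (- (p * \<phi> s)))"
    by (intro mult_right_mono) auto
  also have "\<dots> = (1 + 1 / r)\<^sup>2 * x powr p * ((norm s)\<^sup>2 * exp (- (p * \<phi> s)))" by (simp add: power_mult_distrib)
  also have "\<dots> \<le> (1 + 1 / r)\<^sup>2 * x powr p * (exp (p * \<alpha> * (ln r)\<^sup>2) * om s powr p)"
    by (intro mult_left_mono om_powr_ge[OF r]) auto
  also have "\<dots> = (1 + 1 / r)\<^sup>2 * exp (p * \<alpha> * (ln r)\<^sup>2) * (om s * x) powr p"
    using x om_pos[of s] by (simp add: powr_mult)
  finally show ?thesis by (simp add: mult.assoc)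
qed

lemma seq_term_ge:
  assumes s: "s \<noteq> 0" and x: "x \<ge> 0"
  shows "(om s * x) powr p \<le> (1 + norm s)\<^sup>2 * x powr p * exp (- (p * \<phi> s))"
proof -
  have "(om s * x) powr p = om s powr p * x powr p" using x om_pos[of s] by (simp add: powr_mult)
  also have "\<dots> \<le> ((norm s)\<^sup>2 * exp (- (p * \<phi> s))) * x powr p" by (intro mult_right_mono om_powr_le s) auto
  also have "\<dots> \<le> ((1 + norm s)\<^sup>2 * exp (- (p * \<phi> s))) * x powr p" by (intro mult_right_mono power_mono) auto
  finally show ?thesis by (simp add: mult_ac)
qed

text \<open>The lower bound r on the moduli makes (1 + |s|)^2 comparable to |s|^2 and the weight
  comparable to \<open>om\<close>, so both sampled norms agree up to constants.\<close>

lemma complete_interpolating_range: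
  assumes inj: "inj \<sigma>" and r: "0 < r" "r \<le> 1" "\<And>i. r \<le> norm (\<sigma> i)"
  shows "complete_interpolating p \<phi> (range \<sigma>) \<longleftrightarrow> sampling_basis \<sigma>"
proof -
  define K where "K = (1 + 1 / r)\<^sup>2 * exp (p * \<alpha> * (ln r)\<^sup>2)"
  have K: "K \<ge> 0" by (simp add: K_def)
  have nz: "\<sigma> i \<noteq> 0" for i using r(1) r(3)[of i] by auto
  have le: "seq_norm_pow p \<phi> (range \<sigma>) v \<le> ennreal K * tn \<sigma> v" for v
  proof -
    have "seq_norm_pow p \<phi> (range \<sigma>) v \<le> (\<Sum>i. ennreal K * ennreal ((om (\<sigma> i) * norm (v (\<sigma> i))) powr p))"
      unfolding seq_norm_range[OF inj]
    proof (rule suminf_mono_ennreal)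
      fix i
      have "(1 + norm (\<sigma> i))\<^sup>2 * norm (v (\<sigma> i)) powr p * exp (- (p * \<phi> (\<sigma> i))) \<le> K * (om (\<sigma> i) * norm (v (\<sigma> i))) powr p"
        unfolding K_def by (rule seq_term_le[OF r(1,2) r(3)]) simp
      then show "ennreal ((1 + norm (\<sigma> i))\<^sup>2 * norm (v (\<sigma> i)) powr p * exp (- (p * \<phi> (\<sigma> i)))) \<le> ennreal K * ennreal ((om (\<sigma> i) * norm (v (\<sigma> i))) powr p)"
        using K by (simp add: ennreal_mult[symmetric] ennreal_leI)
    qed
    then show ?thesis by (simp add: tn_def)
  qed
  have ge: "tn \<sigma> v \<le> seq_norm_pow p \<phi> (range \<sigma>) v" for v
    unfolding seq_norm_range[OF inj] tn_def by (intro suminf_mono_ennreal ennreal_leI seq_term_ge nz) simp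
  have d: "dominates X (seq_norm_pow p \<phi> (range \<sigma>)) (tn \<sigma>)" "dominates X (tn \<sigma>) (seq_norm_pow p \<phi> (range \<sigma>))"
    using K le ge by (auto intro: dominatesI dominates_le)
  have "sampling p \<phi> (range \<sigma>) \<longleftrightarrow> dominates X nrm (tn \<sigma>) \<and> dominates X (tn \<sigma>) nrm"
    unfolding sampling_iff using d dominates_trans by blast
  also have "\<dots> \<longleftrightarrow> (\<exists>C>0. \<forall>f. f holomorphic_on UNIV \<longrightarrow> nrm f < \<infinity> \<longrightarrow> nrm f \<le> ennreal C * tn \<sigma> f \<and> tn \<sigma> f \<le> ennreal C * nrm f)"
  proof
    assume "dominates X nrm (tn \<sigma>) \<and> dominates X (tn \<sigma>) nrm"
    then obtain C D where C: "C \<ge> 0" "\<And>f. f \<in> X \<Longrightarrow> nrm f \<le> ennreal C * tn \<sigma> f" and D: "D \<ge> 0" "\<And>f. f \<in> X \<Longrightarrow> tn \<sigma> f \<le> ennreal D * nrm f"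
      unfolding dominates_def by blast
    show "\<exists>C>0. \<forall>f. f holomorphic_on UNIV \<longrightarrow> nrm f < \<infinity> \<longrightarrow> nrm f \<le> ennreal C * tn \<sigma> f \<and> tn \<sigma> f \<le> ennreal C * nrm f"
    proof (intro exI[of _ "C + D + 1"] conjI allI impI)
      fix f assume "f holomorphic_on UNIV" "nrm f < \<infinity>"
      then have f: "f \<in> X" by (simp add: X_iff)
      show "nrm f \<le> ennreal (C + D + 1) * tn \<sigma> f"
        using C D by (intro order_trans[OF C(2)[OF f]] mult_right_mono ennreal_leI) auto
      show "tn \<sigma> f \<le> ennreal (C + D + 1) * nrm f"
        using C D by (intro order_trans[OF D(2)[OF f]] mult_right_mono ennreal_leI) auto
    qed (use C D in simp)
  next
    assume "\<exists>C>0. \<forall>f. f holomorphic_on UNIV \<longrightarrow> nrm f < \<infinity> \<longrightarrow> nrm f \<le> ennreal C * tn \<sigma> f \<and> tn \<sigma> f \<le> ennreal C * nrm f"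
    then obtain C where C: "C > 0" "\<And>f. f \<in> X \<Longrightarrow> nrm f \<le> ennreal C * tn \<sigma> f \<and> tn \<sigma> f \<le> ennreal C * nrm f"
      unfolding X_iff by blast
    then show "dominates X nrm (tn \<sigma>) \<and> dominates X (tn \<sigma>) nrm" by (auto intro!: dominatesI[of C])
  qed
  finally have samp: "sampling p \<phi> (range \<sigma>) \<longleftrightarrow> (\<exists>C>0. \<forall>f. f holomorphic_on UNIV \<longrightarrow> nrm f < \<infinity> \<longrightarrow> nrm f \<le> ennreal C * tn \<sigma> f \<and> tn \<sigma> f \<le> ennreal C * nrm f)" .
  have interp: "interpolating p \<phi> (range \<sigma>) \<longleftrightarrow> (\<forall>v. (\<Sum>i. ennreal (norm (v i) powr p)) < \<infinity> \<longrightarrow>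
        (\<exists>f. f holomorphic_on UNIV \<and> nrm f < \<infinity> \<and> (\<forall>i. of_real (om (\<sigma> i)) * f (\<sigma> i) = v i)))"
  proof (intro iffI allI impI)
    fix v :: "nat \<Rightarrow> complex"
    assume i: "interpolating p \<phi> (range \<sigma>)" and v: "(\<Sum>i. ennreal (norm (v i) powr p)) < \<infinity>"
    define w where "w s = v (inv \<sigma> s) / of_real (om s)" for s
    have w: "of_real (om (\<sigma> i)) * w (\<sigma> i) = v i" for i using om_pos[of "\<sigma> i"] inj by (simp add: w_def)
    have "om (\<sigma> i) * norm (w (\<sigma> i)) = norm (v i)" for i unfolding w[symmetric] using om_pos[of "\<sigma> i"] by (simp add: norm_mult)
    then have "tn \<sigma> w < \<infinity>" using v by (simp add: tn_def)
    then have "seq_norm_pow p \<phi> (range \<sigma>) w < \<infinity>"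
      using le[of w] by (metis ennreal_mult_less_top ennreal_less_top infinity_ennreal_def le_less_trans)
    then obtain f where "f \<in> X" "\<And>s. s \<in> range \<sigma> \<Longrightarrow> f s = w s" using i unfolding interpolating_def by blast
    then show "\<exists>f. f holomorphic_on UNIV \<and> nrm f < \<infinity> \<and> (\<forall>i. of_real (om (\<sigma> i)) * f (\<sigma> i) = v i)"
      using w by (auto simp: X_iff)
  next
    assume a: "\<forall>v. (\<Sum>i. ennreal (norm (v i) powr p)) < \<infinity> \<longrightarrow> (\<exists>f. f holomorphic_on UNIV \<and> nrm f < \<infinity> \<and> (\<forall>i. of_real (om (\<sigma> i)) * f (\<sigma> i) = v i))"
    show "interpolating p \<phi> (range \<sigma>)" unfolding interpolating_def
    proof (intro allI impI)
      fix v :: "complex \<Rightarrow> complex" assume v: "seq_norm_pow p \<phi> (range \<sigma>) v < \<infinity>"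
      define u where "u i = of_real (om (\<sigma> i)) * v (\<sigma> i)" for i
      have "norm (u i) = om (\<sigma> i) * norm (v (\<sigma> i))" for i using om_pos[of "\<sigma> i"] by (simp add: u_def norm_mult)
      then have "(\<Sum>i. ennreal (norm (u i) powr p)) < \<infinity>" using le_less_trans[OF ge v] by (simp add: tn_def)
      then obtain f where f: "f holomorphic_on UNIV" "nrm f < \<infinity>" "\<And>i. of_real (om (\<sigma> i)) * f (\<sigma> i) = u i" using a by blast
      have "f (\<sigma> i) = v (\<sigma> i)" for i using f(3)[of i] om_pos[of "\<sigma> i"] by (simp add: u_def)
      then show "\<exists>f\<in>X. \<forall>s\<in>range \<sigma>. f s = v s" using f(1,2) by (intro bexI[of _ f]) (auto simp: X_iff)
    qed
  qed
  show ?thesis unfolding complete_interpolating_def sampling_basis_def samp interp ..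
qed

section \<open>Moving one node\<close>

lemma eval_dominates: "dominates X (\<lambda>f. ennreal (norm (f y) powr p)) nrm"
proof (rule dominatesI[of "1 + (gsum / om y) powr p"])
  show "0 \<le> 1 + (gsum / om y) powr p" by (simp add: add_nonneg_nonneg)
  fix f assume "f \<in> X"
  then have f: "f holomorphic_on UNIV" "nrm f < \<infinity>" by (auto simp: X_iff)
  obtain r where r: "nrm f = ennreal r" "r \<ge> 0" using ennreal_finite_ex[OF less_imp_neq[OF f(2)]] by blast
  have b: "norm (bc f k) \<le> r powr (1 / p)" for k using r by (intro bc_le_of_nrm_le) auto
  have rr: "(r powr (1 / p)) powr p = r" using p r by (simp add: powr_powr)
  have "norm (f y) powr p \<le> (1 + (gsum / om y) powr p) * r"
  \<comment> \<open>At 0 the values of \<open>pos\<close> and \<open>om\<close> carry no meaning,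
    but f 0 is the constant coefficient.\<close>
  proof (cases "y = 0")
    case True
    have "f 0 = coef f 0" by (simp add: coef_deriv)
    then have "norm (f y) \<le> norm (bc f 0)"
    proof -
      have "1 \<le> wt 0" using h by (simp add: wt_def)
      then have "1 * norm (coef f 0) \<le> wt 0 * norm (coef f 0)" by (intro mult_right_mono) auto
      then show ?thesis using True \<open>f 0 = coef f 0\<close> wt_pos[of 0] by (simp add: bc_def norm_mult)
    qed
    also have "\<dots> \<le> r powr (1 / p)" by (rule b)
    finally have "norm (f y) powr p \<le> (r powr (1 / p)) powr p" using p by (intro powr_mono2) auto
    also have "\<dots> \<le> (1 + (gsum / om y) powr p) * r" unfolding rr using r by (simp add: distrib_right)
    finally show ?thesis .
  next
    case False
    have "om y * norm (f y) \<le> r powr (1 / p) * gsum" by (rule eval_bounded[OF f(1) False b])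
    then have "norm (f y) \<le> gsum / om y * r powr (1 / p)" using om_pos[of y] by (simp add: field_simps)
    then have "norm (f y) powr p \<le> (gsum / om y * r powr (1 / p)) powr p" using p by (intro powr_mono2) auto
    also have "\<dots> = (gsum / om y) powr p * r" using gsum(1) om_pos[of y] by (subst powr_mult) (simp add: rr)
    also have "\<dots> \<le> (1 + (gsum / om y) powr p) * r" using r by (intro mult_right_mono) auto
    finally show ?thesis .
  qed
  then show "ennreal (norm (f y) powr p) \<le> ennreal (1 + (gsum / om y) powr p) * nrm f"
    unfolding r(1) using r(2) by (subst ennreal_mult[symmetric]) (auto intro: ennreal_leI add_nonneg_nonneg)
qed

text \<open>The function g that is 1 at x and 0 on S does not vanish at y: otherwise its zero could
  be moved from y to x, giving a nonzero function that vanishes on \<open>insert x S\<close>.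
  Multiples of g then transfer data between x and y.\<close>

lemma move_point:
  assumes x: "x \<notin> S" and y: "y \<notin> S" and ci: "complete_interpolating p \<phi> (insert x S)"
  shows "complete_interpolating p \<phi> (insert y S)"
proof (cases "x = y")
  case True
  then show ?thesis using ci by simp
next
  case xy: False
  let ?sq = "seq_norm_pow p \<phi>"
  define w where "w s = (1 + norm s)\<^sup>2 * exp (- (p * \<phi> s))" for s
  have w0: "w s > 0" for s
  proof -
    have "0 < 1 + norm s" using norm_ge_zero[of s] by linarith
    then show ?thesis by (simp add: w_def)
  qed
  have ins: "?sq (insert s S) v = ennreal (w s) * ennreal (norm (v s) powr p) + ?sq S v" if "s \<notin> S" for s v
    unfolding seq_norm_insert[OF that] using w0[of s] by (simp add: w_def ennreal_mult[symmetric] mult_ac)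
  have s1: "dominates X nrm (?sq (insert x S))" and s2: "dominates X (?sq (insert x S)) nrm" and int: "interpolating p \<phi> (insert x S)"
    using ci unfolding complete_interpolating_def sampling_iff by auto
  have "?sq (insert x S) (\<lambda>s. if s = x then 1 else 0) = ennreal (w x) * ennreal 1 + ?sq S (\<lambda>s. 0)"
    unfolding ins[OF x] using x by (subst seq_norm_cong[of S _ "\<lambda>s. 0"]) auto
  also have "?sq S (\<lambda>s. 0) = 0" by (simp add: seq_norm_pow_def)
  finally have "?sq (insert x S) (\<lambda>s. if s = x then 1 else 0) < \<infinity>" by (simp add: less_top[symmetric])
  then obtain g where gX: "g \<in> X" and gs: "\<And>s. s \<in> insert x S \<Longrightarrow> g s = (if s = x then 1 else 0)"
    using int unfolding interpolating_def by blast
  have g: "g holomorphic_on UNIV" "nrm g < \<infinity>" "g x = 1" "\<And>s. s \<in> S \<Longrightarrow> g s = 0" using gX gs x by (auto simp: X_iff)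
  have gy: "g y \<noteq> 0"
  proof
    assume gy: "g y = 0"
    define u where "u z = (if z = y then deriv g y else (g z - g y) / (z - y))" for z
    have u: "u holomorphic_on UNIV" unfolding u_def by (rule pole_lemma_open) (use g in auto)
    have gu: "g z = (z - y) * u z" for z using gy by (simp add: u_def)
    define k where "k z = (z - x) * u z" for z
    have k: "k holomorphic_on UNIV" unfolding k_def by (intro holomorphic_intros u)
    have "nrm k < \<infinity>" by (rule nrm_swap_zero[OF g(1,2) k, of y x]) (simp add: k_def gu)
    then have kX: "k \<in> X" using k by (simp add: X_iff)
    have "k s = 0" if "s \<in> insert x S" for s
    proof (cases "s = x")
      case False
      then have "g s = 0" "s \<noteq> y" using that g(4) y by auto
      then show ?thesis using gu[of s] by (simp add: k_def)
    qed (simp add: k_def)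
    then have "?sq (insert x S) k = ?sq (insert x S) (\<lambda>_. 0)" by (intro seq_norm_cong) auto
    then have "?sq (insert x S) k = 0" by (simp add: seq_norm_pow_def)
    then have "nrm k = 0" using s1 kX unfolding dominates_def by fastforce
    then have k0: "k z = 0" for z by (rule nrm_eq_zero[OF k])
    have "(z - x) * g z = 0" for z using k0[of z] by (auto simp: k_def gu)
    then have "g x = 0" by (rule entire_zero_of_mult[OF g(1)])
    then show False using g(3) by simp
  qed
  \<comment> \<open>The part of f that vanishes at x and keeps its samples on S; it is controlled by
    S alone.\<close>
  define e where "e f = (\<lambda>z. 1 * f z + (- f x) * g z)" for f
  have e: "e f \<in> X" if "f \<in> X" for f
  proof -
    have f: "f holomorphic_on UNIV" "nrm f < \<infinity>" using that by (auto simp: X_iff)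
    have "nrm (e f) \<le> ennreal (2 powr p) * (ennreal (norm (1::complex) powr p) * nrm f + ennreal (norm (- f x) powr p) * nrm g)"
      unfolding e_def by (rule nrm_linear[OF f(1) g(1)])
    also have "\<dots> < \<infinity>" using f g by (simp add: ennreal_mult_less_top)
    finally show ?thesis using f g by (auto simp: X_iff e_def intro!: holomorphic_intros)
  qed
  have sqe: "?sq (insert x S) (e f) = ?sq S f" for f
  proof -
    have "?sq S (e f) = ?sq S f" by (rule seq_norm_cong) (simp add: e_def g)
    moreover have "e f x = 0" by (simp add: e_def g)
    ultimately show ?thesis unfolding ins[OF x] using p by simp
  qed
  have up: "dominates X (?sq (insert y S)) nrm"
  proof -
    have "dominates X (\<lambda>f. ennreal (w y) * ennreal (norm (f y) powr p)) nrm"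
      using w0[of y] by (intro dominates_cmult eval_dominates) auto
    moreover have "dominates X (?sq S) (?sq (insert x S))" by (rule dominates_le) (simp add: ins[OF x])
    then have "dominates X (?sq S) nrm" using s2 dominates_trans by blast
    ultimately have "dominates X (\<lambda>f. ennreal (w y) * ennreal (norm (f y) powr p) + ?sq S f) nrm" by (rule dominates_add)
    then show ?thesis unfolding ins[OF y, symmetric] .
  qed
  have lo: "dominates X nrm (?sq (insert y S))"
  proof -
    obtain C1 where C1: "C1 \<ge> 0" "\<And>f. f \<in> X \<Longrightarrow> nrm f \<le> ennreal C1 * ?sq (insert x S) f" using s1 unfolding dominates_def by blast
    obtain C2 where C2: "C2 \<ge> 0" "\<And>f. f \<in> X \<Longrightarrow> ennreal (norm (f y) powr p) \<le> ennreal C2 * nrm f"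
      using eval_dominates[of y] unfolding dominates_def by blast
    have SY: "dominates X (?sq S) (?sq (insert y S))" by (rule dominates_le) (simp add: ins[OF y])
    have eS: "dominates X (\<lambda>f. nrm (e f)) (?sq S)"
      by (rule dominatesI[OF C1(1)]) (use C1(2) e in \<open>force simp: sqe\<close>)
    have "dominates X (\<lambda>f. ennreal (norm (e f y) powr p)) (\<lambda>f. nrm (e f))"
      by (rule dominatesI[OF C2(1)]) (use C2(2) e in blast)
    then have eyS: "dominates X (\<lambda>f. ennreal (norm (e f y) powr p)) (?sq S)" using eS dominates_trans by blast
    have fyY: "dominates X (\<lambda>f. ennreal (norm (f y) powr p)) (?sq (insert y S))"
    proof (rule dominatesI[of "1 / w y"])
      fix f :: "complex \<Rightarrow> complex"
      have "ennreal (norm (f y) powr p) = ennreal (1 / w y) * (ennreal (w y) * ennreal (norm (f y) powr p))"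
        using w0[of y] by (simp add: mult.assoc[symmetric] ennreal_mult[symmetric])
      also have "\<dots> \<le> ennreal (1 / w y) * ?sq (insert y S) f" unfolding ins[OF y] by (intro mult_left_mono) auto
      finally show "ennreal (norm (f y) powr p) \<le> ennreal (1 / w y) * ?sq (insert y S) f" .
    qed (use w0[of y] in simp)
    \<comment> \<open>The value f x is recovered from y, since f x * g y = f y - e f y and g y is
      not 0.\<close>
    have fx: "dominates X (\<lambda>f. ennreal (norm (f x) powr p)) (\<lambda>f. ennreal (norm (f y) powr p) + ennreal (norm (e f y) powr p))"
    proof (rule dominatesI[of "2 powr p / norm (g y) powr p"])
      fix f :: "complex \<Rightarrow> complex"
      have "f x * g y = f y - e f y" by (simp add: e_def)
      then have "norm (f x) * norm (g y) \<le> norm (f y) + norm (e f y)" by (metis norm_mult norm_triangle_ineq4)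
      then have "(norm (f x) * norm (g y)) powr p \<le> (norm (f y) + norm (e f y)) powr p" using p by (intro powr_mono2) auto
      also have "\<dots> \<le> 2 powr p * (norm (f y) powr p + norm (e f y) powr p)" using p by (intro powr_add_le) auto
      finally have "norm (f x) powr p \<le> 2 powr p / norm (g y) powr p * (norm (f y) powr p + norm (e f y) powr p)"
        using gy by (simp add: powr_mult field_simps)
      then show "ennreal (norm (f x) powr p) \<le> ennreal (2 powr p / norm (g y) powr p) * (ennreal (norm (f y) powr p) + ennreal (norm (e f y) powr p))"
        by (simp add: ennreal_mult[symmetric] ennreal_plus[symmetric] ennreal_leI del: ennreal_plus)
    qed simp
    have fxY: "dominates X (\<lambda>f. ennreal (norm (f x) powr p)) (?sq (insert y S))"
      by (rule dominates_trans[OF fx dominates_add[OF fyY dominates_trans[OF eyS SY]]])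
    obtain G where G: "nrm g = ennreal G" "G \<ge> 0" using ennreal_finite_ex[OF less_imp_neq[OF g(2)]] by blast
    have "dominates X nrm (\<lambda>f. nrm (e f) + ennreal G * ennreal (norm (f x) powr p))"
    proof (rule dominatesI[of "2 powr p"])
      fix f assume "f \<in> X"
      then have eX: "e f \<in> X" by (rule e)
      have "f = (\<lambda>z. 1 * e f z + f x * g z)" by (auto simp: e_def)
      then have "nrm f = nrm (\<lambda>z. 1 * e f z + f x * g z)" by simp
      also have "\<dots> \<le> ennreal (2 powr p) * (ennreal (norm (1::complex) powr p) * nrm (e f) + ennreal (norm (f x) powr p) * nrm g)"
        by (rule nrm_linear) (use eX g in \<open>auto simp: X_iff\<close>)
      finally show "nrm f \<le> ennreal (2 powr p) * (nrm (e f) + ennreal G * ennreal (norm (f x) powr p))" by (simp add: G(1) mult.commute)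
    qed simp
    then show ?thesis
      by (rule dominates_trans[OF _ dominates_add[OF dominates_trans[OF eS SY] dominates_cmult[OF fxY G(2)]]])
  qed
  have "interpolating p \<phi> (insert y S)" unfolding interpolating_def
  proof (intro allI impI)
    fix v assume v: "?sq (insert y S) v < \<infinity>"
    have "?sq S v \<le> ?sq (insert y S) v" by (simp add: ins[OF y])
    then have "?sq S v < \<infinity>" using v by (rule le_less_trans)
    moreover have "?sq S (v(x := 0)) = ?sq S v" by (rule seq_norm_cong) (use x in auto)
    ultimately have "?sq (insert x S) (v(x := 0)) < \<infinity>" unfolding ins[OF x] using p by simp
    then obtain f where f: "f \<in> X" "\<And>s. s \<in> insert x S \<Longrightarrow> f s = (v(x := 0)) s" using int unfolding interpolating_def by blast
    \<comment> \<open>A multiple of g corrects the value at y without changing those on S.\<close>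
    define c where "c = (v y - f y) / g y"
    define f' where "f' z = 1 * f z + c * g z" for z
    have fh: "f holomorphic_on UNIV" "nrm f < \<infinity>" using f(1) by (auto simp: X_iff)
    have "nrm f' \<le> ennreal (2 powr p) * (ennreal (norm (1::complex) powr p) * nrm f + ennreal (norm c powr p) * nrm g)"
      unfolding f'_def by (rule nrm_linear[OF fh(1) g(1)])
    also have "\<dots> < \<infinity>" using fh g by (simp add: ennreal_mult_less_top)
    finally have "nrm f' < \<infinity>" .
    moreover have "f' holomorphic_on UNIV" unfolding f'_def[abs_def] by (intro holomorphic_intros fh(1) g(1))
    ultimately have "f' \<in> X" by (simp add: X_iff)
    moreover have "f' s = v s" if "s \<in> insert y S" for s
    proof (cases "s = y")
      case True
      then show ?thesis using gy by (simp add: f'_def c_def)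
    next
      case False
      then have "s \<in> S" using that by simp
      moreover have "s \<noteq> x" using x \<open>s \<in> S\<close> by blast
      ultimately show ?thesis using f(2)[of s] g(4)[of s] by (simp add: f'_def)
    qed
    ultimately show "\<exists>f\<in>X. \<forall>s\<in>insert y S. f s = v s" by blast
  qed
  then show ?thesis unfolding complete_interpolating_def sampling_iff using up lo by blast
qed

lemma move_point_iff:
  "x \<notin> S \<Longrightarrow> y \<notin> S \<Longrightarrow> complete_interpolating p \<phi> (insert x S) \<longleftrightarrow> complete_interpolating p \<phi> (insert y S)"
  using move_point by blast

end

section \<open>The averaging condition\<close>

text \<open>The condition \<open>cum\<close> of \<open>balanced\<close>, detached from the node
  sequence.\<close>

definition subcritical :: "(nat \<Rightarrow> real) \<Rightarrow> bool" where
  "subcritical e \<longleftrightarrow> (\<exists>\<eta>>0. \<exists>C. \<forall>m n. m \<le> n \<longrightarrow> \<bar>(\<Sum>i<n. e i) - (\<Sum>i<m. e i)\<bar> \<le> (1/2 - \<eta>) * (real n - real m) + C)"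

definition log_separated :: "(nat \<Rightarrow> complex) \<Rightarrow> bool" where
  "log_separated \<sigma> \<longleftrightarrow> (\<exists>c>0. \<forall>i j. i \<noteq> j \<longrightarrow> c * norm (\<sigma> i) \<le> norm (\<sigma> i - \<sigma> j))"

lemma subcritical_bounded:
  assumes "subcritical e"
  obtains B where "\<And>i. \<bar>e i\<bar> \<le> B"
proof -
  obtain \<eta> C where "\<And>m n. m \<le> n \<Longrightarrow> \<bar>(\<Sum>i<n. e i) - (\<Sum>i<m. e i)\<bar> \<le> (1/2 - \<eta>) * (real n - real m) + C"
    using assms unfolding subcritical_def by blast
  from this[of i "Suc i" for i] have "\<bar>e i\<bar> \<le> (1/2 - \<eta>) + C" for i by simp
  then show thesis by (rule that)
qed

lemma subcritical_Suc: "subcritical (\<lambda>i. e (Suc i)) \<longleftrightarrow> subcritical e"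
proof
  have sh: "(\<Sum>i<Suc n. e i) = e 0 + (\<Sum>i<n. e (Suc i))" for n by (rule sum.lessThan_Suc_shift)
  assume "subcritical e"
  then obtain \<eta> C where \<eta>: "\<eta> > 0" and b: "\<And>m n. m \<le> n \<Longrightarrow> \<bar>(\<Sum>i<n. e i) - (\<Sum>i<m. e i)\<bar> \<le> (1/2 - \<eta>) * (real n - real m) + C"
    unfolding subcritical_def by blast
  have "\<bar>(\<Sum>i<n. e (Suc i)) - (\<Sum>i<m. e (Suc i))\<bar> \<le> (1/2 - \<eta>) * (real n - real m) + C" if "m \<le> n" for m n
    using b[of "Suc m" "Suc n"] that unfolding sh by simp
  then show "subcritical (\<lambda>i. e (Suc i))" using \<eta> unfolding subcritical_def by blast
next
  have sh: "(\<Sum>i<Suc n. e i) = e 0 + (\<Sum>i<n. e (Suc i))" for n by (rule sum.lessThan_Suc_shift)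
  assume "subcritical (\<lambda>i. e (Suc i))"
  then obtain \<eta> C where \<eta>: "\<eta> > 0" and b: "\<And>m n. m \<le> n \<Longrightarrow> \<bar>(\<Sum>i<n. e (Suc i)) - (\<Sum>i<m. e (Suc i))\<bar> \<le> (1/2 - \<eta>) * (real n - real m) + C"
    unfolding subcritical_def by blast
  have C: "C \<ge> 0" using b[of 0 0] by simp
  \<comment> \<open>The term of index 0 and the one step of length it accounts for go into the
    constant.\<close>
  define C' where "C' = C + \<bar>e 0\<bar> + \<bar>1/2 - \<eta>\<bar>"
  have "\<bar>(\<Sum>i<n. e i) - (\<Sum>i<m. e i)\<bar> \<le> (1/2 - \<eta>) * (real n - real m) + C'" if mn: "m \<le> n" for m n
  proof (cases n)
    case 0
    then show ?thesis using mn C by (simp add: C'_def)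
  next
    case (Suc n')
    show ?thesis
    proof (cases m)
      case 0
      have "\<bar>\<Sum>i<n'. e (Suc i)\<bar> \<le> (1/2 - \<eta>) * real n' + C" using b[of 0 n'] by simp
      moreover have "\<bar>e 0 + (\<Sum>i<n'. e (Suc i))\<bar> \<le> \<bar>e 0\<bar> + \<bar>\<Sum>i<n'. e (Suc i)\<bar>" by (rule abs_triangle_ineq)
      moreover have "(1/2 - \<eta>) * real (Suc n') = (1/2 - \<eta>) * real n' + (1/2 - \<eta>)" by (simp add: algebra_simps)
      moreover have "\<bar>(\<Sum>i<n. e i) - (\<Sum>i<m. e i)\<bar> = \<bar>e 0 + (\<Sum>i<n'. e (Suc i))\<bar>" by (simp only: Suc 0 sh lessThan_0 sum.empty diff_zero)
      moreover have "(1/2 - \<eta>) * (real n - real m) = (1/2 - \<eta>) * real (Suc n')" by (simp only: Suc 0 of_nat_0 diff_zero)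
      ultimately show ?thesis unfolding C'_def by linarith
    next
      case (Suc m')
      have "\<bar>(\<Sum>i<n. e i) - (\<Sum>i<m. e i)\<bar> = \<bar>(\<Sum>i<n'. e (Suc i)) - (\<Sum>i<m'. e (Suc i))\<bar>"
        unfolding \<open>n = Suc n'\<close> Suc sh by simp
      also have "\<dots> \<le> (1/2 - \<eta>) * (real n' - real m') + C" using mn \<open>n = Suc n'\<close> Suc by (intro b) simp
      also have "\<dots> \<le> (1/2 - \<eta>) * (real n - real m) + C'" using \<open>n = Suc n'\<close> Suc by (simp add: C'_def)
      finally show ?thesis .
    qed
  qed
  then show "subcritical e" using \<eta> unfolding subcritical_def by blast
qed

lemma sum_window:
  fixes n N :: nat
  shows "(\<Sum>k=n+1..n+N. d k) = (\<Sum>k<n+N+1. d k) - (\<Sum>k<n+1. d k :: real)"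
  by (induction N) auto

text \<open>A single window length N suffices: a long stretch is cut into windows, and the rest,
  shorter than N, costs at most N B.\<close>

lemma subcritical_of_windows:
  fixes e :: "nat \<Rightarrow> real"
  assumes N: "N \<ge> 1" and \<eta>: "\<eta> > 0" "\<eta> \<le> 1/2" and B: "\<And>i. \<bar>e i\<bar> \<le> B"
    and win: "\<And>n. \<bar>\<Sum>k=n+1..n+N. e k\<bar> \<le> (1/2 - \<eta>) * real N"
  shows "subcritical e"
proof -
  \<comment> \<open>The windows start at index 1 or later, so the argument runs on the shifted
    sequence; index 0 is restored by \<open>subcritical_Suc\<close>.\<close>
  define T where "T n = (\<Sum>i<n. e (Suc i))" for n
  have TS: "(\<Sum>i<Suc n. e i) = e 0 + T n" for n unfolding T_def by (rule sum.lessThan_Suc_shift)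
  have w: "\<bar>T (n + N) - T n\<bar> \<le> (1/2 - \<eta>) * real N" for n
    using win[of n] TS[of "n + N"] TS[of n] unfolding sum_window by simp
  have B0: "B \<ge> 0" using B[of 0] by linarith
  have short: "\<bar>T (m + d) - T m\<bar> \<le> real d * B" for m d
  proof (induction d)
    case (Suc d)
    have "T (m + Suc d) = T (m + d) + e (Suc (m + d))" by (simp add: T_def)
    then show ?case using Suc B[of "Suc (m + d)"] by (simp add: distrib_right)
  qed simp
  have main: "\<bar>T (m + d) - T m\<bar> \<le> (1/2 - \<eta>) * real d + real N * B" for m d
  proof (induction d arbitrary: m rule: less_induct)
    case (less d)
    show ?case
    proof (cases "d < N")
      case True
      have "real d * B \<le> real N * B" using True B0 by (intro mult_right_mono) auto
      moreover have "0 \<le> (1/2 - \<eta>) * real d" using \<eta> by simp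
      ultimately show ?thesis using short[of m d] by linarith
    next
      case False
      have "\<bar>T (m + N + (d - N)) - T (m + N)\<bar> \<le> (1/2 - \<eta>) * real (d - N) + real N * B"
        using N False by (intro less.IH) auto
      moreover have "real (d - N) + real N = real d" using False by simp
      then have "(1/2 - \<eta>) * real (d - N) + (1/2 - \<eta>) * real N = (1/2 - \<eta>) * real d"
        by (simp only: distrib_left[symmetric])
      moreover have "m + N + (d - N) = m + d" using False by simp
      ultimately show ?thesis using w[of m] by (simp add: abs_le_iff)
    qed
  qed
  have "\<bar>(\<Sum>i<n. e (Suc i)) - (\<Sum>i<m. e (Suc i))\<bar> \<le> (1/2 - \<eta>) * (real n - real m) + real N * B" if "m \<le> n" for m n
    using main[of m "n - m"] that by (simp add: of_nat_diff T_def)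
  then have "subcritical (\<lambda>i. e (Suc i))" using \<eta>(1) unfolding subcritical_def by blast
  then show ?thesis by (simp add: subcritical_Suc)
qed

text \<open>Averages of \<delta> must stay, with a margin, in the window of length 1 around c
  divided by a. In one direction \<eta> is the margin; in the other it comes from strictness of the
  inequalities for infimum and supremum.\<close>

lemma subcritical_iff_windows:
  fixes \<delta> :: "nat \<Rightarrow> real" and a c lo hi :: real
  assumes a: "a > 0" and lo: "lo = (c - 1/2) / a" and hi: "hi = (c + 1/2) / a"
  shows "subcritical (\<lambda>i. a * \<delta> i - c) \<longleftrightarrow>
    bounded (range \<delta>) \<and> (\<exists>N\<ge>1. ereal lo < nabla_avg \<delta> N \<and> nabla_avg \<delta> N \<le> Delta_avg \<delta> N \<and> Delta_avg \<delta> N < ereal hi)"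
proof
  have sm: "(\<Sum>k=n+1..n+N. a * \<delta> k - c) = a * (\<Sum>k=n+1..n+N. \<delta> k) - c * real N" for n N
    by (simp add: sum_subtractf sum_distrib_left)
  {
    assume s: "subcritical (\<lambda>i. a * \<delta> i - c)"
    obtain B where B: "\<And>i. \<bar>a * \<delta> i - c\<bar> \<le> B" using subcritical_bounded[OF s] by blast
    have "norm (\<delta> i) \<le> (B + \<bar>c\<bar>) / a" for i
    proof -
      have "a * \<bar>\<delta> i\<bar> = \<bar>a * \<delta> i\<bar>" using a by (simp add: abs_mult)
      then have "a * \<bar>\<delta> i\<bar> \<le> B + \<bar>c\<bar>" using B[of i] by linarith
      then show ?thesis using a by (simp add: field_simps)
    qed
    then have bd: "bounded (range \<delta>)" by (auto simp: bounded_iff)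
    obtain \<eta> C where \<eta>: "\<eta> > 0" and b: "\<And>m n. m \<le> n \<Longrightarrow> \<bar>(\<Sum>i<n. a * \<delta> i - c) - (\<Sum>i<m. a * \<delta> i - c)\<bar> \<le> (1/2 - \<eta>) * (real n - real m) + C"
      using s unfolding subcritical_def by blast
    \<comment> \<open>So large that the bounded error C uses up only half of the margin
      \<eta>.\<close>
    define N where "N = nat \<lceil>2 * C / \<eta>\<rceil> + 1"
    have N: "N \<ge> 1" "2 * C / \<eta> \<le> real N" unfolding N_def by (simp, linarith)
    then have CN: "C \<le> \<eta> / 2 * real N" using \<eta> by (simp add: field_simps)
    have win: "\<bar>1 / real N * (\<Sum>k=n+1..n+N. \<delta> k) - c / a\<bar> \<le> (1/2 - \<eta>/2) / a" for n
    proof -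
      have "\<bar>\<Sum>k=n+1..n+N. a * \<delta> k - c\<bar> \<le> (1/2 - \<eta>) * real N + C"
        unfolding sum_window using b[of "n+1" "n+N+1"] by simp
      then have "\<bar>a * (\<Sum>k=n+1..n+N. \<delta> k) - c * real N\<bar> \<le> (1/2 - \<eta>) * real N + C" unfolding sm .
      also have "\<dots> \<le> (1/2 - \<eta>/2) * real N" using CN by (simp add: algebra_simps)
      finally have "\<bar>a * (\<Sum>k=n+1..n+N. \<delta> k) - c * real N\<bar> / (a * real N) \<le> (1/2 - \<eta>/2) * real N / (a * real N)"
        using a N by (intro divide_right_mono) auto
      moreover have "1 / real N * (\<Sum>k=n+1..n+N. \<delta> k) - c / a = (a * (\<Sum>k=n+1..n+N. \<delta> k) - c * real N) / (a * real N)"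
        using a N by (simp add: field_simps)
      moreover have "\<bar>(a * (\<Sum>k=n+1..n+N. \<delta> k) - c * real N) / (a * real N)\<bar> = \<bar>a * (\<Sum>k=n+1..n+N. \<delta> k) - c * real N\<bar> / (a * real N)"
        unfolding abs_divide using a N by simp
      moreover have "(1/2 - \<eta>/2) * real N / (a * real N) = (1/2 - \<eta>/2) / a" using N by simp
      ultimately show ?thesis by metis
    qed
    have l: "ereal lo < nabla_avg \<delta> N"
    proof -
      have "lo < c / a - (1/2 - \<eta>/2) / a" using \<eta> a unfolding lo by (simp add: field_simps)
      then have "ereal lo < ereal (c / a - (1/2 - \<eta>/2) / a)" by simp
      also have "\<dots> \<le> nabla_avg \<delta> N" unfolding nabla_avg_def
      proof (rule INF_greatest)
        fix n show "ereal (c / a - (1/2 - \<eta>/2) / a) \<le> ereal (1 / real N * (\<Sum>k=n+1..n+N. \<delta> k))"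
          using win[of n] by (simp only: ereal_less_eq abs_le_iff) linarith
      qed
      finally show ?thesis .
    qed
    have u: "Delta_avg \<delta> N < ereal hi"
    proof -
      have "Delta_avg \<delta> N \<le> ereal (c / a + (1/2 - \<eta>/2) / a)" unfolding Delta_avg_def
      proof (rule SUP_least)
        fix n show "ereal (1 / real N * (\<Sum>k=n+1..n+N. \<delta> k)) \<le> ereal (c / a + (1/2 - \<eta>/2) / a)"
          using win[of n] by (simp only: ereal_less_eq abs_le_iff) linarith
      qed
      also have "\<dots> < ereal hi" using \<eta> a unfolding hi by (simp add: field_simps)
      finally show ?thesis .
    qed
    have "nabla_avg \<delta> N \<le> Delta_avg \<delta> N" unfolding nabla_avg_def Delta_avg_def by (rule INF_le_SUP) simp
    then show "bounded (range \<delta>) \<and> (\<exists>N\<ge>1. ereal lo < nabla_avg \<delta> N \<and> nabla_avg \<delta> N \<le> Delta_avg \<delta> N \<and> Delta_avg \<delta> N < ereal hi)"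
      using bd N(1) l u by blast
  }
  assume "bounded (range \<delta>) \<and> (\<exists>N\<ge>1. ereal lo < nabla_avg \<delta> N \<and> nabla_avg \<delta> N \<le> Delta_avg \<delta> N \<and> Delta_avg \<delta> N < ereal hi)"
  then obtain N where bd: "bounded (range \<delta>)" and N: "N \<ge> 1" and l: "ereal lo < nabla_avg \<delta> N" and u: "Delta_avg \<delta> N < ereal hi" by blast
  obtain K where K: "\<And>i. \<bar>\<delta> i\<bar> \<le> K" using bd by (auto simp: bounded_iff)
  obtain l' where l': "lo < l'" "ereal l' < nabla_avg \<delta> N" using ereal_dense2[OF l] by auto
  obtain u' where u': "u' < hi" "Delta_avg \<delta> N < ereal u'" using ereal_dense2[OF u] by auto
  have lw: "l' \<le> 1 / real N * (\<Sum>k=n+1..n+N. \<delta> k)" for n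
  proof -
    have "ereal l' \<le> ereal (1 / real N * (\<Sum>k=n+1..n+N. \<delta> k))"
      using l'(2) unfolding nabla_avg_def by (meson INF_lower UNIV_I less_imp_le order_trans)
    then show ?thesis by simp
  qed
  have uw: "1 / real N * (\<Sum>k=n+1..n+N. \<delta> k) \<le> u'" for n
  proof -
    have "ereal (1 / real N * (\<Sum>k=n+1..n+N. \<delta> k)) \<le> ereal u'"
      using u'(2) unfolding Delta_avg_def by (meson SUP_upper UNIV_I less_imp_le order_trans)
    then show ?thesis by simp
  qed
  \<comment> \<open>The cap 1/2 keeps the slope 1/2 - \<eta> nonnegative, as
    \<open>subcritical_of_windows\<close> requires.\<close>
  define \<eta> where "\<eta> = min (1/2) (min (a * (l' - lo)) (a * (hi - u')))"
  have \<eta>: "\<eta> > 0" "\<eta> \<le> 1/2" "\<eta> \<le> a * (l' - lo)" "\<eta> \<le> a * (hi - u')" using a l'(1) u'(1) by (auto simp: \<eta>_def)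
  show "subcritical (\<lambda>i. a * \<delta> i - c)"
  proof (rule subcritical_of_windows[OF N \<eta>(1,2)])
    show "\<bar>a * \<delta> i - c\<bar> \<le> a * K + \<bar>c\<bar>" for i
    proof -
      have "a * \<bar>\<delta> i\<bar> \<le> a * K" using K[of i] a by (intro mult_left_mono) auto
      then have "\<bar>a * \<delta> i\<bar> \<le> a * K" using a by (simp add: abs_mult)
      then show ?thesis by linarith
    qed
    fix n
    define x where "x = 1 / real N * (\<Sum>k=n+1..n+N. \<delta> k)"
    have S: "(\<Sum>k=n+1..n+N. \<delta> k) = x * real N" using N by (simp add: x_def)
    have lo': "a * lo = c - 1/2" and hi': "a * hi = c + 1/2" using a by (simp_all add: lo hi)
    have "l' \<le> x" "x \<le> u'" unfolding x_def by (rule lw, rule uw)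
    then have "a * l' \<le> a * x" "a * x \<le> a * u'" using a by (auto intro: mult_left_mono)
    moreover have "\<eta> \<le> a * l' - a * lo" "\<eta> \<le> a * hi - a * u'" using \<eta>(3,4) by (simp_all only: right_diff_distrib)
    ultimately have "\<bar>a * x - c\<bar> \<le> 1/2 - \<eta>" using lo' hi' by (intro abs_leI) linarith+
    then have "\<bar>a * x - c\<bar> * real N \<le> (1/2 - \<eta>) * real N" by (intro mult_right_mono) auto
    moreover have "a * (x * real N) - c * real N = (a * x - c) * real N" by (simp add: algebra_simps)
    then have "\<bar>a * (x * real N) - c * real N\<bar> = \<bar>a * x - c\<bar> * real N" by (simp add: abs_mult)
    ultimately show "\<bar>\<Sum>k=n+1..n+N. a * \<delta> k - c\<bar> \<le> (1/2 - \<eta>) * real N" unfolding sm S by simp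
  qed
qed

text \<open>Since the moduli are bounded below, 1 + min rho is comparable to the smaller modulus. If
  one modulus exceeds twice the other, the distance is at least half of the larger one
  anyway.\<close>

lemma d_rho_separated_iff_log_separated:
  assumes \<alpha>: "\<alpha> > 0" and inj: "inj \<gamma>" and r: "r > 0" "\<And>i. r \<le> norm (\<gamma> i)"
  shows "d_rho_separated \<alpha> (range \<gamma>) \<longleftrightarrow> log_separated \<gamma>"
proof
  assume "d_rho_separated \<alpha> (range \<gamma>)"
  then have I0: "0 < (INF (s, s') \<in> {(s, s'). s \<in> range \<gamma> \<and> s' \<in> range \<gamma> \<and> s \<noteq> s'}. ereal (d_rho \<alpha> s s'))" (is "0 < ?I")
    by (simp only: d_rho_separated_def)
  obtain d where d: "0 < d" "ereal d < ?I" using ereal_dense2[OF I0] by (auto simp: zero_ereal_def)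
  have dd: "ereal d \<le> ereal (d_rho \<alpha> s s')" if s: "s \<in> range \<gamma>" "s' \<in> range \<gamma>" "s \<noteq> s'" for s s'
  proof -
    have "?I \<le> (case (s, s') of (s, s') \<Rightarrow> ereal (d_rho \<alpha> s s'))" by (rule INF_lower) (use s in blast)
    then have "?I \<le> ereal (d_rho \<alpha> s s')" by (simp only: prod.case)
    then show ?thesis by (rule order_trans[OF less_imp_le[OF d(2)]])
  qed
  define q where "q = sqrt (2 * \<alpha>)"
  have q: "q > 0" using \<alpha> by (simp add: q_def)
  define c where "c = min (1/2) (d / (2 * q))"
  have c: "c > 0" using d q by (simp add: c_def)
  have "c * norm (\<gamma> i) \<le> norm (\<gamma> i - \<gamma> j)" if ij: "i \<noteq> j" for i j
  proof (cases "norm (\<gamma> i) \<le> 2 * norm (\<gamma> j)")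
    case True
    have "\<gamma> i \<noteq> \<gamma> j" using inj ij by (auto dest: injD)
    then have "d \<le> d_rho \<alpha> (\<gamma> i) (\<gamma> j)" using dd[of "\<gamma> i" "\<gamma> j"] by simp
    moreover have m: "0 \<le> min (rho \<alpha> (\<gamma> i)) (rho \<alpha> (\<gamma> j))" using q by (simp add: rho_def q_def[symmetric])
    ultimately have 1: "d * (1 + min (rho \<alpha> (\<gamma> i)) (rho \<alpha> (\<gamma> j))) \<le> norm (\<gamma> i - \<gamma> j)"
      by (simp add: d_rho_def pos_le_divide_eq)
    have rho: "rho \<alpha> z = norm z / q" for z by (simp add: rho_def q_def)
    have "norm (\<gamma> i) / (2 * q) \<le> min (rho \<alpha> (\<gamma> i)) (rho \<alpha> (\<gamma> j))"
      unfolding rho using True q by (simp add: field_simps)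
    then have "d * (norm (\<gamma> i) / (2 * q)) \<le> d * (1 + min (rho \<alpha> (\<gamma> i)) (rho \<alpha> (\<gamma> j)))" using d by (intro mult_left_mono) auto
    moreover have "c * norm (\<gamma> i) \<le> d / (2 * q) * norm (\<gamma> i)" by (intro mult_right_mono) (auto simp: c_def)
    ultimately show ?thesis using 1 by simp
  next
    case False
    have "c * norm (\<gamma> i) \<le> 1/2 * norm (\<gamma> i)" by (intro mult_right_mono) (auto simp: c_def)
    then show ?thesis using False norm_triangle_ineq2[of "\<gamma> i" "\<gamma> j"] by linarith
  qed
  then show "log_separated \<gamma>" using c unfolding log_separated_def by blast
next
  assume "log_separated \<gamma>"
  then obtain c where c: "c > 0" "\<And>i j. i \<noteq> j \<Longrightarrow> c * norm (\<gamma> i) \<le> norm (\<gamma> i - \<gamma> j)" unfolding log_separated_def by blast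
  define q where "q = sqrt (2 * \<alpha>)"
  have q: "q > 0" using \<alpha> by (simp add: q_def)
  define K where "K = 1 / r + 1 / q"
  have K: "K > 0" using r q by (simp add: K_def add_pos_pos)
  have "ereal (c / K) \<le> (INF (s, s') \<in> {(s, s'). s \<in> range \<gamma> \<and> s' \<in> range \<gamma> \<and> s \<noteq> s'}. ereal (d_rho \<alpha> s s'))"
  proof (rule INF_greatest, clarify)
    fix i j assume "\<gamma> i \<noteq> \<gamma> j"
    then have "i \<noteq> j" by auto
    then have 1: "c * norm (\<gamma> i) \<le> norm (\<gamma> i - \<gamma> j)" by (rule c)
    have g: "norm (\<gamma> i) > 0" using r(1) r(2)[of i] by linarith
    have "1 \<le> norm (\<gamma> i) * (1 / r)" using r(1) r(2)[of i] by (simp add: field_simps)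
    moreover have "min (rho \<alpha> (\<gamma> i)) (rho \<alpha> (\<gamma> j)) \<le> norm (\<gamma> i) * (1 / q)" by (simp add: rho_def q_def)
    ultimately have 2: "1 + min (rho \<alpha> (\<gamma> i)) (rho \<alpha> (\<gamma> j)) \<le> norm (\<gamma> i) * K" by (simp add: K_def distrib_left)
    have 3: "0 < 1 + min (rho \<alpha> (\<gamma> i)) (rho \<alpha> (\<gamma> j))" using q by (intro add_pos_nonneg) (auto simp: rho_def q_def[symmetric])
    have "c / K = c * norm (\<gamma> i) / (norm (\<gamma> i) * K)" using g by simp
    also have "\<dots> \<le> norm (\<gamma> i - \<gamma> j) / (1 + min (rho \<alpha> (\<gamma> i)) (rho \<alpha> (\<gamma> j)))"
      using 1 2 3 by (intro frac_le) auto
    finally show "ereal (c / K) \<le> ereal (d_rho \<alpha> (\<gamma> i) (\<gamma> j))" by (simp add: d_rho_def)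
  qed
  moreover have "0 < ereal (c / K)" using c K by simp
  ultimately show "d_rho_separated \<alpha> (range \<gamma>)" unfolding d_rho_separated_def by (rule order_less_le_trans[rotated])
qed

section \<open>The criterion for node sequences\<close>

context small_fock
begin

lemma complete_interpolating_iff:
  assumes inj: "inj \<sigma>" and nz: "\<And>i. \<sigma> i \<noteq> 0" and mono: "\<And>i. norm (\<sigma> i) \<le> norm (\<sigma> (Suc i))"
  shows "complete_interpolating p \<phi> (range \<sigma>) \<longleftrightarrow> log_separated \<sigma> \<and> subcritical (\<lambda>i. pos (\<sigma> i) - real i)"
proof -
  have mono': "norm (\<sigma> i) \<le> norm (\<sigma> j)" if "i \<le> j" for i j using mono that by (rule lift_Suc_mono_le)
  have "complete_interpolating p \<phi> (range \<sigma>) \<longleftrightarrow> sampling_basis \<sigma>"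
  proof (rule complete_interpolating_range[OF inj])
    show "0 < min 1 (norm (\<sigma> 0))" using nz by simp
    show "min 1 (norm (\<sigma> 0)) \<le> norm (\<sigma> i)" for i using mono'[of 0 i] by simp
  qed simp
  also have "\<dots> \<longleftrightarrow> (\<exists>B c \<eta> C. balanced \<alpha> p \<sigma> B c \<eta> C)" by (rule sampling_basis_iff[OF nz mono'])
  also have "\<dots> \<longleftrightarrow> log_separated \<sigma> \<and> subcritical (\<lambda>i. pos (\<sigma> i) - real i)"
  proof
    assume "\<exists>B c \<eta> C. balanced \<alpha> p \<sigma> B c \<eta> C"
    then obtain B c \<eta> C where "balanced \<alpha> p \<sigma> B c \<eta> C" by blast
    then interpret b: balanced \<alpha> p \<sigma> B c \<eta> C .
    have "log_separated \<sigma>" using b.c b.sep unfolding log_separated_def by blast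
    moreover have "subcritical (\<lambda>i. pos (\<sigma> i) - real i)"
      using b.\<eta> b.cum unfolding subcritical_def b.E_def b.deviation_def by blast
    ultimately show "log_separated \<sigma> \<and> subcritical (\<lambda>i. pos (\<sigma> i) - real i)" by blast
  next
    assume a: "log_separated \<sigma> \<and> subcritical (\<lambda>i. pos (\<sigma> i) - real i)"
    then obtain c where c: "c > 0" "\<And>i j. i \<noteq> j \<Longrightarrow> c * norm (\<sigma> i) \<le> norm (\<sigma> i - \<sigma> j)" unfolding log_separated_def by blast
    obtain B where B: "\<And>i. \<bar>pos (\<sigma> i) - real i\<bar> \<le> B" using subcritical_bounded a by blast
    obtain \<eta> C where \<eta>: "\<eta> > 0" "\<And>m n. m \<le> n \<Longrightarrow> \<bar>(\<Sum>i<n. pos (\<sigma> i) - real i) - (\<Sum>i<m. pos (\<sigma> i) - real i)\<bar> \<le> (1/2 - \<eta>) * (real n - real m) + C"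
      using a unfolding subcritical_def by blast
    interpret nr: near_regular \<alpha> p \<sigma> B c by unfold_locales (use nz B c in auto)
    have "balanced \<alpha> p \<sigma> B c \<eta> C"
      by unfold_locales (use \<eta> in \<open>auto simp: nr.E_def nr.deviation_def\<close>)
    then show "\<exists>B c \<eta> C. balanced \<alpha> p \<sigma> B c \<eta> C" by blast
  qed
  finally show ?thesis .
qed

text \<open>Finitely many nodes are compared with \<gamma> 0 one by one; from index n on the modulus
  is at least twice that of \<gamma> 0, so the distance is at least half the modulus.\<close>

lemma log_separated_prepend:
  assumes inj: "inj \<gamma>" and nz: "\<gamma> 0 \<noteq> 0" and mono: "\<And>i j. i \<le> j \<Longrightarrow> norm (\<gamma> i) \<le> norm (\<gamma> j)"
    and B: "\<And>i. \<bar>pos (\<gamma> i) - real i\<bar> \<le> B" and s: "log_separated (\<lambda>i. \<gamma> (Suc i))"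
  shows "log_separated \<gamma>"
proof -
  obtain c where c: "c > 0" "\<And>i j. i \<noteq> j \<Longrightarrow> c * norm (\<gamma> (Suc i)) \<le> norm (\<gamma> (Suc i) - \<gamma> (Suc j))"
    using s unfolding log_separated_def by blast
  \<comment> \<open>Positions differ from indices by at most B, so node n lies at or beyond the
    position of 2 \<gamma> 0.\<close>
  define n where "n = Suc (nat \<lceil>B + pos (2 * \<gamma> 0)\<rceil>)"
  have g: "norm (\<gamma> i) > 0" for i using nz mono[of 0 i] by (smt (verit) zero_less_norm_iff le0)
  have far: "2 * norm (\<gamma> 0) \<le> norm (\<gamma> n)"
  proof -
    have "pos (2 * \<gamma> 0) \<le> pos (\<gamma> n)" using B[of n] unfolding n_def by linarith
    then have "circ (pos (2 * \<gamma> 0)) \<le> circ (pos (\<gamma> n))" by (rule circ_le)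
    then show ?thesis using norm_circ[of "2 * \<gamma> 0"] norm_circ[of "\<gamma> n"] nz g[of n] by (auto simp: norm_mult)
  qed
  define d where "d = Min ((\<lambda>i. norm (\<gamma> i - \<gamma> 0)) ` {1..n})"
  have d: "d > 0" unfolding d_def by (subst Min_gr_iff) (use inj in \<open>auto simp: n_def dest: injD\<close>)
  have d': "d \<le> norm (\<gamma> i - \<gamma> 0)" if "1 \<le> i" "i \<le> n" for i unfolding d_def using that by (intro Min_le) auto
  define b where "b = min (1/2) (d / norm (\<gamma> n))"
  have b: "b > 0" using d g[of n] by (simp add: b_def)
  have pair: "b * norm (\<gamma> i) \<le> norm (\<gamma> i - \<gamma> 0)" if "i \<ge> 1" for i
  proof (cases "i \<le> n")
    case True
    have "b \<le> d / norm (\<gamma> n)" unfolding b_def by (rule min.cobounded2)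
    then have "b * norm (\<gamma> i) \<le> d / norm (\<gamma> n) * norm (\<gamma> n)" using True g[of n] d by (intro mult_mono mono) auto
    then show ?thesis using d'[of i] that True g[of n] by simp
  next
    case False
    have "b \<le> 1/2" unfolding b_def by (rule min.cobounded1)
    then have "b * norm (\<gamma> i) \<le> 1/2 * norm (\<gamma> i)" by (intro mult_right_mono) auto
    moreover have "norm (\<gamma> n) \<le> norm (\<gamma> i)" using False by (intro mono) auto
    ultimately show ?thesis using far norm_triangle_ineq2[of "\<gamma> i" "\<gamma> 0"] by linarith
  qed
  have "min b c * norm (\<gamma> i) \<le> norm (\<gamma> i - \<gamma> j)" if ij: "i \<noteq> j" for i j
  proof (cases i)
    case 0
    have "min b c * norm (\<gamma> i) \<le> b * norm (\<gamma> i)" by (intro mult_right_mono) auto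
    also have "\<dots> \<le> b * norm (\<gamma> j)" using 0 b by (intro mult_left_mono mono) auto
    also have "\<dots> \<le> norm (\<gamma> j - \<gamma> 0)" using 0 ij by (intro pair) auto
    finally show ?thesis using 0 by (simp add: norm_minus_commute)
  next
    case (Suc i')
    show ?thesis
    proof (cases j)
      case 0
      have "min b c * norm (\<gamma> i) \<le> b * norm (\<gamma> i)" by (intro mult_right_mono) auto
      also have "\<dots> \<le> norm (\<gamma> i - \<gamma> 0)" using Suc by (intro pair) auto
      finally show ?thesis using 0 by simp
    next
      case (Suc j')
      have "min b c * norm (\<gamma> i) \<le> c * norm (\<gamma> i)" by (intro mult_right_mono) auto
      also have "\<dots> \<le> norm (\<gamma> i - \<gamma> j)" using c(2)[of i' j'] \<open>i = Suc i'\<close> Suc ij by simp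
      finally show ?thesis .
    qed
  qed
  then show ?thesis using b c(1) unfolding log_separated_def by (intro exI[of _ "min b c"]) auto
qed

end

lemma log_separated_Suc: "log_separated \<gamma> \<Longrightarrow> log_separated (\<lambda>i. \<gamma> (Suc i))"
  unfolding log_separated_def by (metis nat.inject)

theorem theorem1:
  fixes \<alpha> p q :: real
    and \<gamma> :: "nat \<Rightarrow> complex"
    and \<delta> \<theta> :: "nat \<Rightarrow> real"
    and \<phi> :: "complex \<Rightarrow> real"
    and \<Gamma> :: "complex set"
  assumes "\<alpha> > 0"
    and "1 \<le> p"
    and "hoelder_conjugate p q"
    and "\<phi> = log_weight \<alpha>"
    and "\<Gamma> = range \<gamma>"
    and "inj \<gamma>"
    and "\<And>n. norm (\<gamma> n) \<le> norm (\<gamma> (n + 1))"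
    and "\<And>n. \<gamma> n = of_real (lam \<alpha> n) * of_real (exp (\<delta> n)) * exp (\<i> * of_real (\<theta> n))"
  shows "(p < 4/3 \<longrightarrow>
            (\<forall>x\<in>\<Gamma>. complete_interpolating p \<phi> (\<Gamma> - {x}) \<longleftrightarrow>
               d_rho_separated \<alpha> \<Gamma> \<and> bounded (range \<delta>) \<and>
               (\<exists>N\<ge>1. ereal (- (1 / (4 * \<alpha>) + 1 / (q * \<alpha>))) < nabla_avg \<delta> N \<and>
                       nabla_avg \<delta> N \<le> Delta_avg \<delta> N \<and>
                       Delta_avg \<delta> N < ereal (1 / (4 * \<alpha>) - 1 / (q * \<alpha>)))))
       \<and> (4/3 < p \<and> p < 4 \<longrightarrow>
            (complete_interpolating p \<phi> \<Gamma> \<longleftrightarrow>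
               d_rho_separated \<alpha> \<Gamma> \<and> bounded (range \<delta>) \<and>
               (\<exists>N\<ge>1. ereal (1 / (4 * \<alpha>) - 1 / (q * \<alpha>)) < nabla_avg \<delta> N \<and>
                       nabla_avg \<delta> N \<le> Delta_avg \<delta> N \<and>
                       Delta_avg \<delta> N < ereal (1 / (p * \<alpha>) - 1 / (4 * \<alpha>)))))
       \<and> (4 < p \<longrightarrow>
            (\<forall>x\<in>- \<Gamma>. complete_interpolating p \<phi> (insert x \<Gamma>) \<longleftrightarrow>
               d_rho_separated \<alpha> \<Gamma> \<and> bounded (range \<delta>) \<and>
               (\<exists>N\<ge>1. ereal (1 / (p * \<alpha>) - 1 / (4 * \<alpha>)) < nabla_avg \<delta> N \<and>
                       nabla_avg \<delta> N \<le> Delta_avg \<delta> N \<and>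
                       Delta_avg \<delta> N < ereal (1 / (p * \<alpha>) + 1 / (4 * \<alpha>)))))"
proof -
  interpret small_fock \<alpha> p by unfold_locales (use assms in auto)
  note inj = assms(6)
  have \<phi>: "\<phi> = log_weight \<alpha>" and \<Gamma>: "\<Gamma> = range \<gamma>" by fact+
  have norm\<gamma>: "norm (\<gamma> n) = exp ((1 + real n) / (2 * \<alpha>) + \<delta> n)" for n
    unfolding assms(8)[of n] by (simp add: norm_mult lam_def exp_add)
  have nz: "\<gamma> n \<noteq> 0" for n using norm\<gamma>[of n] by (metis exp_not_eq_zero norm_zero)
  have mono: "norm (\<gamma> i) \<le> norm (\<gamma> (Suc i))" for i using assms(7)[of i] by simp
  have mono': "norm (\<gamma> i) \<le> norm (\<gamma> j)" if "i \<le> j" for i j using mono that by (rule lift_Suc_mono_le)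
  have pos\<gamma>: "pos (\<gamma> n) = 1 + real n + 2 * \<alpha> * \<delta> n - 2 / p" for n
    unfolding pos_def norm\<gamma> using \<alpha> by (simp add: field_simps)
  \<comment> \<open>For p = 1 the encoding gives q = 0 and 1 / q = 0, and the formula still
    holds.\<close>
  have qq: "1 / (q * \<alpha>) = 1 / \<alpha> - 1 / (p * \<alpha>)"
  proof -
    have "1 / q = 1 - 1 / p" using assms(3) by (simp add: hoelder_conjugate_def)
    moreover have "1 / (q * \<alpha>) = 1 / q * (1 / \<alpha>)" by simp
    ultimately show ?thesis by (simp add: diff_divide_distrib)
  qed
  have a2: "2 * \<alpha> > 0" using \<alpha> by simp
  have p0: "p > 0" using p by simp
  have sep: "d_rho_separated \<alpha> \<Gamma> \<longleftrightarrow> log_separated \<gamma>"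
    unfolding \<Gamma> by (rule d_rho_separated_iff_log_separated[OF \<alpha> inj, of "norm (\<gamma> 0)"]) (use nz mono' in auto)
  \<comment> \<open>The one criterion behind all three cases; c is the centre of the admissible
    window for averages of 2 \<alpha> \<delta>.\<close>
  define crit where "crit c \<longleftrightarrow> log_separated \<gamma> \<and> subcritical (\<lambda>i. 2 * \<alpha> * \<delta> i - c)" for c
  have crit: "crit c \<longleftrightarrow> d_rho_separated \<alpha> \<Gamma> \<and> bounded (range \<delta>) \<and>
      (\<exists>N\<ge>1. ereal lo < nabla_avg \<delta> N \<and> nabla_avg \<delta> N \<le> Delta_avg \<delta> N \<and> Delta_avg \<delta> N < ereal hi)"
    if "lo = (c - 1/2) / (2 * \<alpha>)" "hi = (c + 1/2) / (2 * \<alpha>)" for c lo hi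
    unfolding crit_def sep subcritical_iff_windows[OF a2 that] ..
  have bounded_pos: "\<exists>B. \<forall>i. \<bar>pos (\<gamma> i) - real i\<bar> \<le> B" if s: "subcritical (\<lambda>i. 2 * \<alpha> * \<delta> i - c)" for c
  proof -
    obtain B where B: "\<And>i. \<bar>2 * \<alpha> * \<delta> i - c\<bar> \<le> B" using subcritical_bounded[OF s] by blast
    have "\<bar>pos (\<gamma> i) - real i\<bar> \<le> B + \<bar>1 - 2 / p + c\<bar>" for i using B[of i] unfolding pos\<gamma> by linarith
    then show ?thesis by blast
  qed
  have A: "complete_interpolating p \<phi> (\<Gamma> - {x}) \<longleftrightarrow> crit (2 / p - 2)" if x: "x \<in> \<Gamma>" for x
  proof -
    \<comment> \<open>With \<gamma> 0 as the removed point the rest stays ordered, and node n + 1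
      receives index n, which lowers the centre by 1.\<close>
    define \<sigma> where "\<sigma> i = \<gamma> (Suc i)" for i
    have rng: "range \<sigma> = \<Gamma> - {\<gamma> 0}"
    proof
      show "range \<sigma> \<subseteq> \<Gamma> - {\<gamma> 0}" using inj by (auto simp: \<sigma>_def \<Gamma> dest: injD)
      show "\<Gamma> - {\<gamma> 0} \<subseteq> range \<sigma>"
      proof
        fix s assume "s \<in> \<Gamma> - {\<gamma> 0}"
        then obtain n where "s = \<gamma> n" "n \<noteq> 0" by (auto simp: \<Gamma>)
        then show "s \<in> range \<sigma>" by (cases n) (auto simp: \<sigma>_def)
      qed
    qed
    have "complete_interpolating p \<phi> (\<Gamma> - {x}) \<longleftrightarrow> complete_interpolating p \<phi> (range \<sigma>)"
    proof (cases "x = \<gamma> 0")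
      case False
      have "\<Gamma> - {x} = insert (\<gamma> 0) (\<Gamma> - {x, \<gamma> 0})" "\<Gamma> - {\<gamma> 0} = insert x (\<Gamma> - {x, \<gamma> 0})"
        using x False by (auto simp: \<Gamma>)
      then show ?thesis unfolding rng \<phi> using move_point_iff[of "\<gamma> 0" "\<Gamma> - {x, \<gamma> 0}" x] by simp
    qed (simp add: rng)
    also have "\<dots> \<longleftrightarrow> log_separated \<sigma> \<and> subcritical (\<lambda>i. pos (\<sigma> i) - real i)"
      unfolding \<phi> by (rule complete_interpolating_iff) (use inj nz mono in \<open>auto simp: \<sigma>_def inj_def\<close>)
    also have "(\<lambda>i. pos (\<sigma> i) - real i) = (\<lambda>i. 2 * \<alpha> * \<delta> (Suc i) - (2 / p - 2))" by (auto simp: \<sigma>_def pos\<gamma>)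
    also have "subcritical (\<lambda>i. 2 * \<alpha> * \<delta> (Suc i) - (2 / p - 2)) \<longleftrightarrow> subcritical (\<lambda>i. 2 * \<alpha> * \<delta> i - (2 / p - 2))"
      by (rule subcritical_Suc)
    also have "log_separated \<sigma> \<and> subcritical (\<lambda>i. 2 * \<alpha> * \<delta> i - (2 / p - 2)) \<longleftrightarrow> crit (2 / p - 2)"
    proof -
      \<comment> \<open>Subcriticality bounds the positions, and this lets the separation of the
        tail extend to \<gamma> 0.\<close>
      have "log_separated \<gamma>" if s: "subcritical (\<lambda>i. 2 * \<alpha> * \<delta> i - (2 / p - 2))" "log_separated \<sigma>"
      proof -
        obtain B where "\<And>i. \<bar>pos (\<gamma> i) - real i\<bar> \<le> B" using bounded_pos[OF s(1)] by blast
        then show ?thesis using s(2) unfolding \<sigma>_def by (intro log_separated_prepend[OF inj nz mono'])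
      qed
      moreover have "\<sigma> = (\<lambda>i. \<gamma> (Suc i))" by (simp add: \<sigma>_def fun_eq_iff)
      ultimately show ?thesis unfolding crit_def using log_separated_Suc[of \<gamma>] by auto
    qed
    finally show ?thesis .
  qed
  have B: "complete_interpolating p \<phi> \<Gamma> \<longleftrightarrow> crit (2 / p - 1)"
  proof -
    have "(\<lambda>i. pos (\<gamma> i) - real i) = (\<lambda>i. 2 * \<alpha> * \<delta> i - (2 / p - 1))" by (auto simp: pos\<gamma>)
    then show ?thesis unfolding \<phi> \<Gamma> crit_def complete_interpolating_iff[OF inj nz mono] by simp
  qed
  have C: "complete_interpolating p \<phi> (insert x \<Gamma>) \<longleftrightarrow> crit (2 / p)" if x: "x \<in> - \<Gamma>" for x
  proof -
    \<comment> \<open>The added point lies inside all other nodes and can be put first without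
      disturbing the order. It is nonzero, and its distance from each node is at least half the
      modulus of that node.\<close>
    define y where "y = \<gamma> 0 / 2"
    have ny: "norm y = norm (\<gamma> 0) / 2" by (simp add: y_def norm_divide)
    have ylt: "norm y \<le> norm (\<gamma> i) / 2" "norm y < norm (\<gamma> i)" for i
      using mono'[of 0 i] nz[of 0] unfolding ny by (auto simp flip: zero_less_norm_iff)
    have y\<Gamma>: "y \<notin> \<Gamma>" using ylt(2) by (force simp: \<Gamma>)
    define \<sigma> where "\<sigma> i = (case i of 0 \<Rightarrow> y | Suc k \<Rightarrow> \<gamma> k)" for i
    have \<sigma>S: "\<sigma> 0 = y" "\<sigma> (Suc k) = \<gamma> k" for k by (simp_all add: \<sigma>_def)
    have rng: "range \<sigma> = insert y \<Gamma>"
    proof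
      show "range \<sigma> \<subseteq> insert y \<Gamma>" by (auto simp: \<sigma>_def \<Gamma> split: nat.splits)
      show "insert y \<Gamma> \<subseteq> range \<sigma>" using \<sigma>S by (auto simp: \<Gamma>) (metis rangeI)+
    qed
    have injS: "inj \<sigma>"
    proof (rule injI)
      fix i j assume ij: "\<sigma> i = \<sigma> j"
      show "i = j"
        by (cases i; cases j) (use ij y\<Gamma> inj in \<open>auto simp: \<sigma>S \<Gamma> dest: injD\<close>)
    qed
    have nzS: "\<sigma> i \<noteq> 0" for i using nz by (cases i) (auto simp: \<sigma>S y_def)
    have monoS: "norm (\<sigma> i) \<le> norm (\<sigma> (Suc i))" for i
      using mono ylt(2)[of 0] by (cases i) (auto simp: \<sigma>S)
    have "complete_interpolating p \<phi> (insert x \<Gamma>) \<longleftrightarrow> complete_interpolating p \<phi> (range \<sigma>)"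
      unfolding rng \<phi> using x y\<Gamma> by (intro move_point_iff) auto
    also have "\<dots> \<longleftrightarrow> log_separated \<sigma> \<and> subcritical (\<lambda>i. pos (\<sigma> i) - real i)"
      unfolding \<phi> by (rule complete_interpolating_iff[OF injS nzS monoS])
    also have "subcritical (\<lambda>i. pos (\<sigma> i) - real i) \<longleftrightarrow> subcritical (\<lambda>i. pos (\<sigma> (Suc i)) - real (Suc i))"
      by (rule subcritical_Suc[symmetric])
    also have "(\<lambda>i. pos (\<sigma> (Suc i)) - real (Suc i)) = (\<lambda>i. 2 * \<alpha> * \<delta> i - 2 / p)" by (auto simp: \<sigma>S pos\<gamma>)
    also have "log_separated \<sigma> \<longleftrightarrow> log_separated \<gamma>"
    proof
      assume "log_separated \<sigma>"
      then show "log_separated \<gamma>" using log_separated_Suc[of \<sigma>] by (simp add: \<sigma>S)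
    next
      assume "log_separated \<gamma>"
      then obtain c where c: "c > 0" "\<And>i j. i \<noteq> j \<Longrightarrow> c * norm (\<gamma> i) \<le> norm (\<gamma> i - \<gamma> j)" unfolding log_separated_def by blast
      have c1: "min c (1/2) * norm s \<le> c * norm s" "min c (1/2) * norm s \<le> 1/2 * norm s" for s :: complex
        by (intro mult_right_mono; simp)+
      have yg: "norm (\<gamma> k) / 2 \<le> norm (\<gamma> k - y)" for k using norm_triangle_ineq2[of "\<gamma> k" y] ylt(1)[of k] by linarith
      have "min c (1/2) * norm (\<sigma> i) \<le> norm (\<sigma> i - \<sigma> j)" if ij: "i \<noteq> j" for i j
      proof (cases i)
        case 0
        then obtain k where k: "j = Suc k" using ij by (cases j) auto
        have "min c (1/2) * norm y \<le> norm (\<gamma> k - y)" using c1(2)[of y] yg[of k] ylt(1)[of k] norm_ge_zero[of y] by linarith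
        then show ?thesis by (simp add: 0 k \<sigma>S norm_minus_commute)
      next
        case (Suc k)
        show ?thesis
        proof (cases j)
          case 0
          show ?thesis using c1(2)[of "\<gamma> k"] yg[of k] by (simp add: 0 Suc \<sigma>S)
        next
          case (Suc l)
          show ?thesis using c1(1)[of "\<gamma> k"] c(2)[of k l] ij \<open>i = Suc k\<close> Suc by (simp add: \<sigma>S)
        qed
      qed
      then show "log_separated \<sigma>" using c(1) unfolding log_separated_def by (intro exI[of _ "min c (1/2)"]) auto
    qed
    finally show ?thesis by (simp add: crit_def)
  qed
  \<comment> \<open>The end points (c - 1/2) / (2 \<alpha>) and (c + 1/2) / (2 \<alpha>) for the
    three centres.\<close>
  have e1: "- (1 / (4 * \<alpha>) + 1 / (q * \<alpha>)) = (2 / p - 2 - 1/2) / (2 * \<alpha>)"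
    and e2: "1 / (4 * \<alpha>) - 1 / (q * \<alpha>) = (2 / p - 2 + 1/2) / (2 * \<alpha>)"
    and e3: "1 / (4 * \<alpha>) - 1 / (q * \<alpha>) = (2 / p - 1 - 1/2) / (2 * \<alpha>)"
    and e4: "1 / (p * \<alpha>) - 1 / (4 * \<alpha>) = (2 / p - 1 + 1/2) / (2 * \<alpha>)"
    and e5: "1 / (p * \<alpha>) - 1 / (4 * \<alpha>) = (2 / p - 1/2) / (2 * \<alpha>)"
    and e6: "1 / (p * \<alpha>) + 1 / (4 * \<alpha>) = (2 / p + 1/2) / (2 * \<alpha>)"
    unfolding qq using \<alpha> p0 by (simp_all add: field_simps)
  show ?thesis
    using A B C crit[OF e1 e2] crit[OF e3 e4] crit[OF e5 e6] by blast
qed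

end
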